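(* The bicategory $\mathbf{Firm}$ of firm rings, firm bimodules and bimodule homomorphisms is biclosed.
   Context: Rings are associative but need not have a unit. A right module $M$ over a ring $A$ is firm if the map $M\otimes_A A\to M$, $m\otimes a\mapsto ma$, is an isomorphism; similarly for left modules. A ring $A$ is firm if it is firm as a (left, equivalently right) $A$-module. An $A$-$B$-bimodule is firm if it is firm both as a left $A$-module and as a right $B$-module. $\mathbf{Firm}$ is the bicategory whose 0-cells are firm rings, whose 1-cells $A\to B$ are firm $A$-$B$-bimodules, and whose 2-cells are bimodule homomorphisms; the horizontal composite of $M:A\to B$ and $N:B\to C$, written $N\otimes M$, is $M\otimes_B N$. A bicategory $\mathbb{B}$ is biclosed if for every 1-cell $f:\mathcal{A}\to\mathcal{B}$ and every 0-cell $\mathcal{C}$, both functors $f\otimes-:\mathbb{B}(\mathcal{C},\mathcal{A})\to\mathbb{B}(\mathcal{C},\mathcal{B})$ and $-\otimes f:\mathbb{B}(\mathcal{B},\mathcal{C})\to\mathbb{B}(\mathcal{A},\mathcal{C})$ (horizontal composition with $f$) have right adjoints. *)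

theory Defs
  imports "HOL-Algebra.Module" "HOL-Algebra.Free_Abelian_Groups" "HOL-Library.Equipollence"
begin

section \<open>Categories, functors, adjoints\<close>

text \<open>
  Hom-sets are indexed by their endpoints and need not be disjoint, so composition and the action
  of functors on arrows take the objects involved as arguments: \<open>Comp C X Y Z g f\<close> is the
  composite of \<open>f : X \<rightarrow> Y\<close> and \<open>g : Y \<rightarrow> Z\<close>.
\<close>

record ('x, 'h) category_data =
  Obj :: "'x set"
  Hom :: "'x \<Rightarrow> 'x \<Rightarrow> 'h set"
  Id :: "'x \<Rightarrow> 'h"
  Comp :: "'x \<Rightarrow> 'x \<Rightarrow> 'x \<Rightarrow> 'h \<Rightarrow> 'h \<Rightarrow> 'h"

locale category =
  fixes C :: "('x, 'h) category_data"
  assumes Id_in_Hom: "X \<in> Obj C \<Longrightarrow> Id C X \<in> Hom C X X"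
    and Comp_in_Hom: "\<lbrakk>X \<in> Obj C; Y \<in> Obj C; Z \<in> Obj C; f \<in> Hom C X Y; g \<in> Hom C Y Z\<rbrakk>
      \<Longrightarrow> Comp C X Y Z g f \<in> Hom C X Z"
    and Comp_Id_right: "\<lbrakk>X \<in> Obj C; Y \<in> Obj C; f \<in> Hom C X Y\<rbrakk>
      \<Longrightarrow> Comp C X X Y f (Id C X) = f"
    and Comp_Id_left: "\<lbrakk>X \<in> Obj C; Y \<in> Obj C; f \<in> Hom C X Y\<rbrakk>
      \<Longrightarrow> Comp C X Y Y (Id C Y) f = f"
    and Comp_assoc: "\<lbrakk>W \<in> Obj C; X \<in> Obj C; Y \<in> Obj C; Z \<in> Obj C;
        f \<in> Hom C W X; g \<in> Hom C X Y; h \<in> Hom C Y Z\<rbrakk>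
      \<Longrightarrow> Comp C W Y Z h (Comp C W X Y g f) = Comp C W X Z (Comp C X Y Z h g) f"

definition iso_arrow :: "('x, 'h) category_data \<Rightarrow> 'x \<Rightarrow> 'x \<Rightarrow> 'h \<Rightarrow> bool" where
  "iso_arrow C X Y f \<longleftrightarrow> f \<in> Hom C X Y \<and>
     (\<exists>g \<in> Hom C Y X. Comp C X Y X g f = Id C X \<and> Comp C Y X Y f g = Id C Y)"

definition product_category ::
  "('x, 'h) category_data \<Rightarrow> ('y, 'k) category_data \<Rightarrow> ('x \<times> 'y, 'h \<times> 'k) category_data" where
  "product_category C D =
    \<lparr>Obj = Obj C \<times> Obj D,
     Hom = (\<lambda>(X, Y) (X', Y'). Hom C X X' \<times> Hom D Y Y'),
     Id = (\<lambda>(X, Y). (Id C X, Id D Y)),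
     Comp = (\<lambda>(X, Y) (X', Y') (X'', Y'') (g, k) (f, h).
       (Comp C X X' X'' g f, Comp D Y Y' Y'' k h))\<rparr>"

record ('x, 'h, 'y, 'k) functor_data =
  fobj :: "'x \<Rightarrow> 'y"
  farr :: "'x \<Rightarrow> 'x \<Rightarrow> 'h \<Rightarrow> 'k"

locale functor_between =
  C: category C + D: category D
  for C :: "('x, 'h) category_data" and D :: "('y, 'k) category_data" +
  fixes F :: "('x, 'h, 'y, 'k) functor_data"
  assumes fobj_in_Obj: "X \<in> Obj C \<Longrightarrow> fobj F X \<in> Obj D"
    and farr_in_Hom: "\<lbrakk>X \<in> Obj C; Y \<in> Obj C; f \<in> Hom C X Y\<rbrakk>
      \<Longrightarrow> farr F X Y f \<in> Hom D (fobj F X) (fobj F Y)"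
    and farr_Id: "X \<in> Obj C \<Longrightarrow> farr F X X (Id C X) = Id D (fobj F X)"
    and farr_Comp: "\<lbrakk>X \<in> Obj C; Y \<in> Obj C; Z \<in> Obj C; f \<in> Hom C X Y; g \<in> Hom C Y Z\<rbrakk>
      \<Longrightarrow> farr F X Z (Comp C X Y Z g f)
        = Comp D (fobj F X) (fobj F Y) (fobj F Z) (farr F Y Z g) (farr F X Y f)"

locale adjunction =
  F: functor_between C D F + G: functor_between D C G
  for C :: "('x, 'h) category_data" and D :: "('y, 'k) category_data"
    and F :: "('x, 'h, 'y, 'k) functor_data" and G :: "('y, 'k, 'x, 'h) functor_data" +
  fixes \<phi> :: "'x \<Rightarrow> 'y \<Rightarrow> 'k \<Rightarrow> 'h"
  assumes bij: "\<lbrakk>X \<in> Obj C; Y \<in> Obj D\<rbrakk>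
      \<Longrightarrow> bij_betw (\<phi> X Y) (Hom D (fobj F X) Y) (Hom C X (fobj G Y))"
    and natural_left: "\<lbrakk>X \<in> Obj C; X' \<in> Obj C; Y \<in> Obj D;
        u \<in> Hom C X' X; h \<in> Hom D (fobj F X) Y\<rbrakk>
      \<Longrightarrow> \<phi> X' Y (Comp D (fobj F X') (fobj F X) Y h (farr F X' X u))
        = Comp C X' X (fobj G Y) (\<phi> X Y h) u"
    and natural_right: "\<lbrakk>X \<in> Obj C; Y \<in> Obj D; Y' \<in> Obj D;
        h \<in> Hom D (fobj F X) Y; v \<in> Hom D Y Y'\<rbrakk>
      \<Longrightarrow> \<phi> X Y' (Comp D (fobj F X) Y Y' v h)
        = Comp C X (fobj G Y) (fobj G Y') (farr G Y Y' v) (\<phi> X Y h)"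

definition has_right_adjoint ::
  "('x, 'h) category_data \<Rightarrow> ('y, 'k) category_data \<Rightarrow> ('x, 'h, 'y, 'k) functor_data \<Rightarrow> bool" where
  "has_right_adjoint C D F \<longleftrightarrow> (\<exists>G \<phi>. adjunction C D F G \<phi>)"


section \<open>Bicategories\<close>

text \<open>
  \<open>hcomp \<B> a b c\<close> is the composition functor \<open>\<B>(b,c) \<times> \<B>(a,b) \<rightarrow> \<B>(a,c)\<close>, sending \<open>(g, f)\<close>
  to \<open>g \<otimes> f\<close>. The associator at \<open>h, g, f\<close> is a 2-cell \<open>(h \<otimes> g) \<otimes> f \<Rightarrow> h \<otimes> (g \<otimes> f)\<close>, and the
  unitors at \<open>f : a \<rightarrow> b\<close> are 2-cells \<open>1\<^sub>b \<otimes> f \<Rightarrow> f\<close> and \<open>f \<otimes> 1\<^sub>a \<Rightarrow> f\<close>.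
\<close>

record ('o, 'f, 't) bicategory_data =
  Cell0 :: "'o set"
  HomCat :: "'o \<Rightarrow> 'o \<Rightarrow> ('f, 't) category_data"
  unit1 :: "'o \<Rightarrow> 'f"
  hcomp :: "'o \<Rightarrow> 'o \<Rightarrow> 'o \<Rightarrow> ('f \<times> 'f, 't \<times> 't, 'f, 't) functor_data"
  associator :: "'o \<Rightarrow> 'o \<Rightarrow> 'o \<Rightarrow> 'o \<Rightarrow> 'f \<Rightarrow> 'f \<Rightarrow> 'f \<Rightarrow> 't"
  lunitor :: "'o \<Rightarrow> 'o \<Rightarrow> 'f \<Rightarrow> 't"
  runitor :: "'o \<Rightarrow> 'o \<Rightarrow> 'f \<Rightarrow> 't"

abbreviation Cell1 :: "('o, 'f, 't) bicategory_data \<Rightarrow> 'o \<Rightarrow> 'o \<Rightarrow> 'f set" where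
  "Cell1 \<B> a b \<equiv> Obj (HomCat \<B> a b)"

abbreviation Cell2 :: "('o, 'f, 't) bicategory_data \<Rightarrow> 'o \<Rightarrow> 'o \<Rightarrow> 'f \<Rightarrow> 'f \<Rightarrow> 't set" where
  "Cell2 \<B> a b \<equiv> Hom (HomCat \<B> a b)"

abbreviation hcomp1 :: "('o, 'f, 't) bicategory_data \<Rightarrow> 'o \<Rightarrow> 'o \<Rightarrow> 'o \<Rightarrow> 'f \<Rightarrow> 'f \<Rightarrow> 'f" where
  "hcomp1 \<B> a b c g f \<equiv> fobj (hcomp \<B> a b c) (g, f)"

abbreviation hcomp2 :: "('o, 'f, 't) bicategory_data \<Rightarrow> 'o \<Rightarrow> 'o \<Rightarrow> 'o \<Rightarrow>
    'f \<Rightarrow> 'f \<Rightarrow> 'f \<Rightarrow> 'f \<Rightarrow> 't \<Rightarrow> 't \<Rightarrow> 't" where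
  "hcomp2 \<B> a b c g g' f f' \<beta> \<alpha> \<equiv> farr (hcomp \<B> a b c) (g, f) (g', f') (\<beta>, \<alpha>)"

abbreviation vcomp :: "('o, 'f, 't) bicategory_data \<Rightarrow> 'o \<Rightarrow> 'o \<Rightarrow>
    'f \<Rightarrow> 'f \<Rightarrow> 'f \<Rightarrow> 't \<Rightarrow> 't \<Rightarrow> 't" where
  "vcomp \<B> a b \<equiv> Comp (HomCat \<B> a b)"

abbreviation id2 :: "('o, 'f, 't) bicategory_data \<Rightarrow> 'o \<Rightarrow> 'o \<Rightarrow> 'f \<Rightarrow> 't" where
  "id2 \<B> a b \<equiv> Id (HomCat \<B> a b)"

locale bicategory =
  fixes \<B> :: "('o, 'f, 't) bicategory_data"
  assumes HomCat_category: "\<lbrakk>a \<in> Cell0 \<B>; b \<in> Cell0 \<B>\<rbrakk> \<Longrightarrow> category (HomCat \<B> a b)"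
    and unit1_in: "a \<in> Cell0 \<B> \<Longrightarrow> unit1 \<B> a \<in> Cell1 \<B> a a"
    and hcomp_functor: "\<lbrakk>a \<in> Cell0 \<B>; b \<in> Cell0 \<B>; c \<in> Cell0 \<B>\<rbrakk> \<Longrightarrow>
      functor_between (product_category (HomCat \<B> b c) (HomCat \<B> a b)) (HomCat \<B> a c)
        (hcomp \<B> a b c)"
    and associator_iso:
      "\<lbrakk>a \<in> Cell0 \<B>; b \<in> Cell0 \<B>; c \<in> Cell0 \<B>; d \<in> Cell0 \<B>;
        f \<in> Cell1 \<B> a b; g \<in> Cell1 \<B> b c; h \<in> Cell1 \<B> c d\<rbrakk> \<Longrightarrow>
      iso_arrow (HomCat \<B> a d)
        (hcomp1 \<B> a b d (hcomp1 \<B> b c d h g) f)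
        (hcomp1 \<B> a c d h (hcomp1 \<B> a b c g f))
        (associator \<B> a b c d h g f)"
    and associator_natural:
      "\<lbrakk>a \<in> Cell0 \<B>; b \<in> Cell0 \<B>; c \<in> Cell0 \<B>; d \<in> Cell0 \<B>;
        f \<in> Cell1 \<B> a b; g \<in> Cell1 \<B> b c; h \<in> Cell1 \<B> c d;
        f' \<in> Cell1 \<B> a b; g' \<in> Cell1 \<B> b c; h' \<in> Cell1 \<B> c d;
        \<alpha> \<in> Cell2 \<B> a b f f'; \<beta> \<in> Cell2 \<B> b c g g'; \<gamma> \<in> Cell2 \<B> c d h h'\<rbrakk> \<Longrightarrow>
      vcomp \<B> a d
        (hcomp1 \<B> a b d (hcomp1 \<B> b c d h g) f)
        (hcomp1 \<B> a b d (hcomp1 \<B> b c d h' g') f')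
        (hcomp1 \<B> a c d h' (hcomp1 \<B> a b c g' f'))
        (associator \<B> a b c d h' g' f')
        (hcomp2 \<B> a b d (hcomp1 \<B> b c d h g) (hcomp1 \<B> b c d h' g') f f'
          (hcomp2 \<B> b c d h h' g g' \<gamma> \<beta>) \<alpha>)
      = vcomp \<B> a d
        (hcomp1 \<B> a b d (hcomp1 \<B> b c d h g) f)
        (hcomp1 \<B> a c d h (hcomp1 \<B> a b c g f))
        (hcomp1 \<B> a c d h' (hcomp1 \<B> a b c g' f'))
        (hcomp2 \<B> a c d h h' (hcomp1 \<B> a b c g f) (hcomp1 \<B> a b c g' f')
          \<gamma> (hcomp2 \<B> a b c g g' f f' \<beta> \<alpha>))
        (associator \<B> a b c d h g f)"
    and lunitor_iso:
      "\<lbrakk>a \<in> Cell0 \<B>; b \<in> Cell0 \<B>; f \<in> Cell1 \<B> a b\<rbrakk> \<Longrightarrow>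
      iso_arrow (HomCat \<B> a b) (hcomp1 \<B> a b b (unit1 \<B> b) f) f (lunitor \<B> a b f)"
    and lunitor_natural:
      "\<lbrakk>a \<in> Cell0 \<B>; b \<in> Cell0 \<B>; f \<in> Cell1 \<B> a b; f' \<in> Cell1 \<B> a b;
        \<alpha> \<in> Cell2 \<B> a b f f'\<rbrakk> \<Longrightarrow>
      vcomp \<B> a b (hcomp1 \<B> a b b (unit1 \<B> b) f) (hcomp1 \<B> a b b (unit1 \<B> b) f') f'
        (lunitor \<B> a b f')
        (hcomp2 \<B> a b b (unit1 \<B> b) (unit1 \<B> b) f f' (id2 \<B> b b (unit1 \<B> b)) \<alpha>)
      = vcomp \<B> a b (hcomp1 \<B> a b b (unit1 \<B> b) f) f f' \<alpha> (lunitor \<B> a b f)"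
    and runitor_iso:
      "\<lbrakk>a \<in> Cell0 \<B>; b \<in> Cell0 \<B>; f \<in> Cell1 \<B> a b\<rbrakk> \<Longrightarrow>
      iso_arrow (HomCat \<B> a b) (hcomp1 \<B> a a b f (unit1 \<B> a)) f (runitor \<B> a b f)"
    and runitor_natural:
      "\<lbrakk>a \<in> Cell0 \<B>; b \<in> Cell0 \<B>; f \<in> Cell1 \<B> a b; f' \<in> Cell1 \<B> a b;
        \<alpha> \<in> Cell2 \<B> a b f f'\<rbrakk> \<Longrightarrow>
      vcomp \<B> a b (hcomp1 \<B> a a b f (unit1 \<B> a)) (hcomp1 \<B> a a b f' (unit1 \<B> a)) f'
        (runitor \<B> a b f')
        (hcomp2 \<B> a a b f f' (unit1 \<B> a) (unit1 \<B> a) \<alpha> (id2 \<B> a a (unit1 \<B> a)))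
      = vcomp \<B> a b (hcomp1 \<B> a a b f (unit1 \<B> a)) f f' \<alpha> (runitor \<B> a b f)"
    and pentagon:
      "\<lbrakk>a \<in> Cell0 \<B>; b \<in> Cell0 \<B>; c \<in> Cell0 \<B>; d \<in> Cell0 \<B>; e \<in> Cell0 \<B>;
        f \<in> Cell1 \<B> a b; g \<in> Cell1 \<B> b c; h \<in> Cell1 \<B> c d; k \<in> Cell1 \<B> d e;
        gf = hcomp1 \<B> a b c g f; hg = hcomp1 \<B> b c d h g; kh = hcomp1 \<B> c d e k h\<rbrakk> \<Longrightarrow>
      vcomp \<B> a e
        (hcomp1 \<B> a b e (hcomp1 \<B> b c e kh g) f)
        (hcomp1 \<B> a c e kh gf)
        (hcomp1 \<B> a d e k (hcomp1 \<B> a c d h gf))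
        (associator \<B> a c d e k h gf)
        (associator \<B> a b c e kh g f)
      = vcomp \<B> a e
        (hcomp1 \<B> a b e (hcomp1 \<B> b c e kh g) f)
        (hcomp1 \<B> a d e k (hcomp1 \<B> a b d hg f))
        (hcomp1 \<B> a d e k (hcomp1 \<B> a c d h gf))
        (hcomp2 \<B> a d e k k (hcomp1 \<B> a b d hg f) (hcomp1 \<B> a c d h gf)
          (id2 \<B> d e k) (associator \<B> a b c d h g f))
        (vcomp \<B> a e
          (hcomp1 \<B> a b e (hcomp1 \<B> b c e kh g) f)
          (hcomp1 \<B> a b e (hcomp1 \<B> b d e k hg) f)
          (hcomp1 \<B> a d e k (hcomp1 \<B> a b d hg f))
          (associator \<B> a b d e k hg f)
          (hcomp2 \<B> a b e (hcomp1 \<B> b c e kh g) (hcomp1 \<B> b d e k hg) f f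
            (associator \<B> b c d e k h g) (id2 \<B> a b f)))"
    and triangle:
      "\<lbrakk>a \<in> Cell0 \<B>; b \<in> Cell0 \<B>; c \<in> Cell0 \<B>; f \<in> Cell1 \<B> a b; g \<in> Cell1 \<B> b c\<rbrakk> \<Longrightarrow>
      vcomp \<B> a c
        (hcomp1 \<B> a b c (hcomp1 \<B> b b c g (unit1 \<B> b)) f)
        (hcomp1 \<B> a b c g (hcomp1 \<B> a b b (unit1 \<B> b) f))
        (hcomp1 \<B> a b c g f)
        (hcomp2 \<B> a b c g g (hcomp1 \<B> a b b (unit1 \<B> b) f) f (id2 \<B> b c g) (lunitor \<B> a b f))
        (associator \<B> a b b c g (unit1 \<B> b) f)
      = hcomp2 \<B> a b c (hcomp1 \<B> b b c g (unit1 \<B> b)) g f f (runitor \<B> b c g) (id2 \<B> a b f)"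

definition postcomp_functor ::
  "('o, 'f, 't) bicategory_data \<Rightarrow> 'o \<Rightarrow> 'o \<Rightarrow> 'o \<Rightarrow> 'f \<Rightarrow> ('f, 't, 'f, 't) functor_data" where
  "postcomp_functor \<B> c a b f =
    \<lparr>fobj = (\<lambda>x. hcomp1 \<B> c a b f x),
     farr = (\<lambda>x x' \<xi>. hcomp2 \<B> c a b f f x x' (id2 \<B> a b f) \<xi>)\<rparr>"

definition precomp_functor ::
  "('o, 'f, 't) bicategory_data \<Rightarrow> 'o \<Rightarrow> 'o \<Rightarrow> 'o \<Rightarrow> 'f \<Rightarrow> ('f, 't, 'f, 't) functor_data" where
  "precomp_functor \<B> a b c f =
    \<lparr>fobj = (\<lambda>y. hcomp1 \<B> a b c y f),
     farr = (\<lambda>y y' \<eta>. hcomp2 \<B> a b c y y' f f \<eta> (id2 \<B> a b f))\<rparr>"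

locale biclosed_bicategory = bicategory +
  assumes postcomp_adjoint:
      "\<lbrakk>a \<in> Cell0 \<B>; b \<in> Cell0 \<B>; c \<in> Cell0 \<B>; f \<in> Cell1 \<B> a b\<rbrakk> \<Longrightarrow>
      has_right_adjoint (HomCat \<B> c a) (HomCat \<B> c b) (postcomp_functor \<B> c a b f)"
    and precomp_adjoint:
      "\<lbrakk>a \<in> Cell0 \<B>; b \<in> Cell0 \<B>; c \<in> Cell0 \<B>; f \<in> Cell1 \<B> a b\<rbrakk> \<Longrightarrow>
      has_right_adjoint (HomCat \<B> b c) (HomCat \<B> a c) (precomp_functor \<B> a b c f)"


section \<open>Rings without unit and their bimodules\<close>

text \<open>
  Rings and bimodules reuse the record types of \<^theory>\<open>HOL-Algebra.Ring\<close> and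
  \<^theory>\<open>HOL-Algebra.Module\<close>, but not their unital predicates. The field \<open>one\<close> of a ring and,
  as in the library's own modules, the fields \<open>one\<close> and \<open>mult\<close> of a bimodule carry no meaning.
\<close>

locale nonunital_ring = abelian_group R for R :: "('a, 'x) ring_scheme" (structure) +
  assumes m_closed: "\<lbrakk>a \<in> carrier R; b \<in> carrier R\<rbrakk> \<Longrightarrow> a \<otimes> b \<in> carrier R"
    and m_assoc: "\<lbrakk>a \<in> carrier R; b \<in> carrier R; c \<in> carrier R\<rbrakk>
      \<Longrightarrow> (a \<otimes> b) \<otimes> c = a \<otimes> (b \<otimes> c)"
    and l_distr: "\<lbrakk>a \<in> carrier R; b \<in> carrier R; c \<in> carrier R\<rbrakk>
      \<Longrightarrow> (a \<oplus> b) \<otimes> c = a \<otimes> c \<oplus> b \<otimes> c"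
    and r_distr: "\<lbrakk>a \<in> carrier R; b \<in> carrier R; c \<in> carrier R\<rbrakk>
      \<Longrightarrow> c \<otimes> (a \<oplus> b) = c \<otimes> a \<oplus> c \<otimes> b"

record ('a, 'b, 'm) bimodule = "('a, 'm) module" +
  rsmult :: "'m \<Rightarrow> 'b \<Rightarrow> 'm"  (infixl \<open>\<odot>\<^sub>r\<index>\<close> 70)

locale left_module = A: nonunital_ring A + M: abelian_group M
  for A :: "'a ring" and M :: "('a, 'b, 'm) bimodule" +
  assumes smult_closed: "\<lbrakk>a \<in> carrier A; m \<in> carrier M\<rbrakk> \<Longrightarrow> a \<odot>\<^bsub>M\<^esub> m \<in> carrier M"
    and smult_add_scalar: "\<lbrakk>a \<in> carrier A; a' \<in> carrier A; m \<in> carrier M\<rbrakk>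
      \<Longrightarrow> (a \<oplus>\<^bsub>A\<^esub> a') \<odot>\<^bsub>M\<^esub> m = a \<odot>\<^bsub>M\<^esub> m \<oplus>\<^bsub>M\<^esub> a' \<odot>\<^bsub>M\<^esub> m"
    and smult_add: "\<lbrakk>a \<in> carrier A; m \<in> carrier M; m' \<in> carrier M\<rbrakk>
      \<Longrightarrow> a \<odot>\<^bsub>M\<^esub> (m \<oplus>\<^bsub>M\<^esub> m') = a \<odot>\<^bsub>M\<^esub> m \<oplus>\<^bsub>M\<^esub> a \<odot>\<^bsub>M\<^esub> m'"
    and smult_assoc: "\<lbrakk>a \<in> carrier A; a' \<in> carrier A; m \<in> carrier M\<rbrakk>
      \<Longrightarrow> (a \<otimes>\<^bsub>A\<^esub> a') \<odot>\<^bsub>M\<^esub> m = a \<odot>\<^bsub>M\<^esub> (a' \<odot>\<^bsub>M\<^esub> m)"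

locale right_module = B: nonunital_ring B + M: abelian_group M
  for B :: "'b ring" and M :: "('a, 'b, 'm) bimodule" +
  assumes rsmult_closed: "\<lbrakk>m \<in> carrier M; b \<in> carrier B\<rbrakk> \<Longrightarrow> m \<odot>\<^sub>r\<^bsub>M\<^esub> b \<in> carrier M"
    and rsmult_add_scalar: "\<lbrakk>m \<in> carrier M; b \<in> carrier B; b' \<in> carrier B\<rbrakk>
      \<Longrightarrow> m \<odot>\<^sub>r\<^bsub>M\<^esub> (b \<oplus>\<^bsub>B\<^esub> b') = m \<odot>\<^sub>r\<^bsub>M\<^esub> b \<oplus>\<^bsub>M\<^esub> m \<odot>\<^sub>r\<^bsub>M\<^esub> b'"
    and rsmult_add: "\<lbrakk>m \<in> carrier M; m' \<in> carrier M; b \<in> carrier B\<rbrakk>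
      \<Longrightarrow> (m \<oplus>\<^bsub>M\<^esub> m') \<odot>\<^sub>r\<^bsub>M\<^esub> b = m \<odot>\<^sub>r\<^bsub>M\<^esub> b \<oplus>\<^bsub>M\<^esub> m' \<odot>\<^sub>r\<^bsub>M\<^esub> b"
    and rsmult_assoc: "\<lbrakk>m \<in> carrier M; b \<in> carrier B; b' \<in> carrier B\<rbrakk>
      \<Longrightarrow> m \<odot>\<^sub>r\<^bsub>M\<^esub> (b \<otimes>\<^bsub>B\<^esub> b') = (m \<odot>\<^sub>r\<^bsub>M\<^esub> b) \<odot>\<^sub>r\<^bsub>M\<^esub> b'"

locale bimod = left_module A M + right_module B M
  for A :: "'a ring" and B :: "'b ring" and M :: "('a, 'b, 'm) bimodule" +
  assumes smult_rsmult: "\<lbrakk>a \<in> carrier A; m \<in> carrier M; b \<in> carrier B\<rbrakk>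
      \<Longrightarrow> (a \<odot>\<^bsub>M\<^esub> m) \<odot>\<^sub>r\<^bsub>M\<^esub> b = a \<odot>\<^bsub>M\<^esub> (m \<odot>\<^sub>r\<^bsub>M\<^esub> b)"

definition regular_bimodule :: "'a ring \<Rightarrow> ('a, 'a, 'a) bimodule" where
  "regular_bimodule A =
    \<lparr>carrier = carrier A, monoid.mult = undefined, monoid.one = undefined, ring.zero = ring.zero A, ring.add = ring.add A,
     smult = monoid.mult A, rsmult = monoid.mult A\<rparr>"

text \<open>Homomorphisms are taken extensional, so that equality of 2-cells is equality of functions.\<close>

definition bimodule_hom ::
  "'a ring \<Rightarrow> 'b ring \<Rightarrow> ('a, 'b, 'm) bimodule \<Rightarrow> ('a, 'b, 'n) bimodule \<Rightarrow> ('m \<Rightarrow> 'n) set" where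
  "bimodule_hom A B M N =
    {h \<in> hom (add_monoid M) (add_monoid N) \<inter> extensional (carrier M).
      (\<forall>a \<in> carrier A. \<forall>m \<in> carrier M. h (a \<odot>\<^bsub>M\<^esub> m) = a \<odot>\<^bsub>N\<^esub> h m) \<and>
      (\<forall>m \<in> carrier M. \<forall>b \<in> carrier B. h (m \<odot>\<^sub>r\<^bsub>M\<^esub> b) = h m \<odot>\<^sub>r\<^bsub>N\<^esub> b)}"


section \<open>Tensor products and firmness\<close>

text \<open>
  \<open>the_hom G H P\<close> is the (extensional) group homomorphism \<open>G \<rightarrow> H\<close> determined by the property
  \<open>P\<close>, which below always prescribes its values on a generating set of \<open>G\<close>.
\<close>

definition the_hom ::
  "('g, 'x) monoid_scheme \<Rightarrow> ('h, 'y) monoid_scheme \<Rightarrow> (('g \<Rightarrow> 'h) \<Rightarrow> bool) \<Rightarrow> 'g \<Rightarrow> 'h" where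
  "the_hom G H P = (THE h. h \<in> hom G H \<inter> extensional (carrier G) \<and> P h)"

text \<open>
  \<open>M \<otimes>\<^sub>B N\<close> only depends on the right action on \<open>M\<close> and the left action on \<open>N\<close>; the remaining two
  actions induce the bimodule structure.
\<close>

definition tensor_relations ::
  "'b ring \<Rightarrow> ('a, 'b, 'm) bimodule \<Rightarrow> ('b, 'c, 'n) bimodule \<Rightarrow> ('m \<times> 'n \<Rightarrow>\<^sub>0 int) set" where
  "tensor_relations B M N =
    {frag_of (m \<oplus>\<^bsub>M\<^esub> m', n) - frag_of (m, n) - frag_of (m', n) | m m' n.
      m \<in> carrier M \<and> m' \<in> carrier M \<and> n \<in> carrier N} \<union>
    {frag_of (m, n \<oplus>\<^bsub>N\<^esub> n') - frag_of (m, n) - frag_of (m, n') | m n n'.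
      m \<in> carrier M \<and> n \<in> carrier N \<and> n' \<in> carrier N} \<union>
    {frag_of (m \<odot>\<^sub>r\<^bsub>M\<^esub> b, n) - frag_of (m, b \<odot>\<^bsub>N\<^esub> n) | m b n.
      m \<in> carrier M \<and> b \<in> carrier B \<and> n \<in> carrier N}"

definition tensor_subgroup ::
  "'b ring \<Rightarrow> ('a, 'b, 'm) bimodule \<Rightarrow> ('b, 'c, 'n) bimodule \<Rightarrow> ('m \<times> 'n \<Rightarrow>\<^sub>0 int) set" where
  "tensor_subgroup B M N =
    generate (free_Abelian_group (carrier M \<times> carrier N)) (tensor_relations B M N)"

definition tensor_group ::
  "'b ring \<Rightarrow> ('a, 'b, 'm) bimodule \<Rightarrow> ('b, 'c, 'n) bimodule
    \<Rightarrow> ('m \<times> 'n \<Rightarrow>\<^sub>0 int) set monoid" where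
  "tensor_group B M N =
    free_Abelian_group (carrier M \<times> carrier N) Mod tensor_subgroup B M N"

definition tensor_class ::
  "'b ring \<Rightarrow> ('a, 'b, 'm) bimodule \<Rightarrow> ('b, 'c, 'n) bimodule
    \<Rightarrow> 'm \<Rightarrow> 'n \<Rightarrow> ('m \<times> 'n \<Rightarrow>\<^sub>0 int) set" where
  "tensor_class B M N m n =
    tensor_subgroup B M N #>\<^bsub>free_Abelian_group (carrier M \<times> carrier N)\<^esub> frag_of (m, n)"

definition tensor_bimodule ::
  "'b ring \<Rightarrow> ('a, 'b, 'm) bimodule \<Rightarrow> ('b, 'c, 'n) bimodule
    \<Rightarrow> ('a, 'c, ('m \<times> 'n \<Rightarrow>\<^sub>0 int) set) bimodule" where
  "tensor_bimodule B M N =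
    \<lparr>carrier = carrier (tensor_group B M N), monoid.mult = undefined, monoid.one = undefined,
     ring.zero = monoid.one (tensor_group B M N), ring.add = monoid.mult (tensor_group B M N),
     smult = (\<lambda>a. the_hom (tensor_group B M N) (tensor_group B M N)
       (\<lambda>h. \<forall>m \<in> carrier M. \<forall>n \<in> carrier N.
         h (tensor_class B M N m n) = tensor_class B M N (a \<odot>\<^bsub>M\<^esub> m) n)),
     rsmult = (\<lambda>t c. the_hom (tensor_group B M N) (tensor_group B M N)
       (\<lambda>h. \<forall>m \<in> carrier M. \<forall>n \<in> carrier N.
         h (tensor_class B M N m n) = tensor_class B M N m (n \<odot>\<^sub>r\<^bsub>N\<^esub> c)) t)\<rparr>"

definition firm_left :: "'a ring \<Rightarrow> ('a, 'b, 'm) bimodule \<Rightarrow> bool" where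
  "firm_left A M \<longleftrightarrow>
    the_hom (tensor_group A (regular_bimodule A) M) (add_monoid M)
      (\<lambda>h. \<forall>a \<in> carrier A. \<forall>m \<in> carrier M.
        h (tensor_class A (regular_bimodule A) M a m) = a \<odot>\<^bsub>M\<^esub> m)
    \<in> iso (tensor_group A (regular_bimodule A) M) (add_monoid M)"

definition firm_right :: "'b ring \<Rightarrow> ('a, 'b, 'm) bimodule \<Rightarrow> bool" where
  "firm_right B M \<longleftrightarrow>
    the_hom (tensor_group B M (regular_bimodule B)) (add_monoid M)
      (\<lambda>h. \<forall>m \<in> carrier M. \<forall>b \<in> carrier B.
        h (tensor_class B M (regular_bimodule B) m b) = m \<odot>\<^sub>r\<^bsub>M\<^esub> b)
    \<in> iso (tensor_group B M (regular_bimodule B)) (add_monoid M)"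

definition firm_ring :: "'a ring \<Rightarrow> bool" where
  "firm_ring A \<longleftrightarrow> nonunital_ring A \<and>
    firm_left A (regular_bimodule A) \<and> firm_right A (regular_bimodule A)"

definition firm_bimodule :: "'a ring \<Rightarrow> 'b ring \<Rightarrow> ('a, 'b, 'm) bimodule \<Rightarrow> bool" where
  "firm_bimodule A B M \<longleftrightarrow> bimod A B M \<and> firm_left A M \<and> firm_right B M"


section \<open>The bicategory of firm rings\<close>

text \<open>
  HOL has no type of all sets, so the bicategory is formed relative to a type \<open>'u\<close> playing the
  role of a universe: rings and bimodules are carried by small subsets of \<open>'u\<close>, where small means
  of cardinality less than that of \<open>'u\<close>. The universe is required to be infinite and closed under
  power sets in the sense that power sets of small sets are small, i.e. the cardinality of \<open>'u\<close>
  is a strong limit. In particular \<open>'u\<close> may be of inaccessible cardinality.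
\<close>

definition small :: "'u set \<Rightarrow> bool" where
  "small X \<longleftrightarrow> X \<prec> (UNIV :: 'u set)"

definition universe :: "'u itself \<Rightarrow> bool" where
  "universe _ \<longleftrightarrow> infinite (UNIV :: 'u set) \<and>
    (\<forall>X :: 'u set. small X \<longrightarrow> Pow X \<prec> (UNIV :: 'u set))"

definition transport_bimodule ::
  "('m \<Rightarrow> 'n) \<Rightarrow> ('a, 'b, 'm) bimodule \<Rightarrow> ('a, 'b, 'n) bimodule" where
  "transport_bimodule e M = (let d = inv_into (carrier M) e in
    \<lparr>carrier = e ` carrier M, monoid.mult = undefined, monoid.one = undefined, ring.zero = e (ring.zero M),
     ring.add = (\<lambda>x y. e (d x \<oplus>\<^bsub>M\<^esub> d y)),
     smult = (\<lambda>a x. e (a \<odot>\<^bsub>M\<^esub> d x)),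
     rsmult = (\<lambda>x b. e (d x \<odot>\<^sub>r\<^bsub>M\<^esub> b))\<rparr>)"

text \<open>
  Within a universe, the tensor product of small bimodules embeds into \<open>'u\<close>; it is replaced by
  its image under a chosen embedding.
\<close>

definition tensor_embedding ::
  "'u ring \<Rightarrow> ('u, 'u, 'u) bimodule \<Rightarrow> ('u, 'u, 'u) bimodule \<Rightarrow> ('u \<times> 'u \<Rightarrow>\<^sub>0 int) set \<Rightarrow> 'u" where
  "tensor_embedding B M N = (SOME e. inj_on e (carrier (tensor_bimodule B M N)))"

definition tensor ::
  "'u ring \<Rightarrow> ('u, 'u, 'u) bimodule \<Rightarrow> ('u, 'u, 'u) bimodule \<Rightarrow> ('u, 'u, 'u) bimodule" where
  "tensor B M N = transport_bimodule (tensor_embedding B M N) (tensor_bimodule B M N)"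

definition pure_tensor ::
  "'u ring \<Rightarrow> ('u, 'u, 'u) bimodule \<Rightarrow> ('u, 'u, 'u) bimodule \<Rightarrow> 'u \<Rightarrow> 'u \<Rightarrow> 'u" where
  "pure_tensor B M N m n = tensor_embedding B M N (tensor_class B M N m n)"

definition firm_category :: "'u ring \<Rightarrow> 'u ring \<Rightarrow> (('u, 'u, 'u) bimodule, 'u \<Rightarrow> 'u) category_data" where
  "firm_category A B =
    \<lparr>Obj = {M. firm_bimodule A B M \<and> small (carrier M)},
     Hom = bimodule_hom A B,
     Id = (\<lambda>M. restrict id (carrier M)),
     Comp = (\<lambda>M N P g f. compose (carrier M) g f)\<rparr>"

text \<open>For \<open>M : A \<rightarrow> B\<close> and \<open>N : B \<rightarrow> C\<close>, the horizontal composite \<open>N \<otimes> M\<close> is \<open>M \<otimes>\<^sub>B N\<close>.\<close>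

definition firm_hcomp :: "'u ring \<Rightarrow>
    (('u, 'u, 'u) bimodule \<times> ('u, 'u, 'u) bimodule, ('u \<Rightarrow> 'u) \<times> ('u \<Rightarrow> 'u),
     ('u, 'u, 'u) bimodule, 'u \<Rightarrow> 'u) functor_data" where
  "firm_hcomp B =
    \<lparr>fobj = (\<lambda>(N, M). tensor B M N),
     farr = (\<lambda>(N, M) (N', M') (\<beta>, \<alpha>).
       the_hom (add_monoid (tensor B M N)) (add_monoid (tensor B M' N'))
         (\<lambda>h. \<forall>m \<in> carrier M. \<forall>n \<in> carrier N.
           h (pure_tensor B M N m n) = pure_tensor B M' N' (\<alpha> m) (\<beta> n)))\<rparr>"

text \<open>For \<open>M : A \<rightarrow> B\<close>, \<open>N : B \<rightarrow> C\<close> and \<open>P : C \<rightarrow> D\<close>, the associator is the map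
  \<open>M \<otimes>\<^sub>B (N \<otimes>\<^sub>C P) \<rightarrow> (M \<otimes>\<^sub>B N) \<otimes>\<^sub>C P\<close>.\<close>

definition firm_associator :: "'u ring \<Rightarrow> 'u ring \<Rightarrow>
    ('u, 'u, 'u) bimodule \<Rightarrow> ('u, 'u, 'u) bimodule \<Rightarrow> ('u, 'u, 'u) bimodule \<Rightarrow> 'u \<Rightarrow> 'u" where
  "firm_associator B C P N M =
    the_hom (add_monoid (tensor B M (tensor C N P))) (add_monoid (tensor C (tensor B M N) P))
      (\<lambda>h. \<forall>m \<in> carrier M. \<forall>n \<in> carrier N. \<forall>p \<in> carrier P.
        h (pure_tensor B M (tensor C N P) m (pure_tensor C N P n p))
        = pure_tensor C (tensor B M N) P (pure_tensor B M N m n) p)"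

definition Firm :: "('u ring, ('u, 'u, 'u) bimodule, 'u \<Rightarrow> 'u) bicategory_data" where
  "Firm =
    \<lparr>Cell0 = {A. firm_ring A \<and> small (carrier A)},
     HomCat = firm_category,
     unit1 = regular_bimodule,
     hcomp = (\<lambda>A B C. firm_hcomp B),
     associator = (\<lambda>A B C D. firm_associator B C),
     lunitor = (\<lambda>A B M.
       the_hom (add_monoid (tensor B M (regular_bimodule B))) (add_monoid M)
         (\<lambda>h. \<forall>m \<in> carrier M. \<forall>b \<in> carrier B.
           h (pure_tensor B M (regular_bimodule B) m b) = m \<odot>\<^sub>r\<^bsub>M\<^esub> b)),
     runitor = (\<lambda>A B M.
       the_hom (add_monoid (tensor A (regular_bimodule A) M)) (add_monoid M)
         (\<lambda>h. \<forall>a \<in> carrier A. \<forall>m \<in> carrier M.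
           h (pure_tensor A (regular_bimodule A) M a m) = a \<odot>\<^bsub>M\<^esub> m))\<rparr>"

end

theory Submission
  imports Defs "HOL-Algebra.Multiplicative_Group"
begin

text \<open>
  Biclosedness says that bilinear maps are representable in each variable. Given firm bimodules
  \<open>F : A \<rightarrow> B\<close> and \<open>Y : C \<rightarrow> B\<close>, a homomorphism \<open>X \<otimes>\<^sub>A F \<rightarrow> Y\<close> is a bilinear map \<open>X \<times> F \<rightarrow> Y\<close>, and
  currying makes it a homomorphism from \<open>X\<close> to the bimodule \<open>Hom\<^sub>B(F, Y)\<close> of right linear maps.
  That bimodule need not be firm. But firm modules over a firm ring \<open>C\<close> are coreflective: every
  homomorphism from a firm module to \<open>H\<close> factors uniquely through \<open>C \<otimes>\<^sub>C H \<rightarrow> H\<close>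
  (\<open>firm_left_coreflection\<close>). Coreflecting on both sides yields the right adjoint
  \<open>Y \<mapsto> (C \<otimes>\<^sub>C Hom\<^sub>B(F, Y)) \<otimes>\<^sub>A A\<close> of \<open>- \<otimes>\<^sub>A F\<close> (\<open>right_residual\<close>); the second coreflection does not
  destroy firmness on the left, because \<open>M \<otimes> N\<close> is firm on the left as soon as \<open>M\<close> is
  (\<open>firm_left_bitensor\<close>). The adjoint of \<open>F \<otimes>\<^sub>B -\<close> is the same construction for opposite rings and
  bimodules (\<open>left_residual\<close>).

  All of this rests on one predicate, \<open>tensor_product B M N T p\<close>: the balanced map \<open>p\<close> exhibits \<open>T\<close>
  as a tensor product of \<open>M\<close> and \<open>N\<close> over \<open>B\<close>. It holds for the construction by cosets and for its
  copies in the universe, it is symmetric under passage to opposites, and a module is firm precisely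
  when its own action map satisfies it (\<open>firm_left_iff\<close>). It provides two tools: balanced maps
  extend to \<open>T\<close>, and additive maps on \<open>T\<close> that agree on the values of \<open>p\<close> are equal. The second
  tool, iterated, reduces every axiom of a bicategory to a computation with pure tensors.

  The remaining point is size. A tensor product of small bimodules is small by cardinal arithmetic
  when one of them is infinite. When both are finite it is finite, and this matters because the
  cardinal of the universe may be \<open>\<aleph>\<^sub>0\<close>. The bimodule \<open>Hom\<^sub>B(F, Y)\<close> is small because that cardinal
  is a strong limit.
\<close>

section \<open>Additive maps and balanced maps\<close>

abbreviation additive_maps ::
  "('g, 'x) ring_scheme \<Rightarrow> ('h, 'y) ring_scheme \<Rightarrow> ('g \<Rightarrow> 'h) set" where
  "additive_maps G H \<equiv> hom (add_monoid G) (add_monoid H)"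

lemma additive_mapI:
  "\<lbrakk>\<And>x. x \<in> carrier G \<Longrightarrow> h x \<in> carrier H;
    \<And>x y. \<lbrakk>x \<in> carrier G; y \<in> carrier G\<rbrakk> \<Longrightarrow> h (x \<oplus>\<^bsub>G\<^esub> y) = h x \<oplus>\<^bsub>H\<^esub> h y\<rbrakk>
   \<Longrightarrow> h \<in> additive_maps G H"
  by (simp add: hom_def)

lemma additive_map_closed: "\<lbrakk>h \<in> additive_maps G H; x \<in> carrier G\<rbrakk> \<Longrightarrow> h x \<in> carrier H"
  by (auto simp: hom_def)

lemma additive_map_add:
  "\<lbrakk>h \<in> additive_maps G H; x \<in> carrier G; y \<in> carrier G\<rbrakk>
    \<Longrightarrow> h (x \<oplus>\<^bsub>G\<^esub> y) = h x \<oplus>\<^bsub>H\<^esub> h y"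
  by (auto simp: hom_def)

lemma additive_map_zero:
  assumes "abelian_group G" "abelian_group H" "h \<in> additive_maps G H"
  shows "h \<zero>\<^bsub>G\<^esub> = \<zero>\<^bsub>H\<^esub>"
  using hom_one[OF assms(3) abelian_group.a_group[OF assms(1)] abelian_group.a_group[OF assms(2)]]
  by simp

lemma additive_map_compose:
  "\<lbrakk>h \<in> additive_maps G H; k \<in> additive_maps H K\<rbrakk> \<Longrightarrow> (\<lambda>x. k (h x)) \<in> additive_maps G K"
  by (simp add: hom_def Pi_iff)

lemma additive_map_restrict:
  assumes "abelian_group G" "h \<in> additive_maps G H"
  shows "restrict h (carrier G) \<in> additive_maps G H"
  using assms by (auto simp: hom_def abelian_groupE(1))

lemma the_hom_equality:
  assumes "h \<in> hom G H" "h \<in> extensional (carrier G)" "P h"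
    and "\<And>k x. \<lbrakk>k \<in> hom G H; P k; x \<in> carrier G\<rbrakk> \<Longrightarrow> k x = h x"
  shows "the_hom G H P = h"
  unfolding the_hom_def
proof (rule the_equality)
  show "h \<in> hom G H \<inter> extensional (carrier G) \<and> P h"
    using assms by simp
  show "k = h" if "k \<in> hom G H \<inter> extensional (carrier G) \<and> P k" for k
    using that assms by (auto intro: extensionalityI[of _ "carrier G"])
qed

definition balanced :: "'b ring \<Rightarrow> ('a, 'b, 'm) bimodule \<Rightarrow> ('b, 'c, 'n) bimodule
    \<Rightarrow> ('g, 'x) ring_scheme \<Rightarrow> ('m \<Rightarrow> 'n \<Rightarrow> 'g) \<Rightarrow> bool" where
  "balanced B M N G f \<longleftrightarrow>
    (\<forall>m \<in> carrier M. \<forall>n \<in> carrier N. f m n \<in> carrier G) \<and>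
    (\<forall>m \<in> carrier M. \<forall>m' \<in> carrier M. \<forall>n \<in> carrier N. f (m \<oplus>\<^bsub>M\<^esub> m') n = f m n \<oplus>\<^bsub>G\<^esub> f m' n) \<and>
    (\<forall>m \<in> carrier M. \<forall>n \<in> carrier N. \<forall>n' \<in> carrier N. f m (n \<oplus>\<^bsub>N\<^esub> n') = f m n \<oplus>\<^bsub>G\<^esub> f m n') \<and>
    (\<forall>m \<in> carrier M. \<forall>b \<in> carrier B. \<forall>n \<in> carrier N. f (m \<odot>\<^sub>r\<^bsub>M\<^esub> b) n = f m (b \<odot>\<^bsub>N\<^esub> n))"

lemma balancedI:
  assumes "\<And>m n. \<lbrakk>m \<in> carrier M; n \<in> carrier N\<rbrakk> \<Longrightarrow> f m n \<in> carrier G"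
    and "\<And>m m' n. \<lbrakk>m \<in> carrier M; m' \<in> carrier M; n \<in> carrier N\<rbrakk>
      \<Longrightarrow> f (m \<oplus>\<^bsub>M\<^esub> m') n = f m n \<oplus>\<^bsub>G\<^esub> f m' n"
    and "\<And>m n n'. \<lbrakk>m \<in> carrier M; n \<in> carrier N; n' \<in> carrier N\<rbrakk>
      \<Longrightarrow> f m (n \<oplus>\<^bsub>N\<^esub> n') = f m n \<oplus>\<^bsub>G\<^esub> f m n'"
    and "\<And>m b n. \<lbrakk>m \<in> carrier M; b \<in> carrier B; n \<in> carrier N\<rbrakk>
      \<Longrightarrow> f (m \<odot>\<^sub>r\<^bsub>M\<^esub> b) n = f m (b \<odot>\<^bsub>N\<^esub> n)"
  shows "balanced B M N G f"
  using assms by (simp add: balanced_def)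

lemma balanced_closed:
  "\<lbrakk>balanced B M N G f; m \<in> carrier M; n \<in> carrier N\<rbrakk> \<Longrightarrow> f m n \<in> carrier G"
  by (simp add: balanced_def)

lemma balanced_add_left:
  "\<lbrakk>balanced B M N G f; m \<in> carrier M; m' \<in> carrier M; n \<in> carrier N\<rbrakk>
    \<Longrightarrow> f (m \<oplus>\<^bsub>M\<^esub> m') n = f m n \<oplus>\<^bsub>G\<^esub> f m' n"
  by (simp add: balanced_def)

lemma balanced_add_right:
  "\<lbrakk>balanced B M N G f; m \<in> carrier M; n \<in> carrier N; n' \<in> carrier N\<rbrakk>
    \<Longrightarrow> f m (n \<oplus>\<^bsub>N\<^esub> n') = f m n \<oplus>\<^bsub>G\<^esub> f m n'"
  by (simp add: balanced_def)

lemma balanced_middle: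
  "\<lbrakk>balanced B M N G f; m \<in> carrier M; b \<in> carrier B; n \<in> carrier N\<rbrakk>
    \<Longrightarrow> f (m \<odot>\<^sub>r\<^bsub>M\<^esub> b) n = f m (b \<odot>\<^bsub>N\<^esub> n)"
  by (simp add: balanced_def)

lemma balanced_compose:
  assumes "balanced B M N G f" "h \<in> additive_maps G H"
  shows "balanced B M N H (\<lambda>m n. h (f m n))"
  using assms unfolding balanced_def by (simp add: additive_map_closed additive_map_add)

lemma balanced_additive_left:
  "\<lbrakk>balanced B M N G f; n \<in> carrier N\<rbrakk> \<Longrightarrow> (\<lambda>m. f m n) \<in> additive_maps M G"
  by (rule additive_mapI) (auto simp: balanced_def)

lemma balanced_additive_right:
  "\<lbrakk>balanced B M N G f; m \<in> carrier M\<rbrakk> \<Longrightarrow> f m \<in> additive_maps N G"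
  by (rule additive_mapI) (auto simp: balanced_def)


section \<open>Tensor products by their universal property\<close>

text \<open>
  Stated as an induction principle: \<open>T\<close> is the closure of the values of \<open>p\<close> under addition.
\<close>

definition spans :: "('a, 'b, 'm) bimodule \<Rightarrow> ('b, 'c, 'n) bimodule \<Rightarrow> ('t, 'x) ring_scheme
    \<Rightarrow> ('m \<Rightarrow> 'n \<Rightarrow> 't) \<Rightarrow> bool" where
  "spans M N T p \<longleftrightarrow> (\<forall>P. (\<forall>m \<in> carrier M. \<forall>n \<in> carrier N. P (p m n)) \<longrightarrow>
     (\<forall>x \<in> carrier T. \<forall>y \<in> carrier T. P x \<longrightarrow> P y \<longrightarrow> P (x \<oplus>\<^bsub>T\<^esub> y)) \<longrightarrow> (\<forall>x \<in> carrier T. P x))"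

text \<open>
  A universal property with a quantifier over target groups would be tied to one type of targets.
  Instead, \<open>T\<close> is compared with the tensor product constructed by cosets: a homomorphism back to it
  that respects pure tensors is, since these span, an isomorphism.
\<close>

definition tensor_product :: "'b ring \<Rightarrow> ('a, 'b, 'm) bimodule \<Rightarrow> ('b, 'c, 'n) bimodule
    \<Rightarrow> ('t, 'x) ring_scheme \<Rightarrow> ('m \<Rightarrow> 'n \<Rightarrow> 't) \<Rightarrow> bool" where
  "tensor_product B M N T p \<longleftrightarrow> abelian_group T \<and> balanced B M N T p \<and> spans M N T p \<and>
     (\<exists>d \<in> additive_maps T (tensor_bimodule B M N).
       \<forall>m \<in> carrier M. \<forall>n \<in> carrier N. d (p m n) = tensor_class B M N m n)"

lemma tensor_product_abelian_group: "tensor_product B M N T p \<Longrightarrow> abelian_group T"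
  by (simp add: tensor_product_def)

lemma tensor_product_balanced: "tensor_product B M N T p \<Longrightarrow> balanced B M N T p"
  by (simp add: tensor_product_def)

lemma tensor_product_closed:
  "\<lbrakk>tensor_product B M N T p; m \<in> carrier M; n \<in> carrier N\<rbrakk> \<Longrightarrow> p m n \<in> carrier T"
  by (rule balanced_closed[OF tensor_product_balanced])

lemma spans_induct:
  assumes "spans M N T p" "x \<in> carrier T"
    and "\<And>m n. \<lbrakk>m \<in> carrier M; n \<in> carrier N\<rbrakk> \<Longrightarrow> P (p m n)"
    and "\<And>x y. \<lbrakk>x \<in> carrier T; y \<in> carrier T; P x; P y\<rbrakk> \<Longrightarrow> P (x \<oplus>\<^bsub>T\<^esub> y)"
  shows "P x"
  using assms(1)[unfolded spans_def, rule_format, of P x] assms(2-4) by simp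

lemma spans_hom_eq:
  assumes "spans M N T p" "h \<in> additive_maps T G" "k \<in> additive_maps T G"
    and "\<And>m n. \<lbrakk>m \<in> carrier M; n \<in> carrier N\<rbrakk> \<Longrightarrow> h (p m n) = k (p m n)"
    and "x \<in> carrier T"
  shows "h x = k x"
proof (rule spans_induct[where P = "\<lambda>x. h x = k x", OF assms(1,5)])
  show "h (p m n) = k (p m n)" if "m \<in> carrier M" "n \<in> carrier N" for m n
    using that by (rule assms(4))
  show "h (x \<oplus>\<^bsub>T\<^esub> y) = k (x \<oplus>\<^bsub>T\<^esub> y)"
    if "x \<in> carrier T" "y \<in> carrier T" "h x = k x" "h y = k y" for x y
    using that by (simp only: additive_map_add[OF assms(2)] additive_map_add[OF assms(3)])
qed

lemma tensor_product_spans: "tensor_product B M N T p \<Longrightarrow> spans M N T p"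
  by (simp add: tensor_product_def)

lemmas tensor_product_hom_eq = spans_hom_eq[OF tensor_product_spans]

lemma keys_diff_subset:
  "\<lbrakk>Poly_Mapping.keys x \<subseteq> S; Poly_Mapping.keys y \<subseteq> S\<rbrakk> \<Longrightarrow> Poly_Mapping.keys (x - y) \<subseteq> S"
  for x y :: "'e \<Rightarrow>\<^sub>0 int"
  using keys_diff[of x y] by blast

lemma tensor_relations_in_free:
  assumes "right_module B M" "left_module B N"
  shows "tensor_relations B M N \<subseteq> carrier (free_Abelian_group (carrier M \<times> carrier N))"
proof -
  interpret M: right_module B M by fact
  interpret N: left_module B N by fact
  show ?thesis
  proof
    fix r
    assume "r \<in> tensor_relations B M N"
    then show "r \<in> carrier (free_Abelian_group (carrier M \<times> carrier N))"
      unfolding tensor_relations_def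
      by (elim UnE CollectE exE conjE) (simp_all add: keys_diff_subset M.rsmult_closed N.smult_closed)
  qed
qed

context
  fixes B :: "'b ring" and M :: "('a, 'b, 'm) bimodule" and N :: "('b, 'c, 'n) bimodule"
  assumes M: "right_module B M" and N: "left_module B N"
begin

interpretation M: right_module B M by (rule M)
interpretation N: left_module B N by (rule N)

abbreviation (input) "free_pairs \<equiv> free_Abelian_group (carrier M \<times> carrier N)"
abbreviation (input) "relations_span \<equiv> tensor_subgroup B M N"

lemma tensor_subgroup: "subgroup relations_span free_pairs"
  unfolding tensor_subgroup_def
  by (intro group.generate_is_subgroup tensor_relations_in_free M N) simp

lemma tensor_normal: "relations_span \<lhd> free_pairs"
  by (intro comm_group.subgroup_imp_normal abelian_free_Abelian_group tensor_subgroup)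

lemma tensor_bimodule_fields:
  "carrier (tensor_bimodule B M N) = carrier (tensor_group B M N)"
  "x \<oplus>\<^bsub>tensor_bimodule B M N\<^esub> y = x \<otimes>\<^bsub>tensor_group B M N\<^esub> y"
  "\<zero>\<^bsub>tensor_bimodule B M N\<^esub> = \<one>\<^bsub>tensor_group B M N\<^esub>"
  by (simp_all add: tensor_bimodule_def)

lemma hom_tensor_group: "hom (tensor_group B M N) = hom (add_monoid (tensor_bimodule B M N))"
  "hom G (tensor_group B M N) = hom G (add_monoid (tensor_bimodule B M N))"
  by (auto simp: hom_def tensor_bimodule_fields fun_eq_iff)

lemma abelian_group_tensor_bimodule: "abelian_group (tensor_bimodule B M N)"
proof -
  interpret T: comm_group "tensor_group B M N"
    unfolding tensor_group_def
    by (intro comm_group.abelian_FactGroup abelian_free_Abelian_group tensor_subgroup)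
  show ?thesis
    by (rule abelian_groupI) (auto simp: tensor_bimodule_fields T.m_ac intro: T.l_inv)
qed

lemma carrier_tensor_bimodule:
  "carrier (tensor_bimodule B M N) = (\<lambda>x. relations_span #>\<^bsub>free_pairs\<^esub> x) ` carrier free_pairs"
  by (auto simp: tensor_bimodule_def tensor_group_def FactGroup_def RCOSETS_def)

lemma add_tensor_bimodule:
  assumes "x \<in> carrier free_pairs" "y \<in> carrier free_pairs"
  shows "(relations_span #>\<^bsub>free_pairs\<^esub> x) \<oplus>\<^bsub>tensor_bimodule B M N\<^esub> (relations_span #>\<^bsub>free_pairs\<^esub> y) = relations_span #>\<^bsub>free_pairs\<^esub> (x + y)"
  using normal.rcos_sum[OF tensor_normal assms]
  by (simp add: tensor_bimodule_def tensor_group_def FactGroup_def)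

lemma coset_eqI:
  assumes "x \<in> carrier free_pairs" "y \<in> carrier free_pairs" "x - y \<in> relations_span"
  shows "relations_span #>\<^bsub>free_pairs\<^esub> x = relations_span #>\<^bsub>free_pairs\<^esub> y"
proof (rule sym, rule group.repr_independence)
  show "x \<in> relations_span #>\<^bsub>free_pairs\<^esub> y"
    using assms by (force simp: r_coset_def)
qed (use assms tensor_subgroup in auto)

lemma relation_in_subgroup: "r \<in> tensor_relations B M N \<Longrightarrow> r \<in> relations_span"
  unfolding tensor_subgroup_def by (rule generate.incl)

lemma tensor_class_balanced:
  "balanced B M N (tensor_bimodule B M N) (tensor_class B M N)"
proof (rule balancedI)
  note cls = tensor_class_def[of B M N]
  have sum: "Poly_Mapping.keys (x + y) \<subseteq> S"
    if "Poly_Mapping.keys x \<subseteq> S" "Poly_Mapping.keys y \<subseteq> S" for x y :: "'e \<Rightarrow>\<^sub>0 int" and S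
    using that keys_add[of x y] by blast
  fix m m' n n' b
  show "tensor_class B M N m n \<in> carrier (tensor_bimodule B M N)"
    if "m \<in> carrier M" "n \<in> carrier N"
    using that by (simp add: carrier_tensor_bimodule cls)
  show "tensor_class B M N (m \<oplus>\<^bsub>M\<^esub> m') n
      = tensor_class B M N m n \<oplus>\<^bsub>tensor_bimodule B M N\<^esub> tensor_class B M N m' n"
    if "m \<in> carrier M" "m' \<in> carrier M" "n \<in> carrier N"
  proof -
    have "frag_of (m \<oplus>\<^bsub>M\<^esub> m', n) - frag_of (m, n) - frag_of (m', n) \<in> tensor_relations B M N"
      unfolding tensor_relations_def using that by blast
    then have "frag_of (m \<oplus>\<^bsub>M\<^esub> m', n) - (frag_of (m, n) + frag_of (m', n)) \<in> relations_span"
      by (simp add: relation_in_subgroup diff_diff_eq)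
    then show ?thesis
      using that by (simp add: cls add_tensor_bimodule coset_eqI sum)
  qed
  show "tensor_class B M N m (n \<oplus>\<^bsub>N\<^esub> n')
      = tensor_class B M N m n \<oplus>\<^bsub>tensor_bimodule B M N\<^esub> tensor_class B M N m n'"
    if "m \<in> carrier M" "n \<in> carrier N" "n' \<in> carrier N"
  proof -
    have "frag_of (m, n \<oplus>\<^bsub>N\<^esub> n') - frag_of (m, n) - frag_of (m, n') \<in> tensor_relations B M N"
      unfolding tensor_relations_def using that by blast
    then have "frag_of (m, n \<oplus>\<^bsub>N\<^esub> n') - (frag_of (m, n) + frag_of (m, n')) \<in> relations_span"
      by (simp add: relation_in_subgroup diff_diff_eq)
    then show ?thesis
      using that by (simp add: cls add_tensor_bimodule coset_eqI sum)
  qed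
  show "tensor_class B M N (m \<odot>\<^sub>r\<^bsub>M\<^esub> b) n = tensor_class B M N m (b \<odot>\<^bsub>N\<^esub> n)"
    if "m \<in> carrier M" "b \<in> carrier B" "n \<in> carrier N"
  proof -
    have "frag_of (m \<odot>\<^sub>r\<^bsub>M\<^esub> b, n) - frag_of (m, b \<odot>\<^bsub>N\<^esub> n) \<in> tensor_relations B M N"
      unfolding tensor_relations_def using that by blast
    then show ?thesis
      using that by (simp add: cls coset_eqI relation_in_subgroup M.rsmult_closed N.smult_closed)
  qed
qed

text \<open>
  Sums of generators suffice, without differences, because \<open>- (m \<otimes> n) = (- m) \<otimes> n\<close>.
\<close>

lemma tensor_class_spans: "spans M N (tensor_bimodule B M N) (tensor_class B M N)"
  unfolding spans_def
proof (intro allI impI ballI)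
  fix P t
  assume P: "\<forall>m\<in>carrier M. \<forall>n\<in>carrier N. P (tensor_class B M N m n)"
    and P_add: "\<forall>x\<in>carrier (tensor_bimodule B M N). \<forall>y\<in>carrier (tensor_bimodule B M N).
      P x \<longrightarrow> P y \<longrightarrow> P (x \<oplus>\<^bsub>tensor_bimodule B M N\<^esub> y)"
    and "t \<in> carrier (tensor_bimodule B M N)"
  then obtain x where x: "Poly_Mapping.keys x \<subseteq> carrier M \<times> carrier N" "t = relations_span #>\<^bsub>free_pairs\<^esub> x"
    by (auto simp: carrier_tensor_bimodule)
  interpret T: abelian_group "tensor_bimodule B M N" by (rule abelian_group_tensor_bimodule)
  note bal = tensor_class_balanced
  have zero: "relations_span #>\<^bsub>free_pairs\<^esub> 0 = \<zero>\<^bsub>tensor_bimodule B M N\<^esub>"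
    using group.coset_join2[OF group_free_Abelian_group _ tensor_subgroup, of 0]
      subgroup.one_closed[OF tensor_subgroup]
    by (simp add: tensor_bimodule_def tensor_group_def FactGroup_def)
  have cls0: "tensor_class B M N \<zero>\<^bsub>M\<^esub> n = \<zero>\<^bsub>tensor_bimodule B M N\<^esub>" if "n \<in> carrier N" for n
    using additive_map_zero[OF M.M.abelian_group_axioms T.abelian_group_axioms
        balanced_additive_left[OF bal that]] .
  have neg: "relations_span #>\<^bsub>free_pairs\<^esub> (- frag_of (m, n)) = tensor_class B M N (\<ominus>\<^bsub>M\<^esub> m) n"
    if mn: "m \<in> carrier M" "n \<in> carrier N" for m n
  proof -
    have "tensor_class B M N (\<ominus>\<^bsub>M\<^esub> m) n \<oplus>\<^bsub>tensor_bimodule B M N\<^esub> tensor_class B M N m n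
        = \<zero>\<^bsub>tensor_bimodule B M N\<^esub>"
      using mn by (simp add: cls0 balanced_add_left[OF bal, symmetric] M.M.l_neg)
    moreover have "(relations_span #>\<^bsub>free_pairs\<^esub> (- frag_of (m, n))) \<oplus>\<^bsub>tensor_bimodule B M N\<^esub> tensor_class B M N m n
        = \<zero>\<^bsub>tensor_bimodule B M N\<^esub>"
      using mn by (simp add: tensor_class_def add_tensor_bimodule zero)
    moreover have "relations_span #>\<^bsub>free_pairs\<^esub> (- frag_of (m, n)) \<in> carrier (tensor_bimodule B M N)"
      using mn by (simp add: carrier_tensor_bimodule)
    ultimately show ?thesis
      using mn by (metis M.M.a_inv_closed T.minus_equality balanced_closed[OF bal])
  qed
  have "P (relations_span #>\<^bsub>free_pairs\<^esub> x) \<and> P (relations_span #>\<^bsub>free_pairs\<^esub> (- x))"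
  proof (rule free_Abelian_group_induct[OF x(1)])
    show "P (relations_span #>\<^bsub>free_pairs\<^esub> 0) \<and> P (relations_span #>\<^bsub>free_pairs\<^esub> (- 0))"
      using P cls0[OF N.M.zero_closed] N.M.zero_closed M.M.zero_closed zero by (metis neg_0_equal_iff_equal)
  next
    fix x y :: "'m \<times> 'n \<Rightarrow>\<^sub>0 int"
    assume xy: "Poly_Mapping.keys x \<subseteq> carrier M \<times> carrier N" "Poly_Mapping.keys y \<subseteq> carrier M \<times> carrier N"
      "P (relations_span #>\<^bsub>free_pairs\<^esub> x) \<and> P (relations_span #>\<^bsub>free_pairs\<^esub> (- x))" "P (relations_span #>\<^bsub>free_pairs\<^esub> y) \<and> P (relations_span #>\<^bsub>free_pairs\<^esub> (- y))"
    have "relations_span #>\<^bsub>free_pairs\<^esub> (x - y) = (relations_span #>\<^bsub>free_pairs\<^esub> x) \<oplus>\<^bsub>tensor_bimodule B M N\<^esub> (relations_span #>\<^bsub>free_pairs\<^esub> (- y))"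
      "relations_span #>\<^bsub>free_pairs\<^esub> (- (x - y)) = (relations_span #>\<^bsub>free_pairs\<^esub> (- x)) \<oplus>\<^bsub>tensor_bimodule B M N\<^esub> (relations_span #>\<^bsub>free_pairs\<^esub> y)"
      using xy by (simp_all add: add_tensor_bimodule)
    then show "P (relations_span #>\<^bsub>free_pairs\<^esub> (x - y)) \<and> P (relations_span #>\<^bsub>free_pairs\<^esub> (- (x - y)))"
      using xy P_add by (simp add: carrier_tensor_bimodule)
  next
    show "P (relations_span #>\<^bsub>free_pairs\<^esub> frag_of a) \<and> P (relations_span #>\<^bsub>free_pairs\<^esub> (- frag_of a))" if "a \<in> carrier M \<times> carrier N" for a
      using that P neg by (auto simp flip: tensor_class_def)
  qed
  then show "P t"
    using x by simp
qed

lemma tensor_product_tensor_bimodule: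
  "tensor_product B M N (tensor_bimodule B M N) (tensor_class B M N)"
proof -
  have "(\<lambda>x. x) \<in> additive_maps (tensor_bimodule B M N) (tensor_bimodule B M N)"
    by (simp add: hom_def)
  then show ?thesis
    unfolding tensor_product_def
    by (intro conjI bexI[of _ "\<lambda>x. x"] abelian_group_tensor_bimodule tensor_class_balanced
        tensor_class_spans) simp_all
qed

text \<open>
  The extension of \<open>f\<close> to the free abelian group on pairs kills the defining relations.
\<close>

lemma tensor_bimodule_universal:
  assumes G: "abelian_group G" and f: "balanced B M N G f"
  shows "\<exists>h \<in> additive_maps (tensor_bimodule B M N) G.
    \<forall>m \<in> carrier M. \<forall>n \<in> carrier N. h (tensor_class B M N m n) = f m n"
proof -
  interpret G: abelian_group G by (rule G)
  have "case_prod f ` (carrier M \<times> carrier N) \<subseteq> carrier (add_monoid G)"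
    using f by (auto simp: balanced_closed)
  then obtain h where h: "h \<in> hom free_pairs (add_monoid G)"
    and h_of: "\<And>x. x \<in> carrier M \<times> carrier N \<Longrightarrow> h (frag_of x) = case_prod f x"
    using comm_group.free_Abelian_group_universal[OF G.a_comm_group] by metis
  interpret h: group_hom free_pairs "add_monoid G" h
    using h G.a_group by (simp add: group_hom_def group_hom_axioms_def)
  have minus: "h (x - y) = h x \<ominus>\<^bsub>G\<^esub> h y" if "x \<in> carrier free_pairs" "y \<in> carrier free_pairs" for x y
  proof -
    have "h (x + - y) = h x \<oplus>\<^bsub>G\<^esub> h (- y)"
      using h.hom_mult[of x "- y"] that by simp
    moreover have "h (- y) = \<ominus>\<^bsub>G\<^esub> h y"
      using h.hom_inv[of y] that by (simp add: a_inv_def)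
    ultimately show ?thesis by (simp add: G.minus_eq)
  qed
  have cancel: "a \<oplus>\<^bsub>G\<^esub> b \<ominus>\<^bsub>G\<^esub> a \<ominus>\<^bsub>G\<^esub> b = \<zero>\<^bsub>G\<^esub>" if "a \<in> carrier G" "b \<in> carrier G" for a b
  proof -
    have "a \<oplus>\<^bsub>G\<^esub> b \<ominus>\<^bsub>G\<^esub> a \<ominus>\<^bsub>G\<^esub> b = (a \<oplus>\<^bsub>G\<^esub> \<ominus>\<^bsub>G\<^esub> a) \<oplus>\<^bsub>G\<^esub> (b \<oplus>\<^bsub>G\<^esub> \<ominus>\<^bsub>G\<^esub> b)"
      using that by (simp add: G.minus_eq G.a_ac)
    then show ?thesis
      using that by (simp add: G.r_neg)
  qed
  have "tensor_relations B M N \<subseteq> kernel free_pairs (add_monoid G) h"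
  proof
    fix r
    assume r: "r \<in> tensor_relations B M N"
    then have "r \<in> carrier free_pairs"
      using tensor_relations_in_free[OF M N] by blast
    moreover have "h r = \<zero>\<^bsub>G\<^esub>"
      using r unfolding tensor_relations_def
    proof (elim UnE CollectE exE conjE)
      fix m m' n
      assume "r = frag_of (m \<oplus>\<^bsub>M\<^esub> m', n) - frag_of (m, n) - frag_of (m', n)"
        and mn: "m \<in> carrier M" "m' \<in> carrier M" "n \<in> carrier N"
      moreover have "h (frag_of (m \<oplus>\<^bsub>M\<^esub> m', n) - frag_of (m, n) - frag_of (m', n))
          = f m n \<oplus>\<^bsub>G\<^esub> f m' n \<ominus>\<^bsub>G\<^esub> f m n \<ominus>\<^bsub>G\<^esub> f m' n"
        using mn by (simp add: minus h_of keys_diff_subset balanced_add_left[OF f])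
      ultimately show ?thesis
        using mn by (simp add: cancel balanced_closed[OF f])
    next
      fix m n n'
      assume "r = frag_of (m, n \<oplus>\<^bsub>N\<^esub> n') - frag_of (m, n) - frag_of (m, n')"
        and mn: "m \<in> carrier M" "n \<in> carrier N" "n' \<in> carrier N"
      moreover have "h (frag_of (m, n \<oplus>\<^bsub>N\<^esub> n') - frag_of (m, n) - frag_of (m, n'))
          = f m n \<oplus>\<^bsub>G\<^esub> f m n' \<ominus>\<^bsub>G\<^esub> f m n \<ominus>\<^bsub>G\<^esub> f m n'"
        using mn by (simp add: minus h_of keys_diff_subset balanced_add_right[OF f])
      ultimately show ?thesis
        using mn by (simp add: cancel balanced_closed[OF f])
    next
      fix m b n
      assume "r = frag_of (m \<odot>\<^sub>r\<^bsub>M\<^esub> b, n) - frag_of (m, b \<odot>\<^bsub>N\<^esub> n)"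
        and mn: "m \<in> carrier M" "b \<in> carrier B" "n \<in> carrier N"
      moreover have "h (frag_of (m \<odot>\<^sub>r\<^bsub>M\<^esub> b, n) - frag_of (m, b \<odot>\<^bsub>N\<^esub> n))
          = f m (b \<odot>\<^bsub>N\<^esub> n) \<ominus>\<^bsub>G\<^esub> f m (b \<odot>\<^bsub>N\<^esub> n)"
        using mn by (simp add: minus h_of balanced_middle[OF f] M.rsmult_closed N.smult_closed)
      ultimately show ?thesis
        using mn by (simp add: G.minus_eq G.r_neg balanced_closed[OF f] N.smult_closed)
    qed
    ultimately show "r \<in> kernel free_pairs (add_monoid G) h"
      by (simp add: kernel_def)
  qed
  then have "relations_span \<subseteq> kernel free_pairs (add_monoid G) h"
    unfolding tensor_subgroup_def
    by (intro group.generate_subgroup_incl h.subgroup_kernel) simp_all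
  then obtain g where g: "g \<in> hom (free_pairs Mod relations_span) (add_monoid G)"
    "\<And>x. x \<in> carrier free_pairs \<Longrightarrow> g (relations_span #>\<^bsub>free_pairs\<^esub> x) = h x"
    using h.FactGroup_universal_kernel[OF tensor_normal] by blast
  have "g \<in> additive_maps (tensor_bimodule B M N) G"
    using g(1) by (simp add: hom_tensor_group[symmetric] tensor_group_def)
  moreover have "g (tensor_class B M N m n) = f m n" if "m \<in> carrier M" "n \<in> carrier N" for m n
    using that g(2)[of "frag_of (m, n)"] h_of by (simp add: tensor_class_def)
  ultimately show ?thesis by blast
qed

text \<open>
  The target \<open>G\<close> may have any type, because the extension factors through the coset construction.
\<close>

lemma tensor_product_universal:
  assumes T: "tensor_product B M N T p" and G: "abelian_group G" and f: "balanced B M N G f"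
  shows "\<exists>h \<in> additive_maps T G \<inter> extensional (carrier T).
    \<forall>m \<in> carrier M. \<forall>n \<in> carrier N. h (p m n) = f m n"
proof -
  obtain d where d: "d \<in> additive_maps T (tensor_bimodule B M N)"
    and d_p: "\<And>m n. \<lbrakk>m \<in> carrier M; n \<in> carrier N\<rbrakk> \<Longrightarrow> d (p m n) = tensor_class B M N m n"
    using T unfolding tensor_product_def by blast
  obtain h where h: "h \<in> additive_maps (tensor_bimodule B M N) G"
    and h_cls: "\<And>m n. \<lbrakk>m \<in> carrier M; n \<in> carrier N\<rbrakk> \<Longrightarrow> h (tensor_class B M N m n) = f m n"
    using tensor_bimodule_universal[OF G f] by blast
  let ?h = "restrict (\<lambda>x. h (d x)) (carrier T)"
  have "?h \<in> additive_maps T G"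
    using additive_map_restrict[OF tensor_product_abelian_group[OF T] additive_map_compose[OF d h]] .
  moreover have "?h (p m n) = f m n" if "m \<in> carrier M" "n \<in> carrier N" for m n
    using that by (simp add: d_p h_cls tensor_product_closed[OF T])
  ultimately show ?thesis
    by (intro bexI[of _ ?h]) auto
qed

end


lemma additive_map_plus:
  assumes "abelian_group H" "h \<in> additive_maps G H" "k \<in> additive_maps G H"
  shows "(\<lambda>x. h x \<oplus>\<^bsub>H\<^esub> k x) \<in> additive_maps G H"
proof -
  interpret H: abelian_group H by fact
  show ?thesis
    using assms(2,3) by (intro additive_mapI) (simp_all add: additive_map_closed additive_map_add H.a_ac)
qed

lemma abelian_group_cong:
  assumes "abelian_group G" "carrier G' = carrier G" "ring.add G' = ring.add G"
    "ring.zero G' = ring.zero G"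
  shows "abelian_group G'"
proof -
  interpret G: abelian_group G by fact
  show ?thesis
    by (rule abelian_groupI) (auto simp: assms(2-4) G.a_ac intro: G.l_neg)
qed

lemma additive_maps_cong:
  "\<lbrakk>carrier G' = carrier G; ring.add G' = ring.add G; carrier H' = carrier H; ring.add H' = ring.add H\<rbrakk>
    \<Longrightarrow> additive_maps G' H' = additive_maps G H"
  by (simp add: hom_def)

lemma tensor_product_cong:
  assumes T: "tensor_product B M N T p"
    and eq: "carrier T' = carrier T" "ring.add T' = ring.add T" "ring.zero T' = ring.zero T"
  shows "tensor_product B M N T' p"
proof -
  have "balanced B M N T' p = balanced B M N T p" "spans M N T' p = spans M N T p"
    by (simp_all add: balanced_def spans_def eq)
  moreover have "additive_maps T' (tensor_bimodule B M N) = additive_maps T (tensor_bimodule B M N)"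
    by (rule additive_maps_cong) (simp_all add: eq)
  ultimately show ?thesis
    using T abelian_group_cong[OF tensor_product_abelian_group[OF T] eq]
    unfolding tensor_product_def by (simp only:) 
qed

lemma tensor_product_the_hom:
  assumes MN: "right_module B M" "left_module B N"
    and T: "tensor_product B M N T p" and G: "abelian_group G" and f: "balanced B M N G f"
  defines "h \<equiv> the_hom (add_monoid T) (add_monoid G)
    (\<lambda>h. \<forall>m \<in> carrier M. \<forall>n \<in> carrier N. h (p m n) = f m n)"
  shows "h \<in> additive_maps T G" "h \<in> extensional (carrier T)"
    "\<And>m n. \<lbrakk>m \<in> carrier M; n \<in> carrier N\<rbrakk> \<Longrightarrow> h (p m n) = f m n"
proof -
  obtain k where k: "k \<in> additive_maps T G" "k \<in> extensional (carrier T)"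
    "\<And>m n. \<lbrakk>m \<in> carrier M; n \<in> carrier N\<rbrakk> \<Longrightarrow> k (p m n) = f m n"
    using tensor_product_universal[OF MN T G f] by auto
  have "h = k"
    unfolding h_def
    by (rule the_hom_equality) (use k in \<open>auto intro: tensor_product_hom_eq[OF T]\<close>)
  then show "h \<in> additive_maps T G" "h \<in> extensional (carrier T)"
    "\<And>m n. \<lbrakk>m \<in> carrier M; n \<in> carrier N\<rbrakk> \<Longrightarrow> h (p m n) = f m n"
    using k by simp_all
qed

lemma the_hom_tensor_group:
  "the_hom (tensor_group B M N) H P = the_hom (add_monoid (tensor_bimodule B M N)) H P"
  "the_hom H (tensor_group B M N) Q = the_hom H (add_monoid (tensor_bimodule B M N)) Q"
proof -
  have "hom (tensor_group B M N) H = hom (add_monoid (tensor_bimodule B M N)) H"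
    "hom H (tensor_group B M N) = hom H (add_monoid (tensor_bimodule B M N))"
    by (simp_all add: hom_def tensor_bimodule_def)
  moreover have "carrier (tensor_group B M N) = carrier (tensor_bimodule B M N)"
    by (simp add: tensor_bimodule_def)
  ultimately show
    "the_hom (tensor_group B M N) H P = the_hom (add_monoid (tensor_bimodule B M N)) H P"
    "the_hom H (tensor_group B M N) Q = the_hom H (add_monoid (tensor_bimodule B M N)) Q"
    by (simp_all add: the_hom_def)
qed


section \<open>Bilinear maps and tensor products of bimodules\<close>

definition bilinear :: "'a ring \<Rightarrow> 'b ring \<Rightarrow> 'c ring \<Rightarrow> ('a, 'b, 'm) bimodule
    \<Rightarrow> ('b, 'c, 'n) bimodule \<Rightarrow> ('a, 'c, 'g) bimodule \<Rightarrow> ('m \<Rightarrow> 'n \<Rightarrow> 'g) \<Rightarrow> bool" where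
  "bilinear A B C M N G f \<longleftrightarrow> balanced B M N G f \<and>
    (\<forall>a \<in> carrier A. \<forall>m \<in> carrier M. \<forall>n \<in> carrier N. f (a \<odot>\<^bsub>M\<^esub> m) n = a \<odot>\<^bsub>G\<^esub> f m n) \<and>
    (\<forall>m \<in> carrier M. \<forall>n \<in> carrier N. \<forall>c \<in> carrier C. f m (n \<odot>\<^sub>r\<^bsub>N\<^esub> c) = f m n \<odot>\<^sub>r\<^bsub>G\<^esub> c)"

definition bitensor :: "'a ring \<Rightarrow> 'b ring \<Rightarrow> 'c ring \<Rightarrow> ('a, 'b, 'm) bimodule
    \<Rightarrow> ('b, 'c, 'n) bimodule \<Rightarrow> ('a, 'c, 't) bimodule \<Rightarrow> ('m \<Rightarrow> 'n \<Rightarrow> 't) \<Rightarrow> bool" where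
  "bitensor A B C M N T p \<longleftrightarrow>
    bimod A C T \<and> bilinear A B C M N T p \<and> tensor_product B M N T p"

lemma bilinear_balanced: "bilinear A B C M N G f \<Longrightarrow> balanced B M N G f"
  by (simp add: bilinear_def)

lemma bilinear_smult: "\<lbrakk>bilinear A B C M N G f; a \<in> carrier A; m \<in> carrier M; n \<in> carrier N\<rbrakk>
    \<Longrightarrow> f (a \<odot>\<^bsub>M\<^esub> m) n = a \<odot>\<^bsub>G\<^esub> f m n"
  by (simp add: bilinear_def)

lemma bilinear_rsmult: "\<lbrakk>bilinear A B C M N G f; m \<in> carrier M; n \<in> carrier N; c \<in> carrier C\<rbrakk>
    \<Longrightarrow> f m (n \<odot>\<^sub>r\<^bsub>N\<^esub> c) = f m n \<odot>\<^sub>r\<^bsub>G\<^esub> c"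
  by (simp add: bilinear_def)

lemma bilinear_closed:
  "\<lbrakk>bilinear A B C M N G f; m \<in> carrier M; n \<in> carrier N\<rbrakk> \<Longrightarrow> f m n \<in> carrier G"
  by (rule balanced_closed[OF bilinear_balanced])

lemma bitensor_bimod: "bitensor A B C M N T p \<Longrightarrow> bimod A C T"
  and bitensor_bilinear: "bitensor A B C M N T p \<Longrightarrow> bilinear A B C M N T p"
  and bitensor_tensor_product: "bitensor A B C M N T p \<Longrightarrow> tensor_product B M N T p"
  by (simp_all add: bitensor_def)

lemma bimodule_homI:
  assumes "h \<in> additive_maps M N" "h \<in> extensional (carrier M)"
    and "\<And>a m. \<lbrakk>a \<in> carrier A; m \<in> carrier M\<rbrakk> \<Longrightarrow> h (a \<odot>\<^bsub>M\<^esub> m) = a \<odot>\<^bsub>N\<^esub> h m"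
    and "\<And>m b. \<lbrakk>m \<in> carrier M; b \<in> carrier B\<rbrakk> \<Longrightarrow> h (m \<odot>\<^sub>r\<^bsub>M\<^esub> b) = h m \<odot>\<^sub>r\<^bsub>N\<^esub> b"
  shows "h \<in> bimodule_hom A B M N"
  using assms by (simp add: bimodule_hom_def)

lemma bimodule_hom_additive: "h \<in> bimodule_hom A B M N \<Longrightarrow> h \<in> additive_maps M N"
  and bimodule_hom_extensional: "h \<in> bimodule_hom A B M N \<Longrightarrow> h \<in> extensional (carrier M)"
  and bimodule_hom_smult: "\<lbrakk>h \<in> bimodule_hom A B M N; a \<in> carrier A; m \<in> carrier M\<rbrakk>
    \<Longrightarrow> h (a \<odot>\<^bsub>M\<^esub> m) = a \<odot>\<^bsub>N\<^esub> h m"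
  and bimodule_hom_rsmult: "\<lbrakk>h \<in> bimodule_hom A B M N; m \<in> carrier M; b \<in> carrier B\<rbrakk>
    \<Longrightarrow> h (m \<odot>\<^sub>r\<^bsub>M\<^esub> b) = h m \<odot>\<^sub>r\<^bsub>N\<^esub> b"
  by (simp_all add: bimodule_hom_def)

lemma bimodule_hom_closed: "\<lbrakk>h \<in> bimodule_hom A B M N; m \<in> carrier M\<rbrakk> \<Longrightarrow> h m \<in> carrier N"
  by (rule additive_map_closed[OF bimodule_hom_additive])

lemma bimodule_hom_eqI:
  "\<lbrakk>h \<in> bimodule_hom A B M N; k \<in> bimodule_hom A B M N'; \<And>m. m \<in> carrier M \<Longrightarrow> h m = k m\<rbrakk>
    \<Longrightarrow> h = k"
  by (rule extensionalityI[of _ "carrier M"]) (auto dest: bimodule_hom_extensional)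

lemma smult_additive:
  assumes "left_module A M" "a \<in> carrier A"
  shows "(\<lambda>m. a \<odot>\<^bsub>M\<^esub> m) \<in> additive_maps M M"
proof -
  interpret left_module A M by fact
  show ?thesis using assms(2) by (intro additive_mapI) (simp_all add: smult_closed smult_add)
qed

lemma rsmult_additive:
  assumes "right_module B M" "b \<in> carrier B"
  shows "(\<lambda>m. m \<odot>\<^sub>r\<^bsub>M\<^esub> b) \<in> additive_maps M M"
proof -
  interpret right_module B M by fact
  show ?thesis using assms(2) by (intro additive_mapI) (simp_all add: rsmult_closed rsmult_add)
qed

lemma bimod_left: "bimod A B M \<Longrightarrow> left_module A M"
  and bimod_right: "bimod A B M \<Longrightarrow> right_module B M"
  by (simp_all add: bimod_def)

lemma bimod_abelian_group: "bimod A B M \<Longrightarrow> abelian_group M"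
  by (simp add: bimod_def left_module_def)

text \<open>
  Both sides of each linearity law are additive in the argument, so they need to be compared on
  pure tensors only.
\<close>

lemma bitensor_bimodule_homI:
  assumes T: "bitensor A B C M N T p" and MN: "bimod A B M" "bimod B C N" and G: "bimod A C G"
    and h: "h \<in> additive_maps T G" "h \<in> extensional (carrier T)"
    and f: "bilinear A B C M N G (\<lambda>m n. h (p m n))"
  shows "h \<in> bimodule_hom A C T G"
proof (rule bimodule_homI[OF h])
  interpret T: bimod A C T using bitensor_bimod[OF T] .
  interpret G: bimod A C G by fact
  interpret M: bimod A B M by fact
  interpret N: bimod B C N by fact
  note p = bitensor_bilinear[OF T] and eq = tensor_product_hom_eq[OF bitensor_tensor_product[OF T]]
  show "h (a \<odot>\<^bsub>T\<^esub> t) = a \<odot>\<^bsub>G\<^esub> h t" if a: "a \<in> carrier A" and t: "t \<in> carrier T" for a t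
  proof (rule eq[OF additive_map_compose[OF smult_additive h(1)] additive_map_compose[OF h(1) smult_additive] _ t])
    fix m n assume mn: "m \<in> carrier M" "n \<in> carrier N"
    then show "h (a \<odot>\<^bsub>T\<^esub> p m n) = a \<odot>\<^bsub>G\<^esub> h (p m n)"
      using bilinear_smult[OF f a mn] bilinear_smult[OF p a mn] by simp
  qed (use a T.left_module_axioms G.left_module_axioms in auto)
  show "h (t \<odot>\<^sub>r\<^bsub>T\<^esub> c) = h t \<odot>\<^sub>r\<^bsub>G\<^esub> c" if c: "c \<in> carrier C" and t: "t \<in> carrier T" for c t
  proof (rule eq[OF additive_map_compose[OF rsmult_additive h(1)] additive_map_compose[OF h(1) rsmult_additive] _ t])
    fix m n assume mn: "m \<in> carrier M" "n \<in> carrier N"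
    then show "h (p m n \<odot>\<^sub>r\<^bsub>T\<^esub> c) = h (p m n) \<odot>\<^sub>r\<^bsub>G\<^esub> c"
      using bilinear_rsmult[OF f mn c] bilinear_rsmult[OF p mn c] by simp
  qed (use c T.right_module_axioms G.right_module_axioms in auto)
qed

lemma bitensor_the_hom:
  assumes T: "bitensor A B C M N T p" and MN: "bimod A B M" "bimod B C N" and G: "bimod A C G"
    and f: "bilinear A B C M N G f"
  defines "h \<equiv> the_hom (add_monoid T) (add_monoid G)
    (\<lambda>h. \<forall>m \<in> carrier M. \<forall>n \<in> carrier N. h (p m n) = f m n)"
  shows "h \<in> bimodule_hom A C T G" "\<And>m n. \<lbrakk>m \<in> carrier M; n \<in> carrier N\<rbrakk> \<Longrightarrow> h (p m n) = f m n"
proof -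
  note h = tensor_product_the_hom[OF bimod_right[OF MN(1)] bimod_left[OF MN(2)]
      bitensor_tensor_product[OF T] bimod_abelian_group[OF G] bilinear_balanced[OF f], folded h_def]
  show h_p: "h (p m n) = f m n" if "m \<in> carrier M" "n \<in> carrier N" for m n
    using that by (rule h(3))
  interpret M: bimod A B M by fact
  interpret N: bimod B C N by fact
  have "bilinear A B C M N G (\<lambda>m n. h (p m n))"
    using f by (simp add: bilinear_def balanced_def h_p M.smult_closed N.rsmult_closed
        M.rsmult_closed N.smult_closed)
  then show "h \<in> bimodule_hom A C T G"
    by (rule bitensor_bimodule_homI[OF T MN G h(1,2)])
qed

text \<open>
  The outer actions are well defined on \<open>M \<otimes>\<^sub>B N\<close> because they commute with the actions of \<open>B\<close>.
  Each module law then equates two additive endomaps that agree on pure tensors.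
\<close>

lemma bitensor_tensor_bimodule:
  assumes M: "bimod A B M" and N: "bimod B C N"
  shows "bitensor A B C M N (tensor_bimodule B M N) (tensor_class B M N)"
proof -
  interpret M: bimod A B M by (rule M)
  interpret N: bimod B C N by (rule N)
  note MN = M.right_module_axioms N.left_module_axioms
  let ?T = "tensor_bimodule B M N" and ?p = "tensor_class B M N"
  note T = tensor_product_tensor_bimodule[OF MN]
  note p = tensor_product_balanced[OF T]
  interpret T: abelian_group ?T using tensor_product_abelian_group[OF T] .
  note eq = tensor_product_hom_eq[OF T]
  have left: "(\<lambda>t. a \<odot>\<^bsub>?T\<^esub> t) \<in> additive_maps ?T ?T"
    "\<And>m n. \<lbrakk>m \<in> carrier M; n \<in> carrier N\<rbrakk> \<Longrightarrow> a \<odot>\<^bsub>?T\<^esub> ?p m n = ?p (a \<odot>\<^bsub>M\<^esub> m) n"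
    if a: "a \<in> carrier A" for a
  proof -
    have "balanced B M N ?T (\<lambda>m n. ?p (a \<odot>\<^bsub>M\<^esub> m) n)"
      using a p by (simp add: balanced_def M.smult_closed M.smult_add M.smult_rsmult[symmetric])
    note h = tensor_product_the_hom[OF MN T T.abelian_group_axioms this]
    have "smult ?T a = the_hom (add_monoid ?T) (add_monoid ?T)
       (\<lambda>h. \<forall>m \<in> carrier M. \<forall>n \<in> carrier N. h (?p m n) = ?p (a \<odot>\<^bsub>M\<^esub> m) n)"
      by (subst tensor_bimodule_def) (simp add: the_hom_tensor_group)
    then show "(\<lambda>t. a \<odot>\<^bsub>?T\<^esub> t) \<in> additive_maps ?T ?T"
      "\<And>m n. \<lbrakk>m \<in> carrier M; n \<in> carrier N\<rbrakk> \<Longrightarrow> a \<odot>\<^bsub>?T\<^esub> ?p m n = ?p (a \<odot>\<^bsub>M\<^esub> m) n"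
      using h by simp_all
  qed
  have right: "(\<lambda>t. t \<odot>\<^sub>r\<^bsub>?T\<^esub> c) \<in> additive_maps ?T ?T"
    "\<And>m n. \<lbrakk>m \<in> carrier M; n \<in> carrier N\<rbrakk> \<Longrightarrow> ?p m n \<odot>\<^sub>r\<^bsub>?T\<^esub> c = ?p m (n \<odot>\<^sub>r\<^bsub>N\<^esub> c)"
    if c: "c \<in> carrier C" for c
  proof -
    have "balanced B M N ?T (\<lambda>m n. ?p m (n \<odot>\<^sub>r\<^bsub>N\<^esub> c))"
      using c p by (simp add: balanced_def N.rsmult_closed N.rsmult_add N.smult_rsmult)
    note h = tensor_product_the_hom[OF MN T T.abelian_group_axioms this]
    have "(\<lambda>t. t \<odot>\<^sub>r\<^bsub>?T\<^esub> c) = the_hom (add_monoid ?T) (add_monoid ?T)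
       (\<lambda>h. \<forall>m \<in> carrier M. \<forall>n \<in> carrier N. h (?p m n) = ?p m (n \<odot>\<^sub>r\<^bsub>N\<^esub> c))"
      by (subst tensor_bimodule_def) (simp add: the_hom_tensor_group)
    from h[folded this] show "(\<lambda>t. t \<odot>\<^sub>r\<^bsub>?T\<^esub> c) \<in> additive_maps ?T ?T"
      "\<And>m n. \<lbrakk>m \<in> carrier M; n \<in> carrier N\<rbrakk> \<Longrightarrow> ?p m n \<odot>\<^sub>r\<^bsub>?T\<^esub> c = ?p m (n \<odot>\<^sub>r\<^bsub>N\<^esub> c)"
      by simp_all
  qed
  note p_left = balanced_add_left[OF p] and p_right = balanced_add_right[OF p]
  have "bimod A C ?T"
  proof unfold_locales
    fix a a' c c' t t'
    show "a \<odot>\<^bsub>?T\<^esub> t \<in> carrier ?T" if "a \<in> carrier A" "t \<in> carrier ?T"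
      using additive_map_closed[OF left(1)] that .
    show "t \<odot>\<^sub>r\<^bsub>?T\<^esub> c \<in> carrier ?T" if "t \<in> carrier ?T" "c \<in> carrier C"
      using additive_map_closed[OF right(1)] that by simp
    show "a \<odot>\<^bsub>?T\<^esub> (t \<oplus>\<^bsub>?T\<^esub> t') = a \<odot>\<^bsub>?T\<^esub> t \<oplus>\<^bsub>?T\<^esub> a \<odot>\<^bsub>?T\<^esub> t'"
      if "a \<in> carrier A" "t \<in> carrier ?T" "t' \<in> carrier ?T"
      using additive_map_add[OF left(1)] that by simp
    show "(t \<oplus>\<^bsub>?T\<^esub> t') \<odot>\<^sub>r\<^bsub>?T\<^esub> c = t \<odot>\<^sub>r\<^bsub>?T\<^esub> c \<oplus>\<^bsub>?T\<^esub> t' \<odot>\<^sub>r\<^bsub>?T\<^esub> c"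
      if "t \<in> carrier ?T" "t' \<in> carrier ?T" "c \<in> carrier C"
      using additive_map_add[OF right(1)] that by simp
    show "(a \<oplus>\<^bsub>A\<^esub> a') \<odot>\<^bsub>?T\<^esub> t = a \<odot>\<^bsub>?T\<^esub> t \<oplus>\<^bsub>?T\<^esub> a' \<odot>\<^bsub>?T\<^esub> t"
      if a: "a \<in> carrier A" "a' \<in> carrier A" and t: "t \<in> carrier ?T"
      by (rule eq[OF left(1) additive_map_plus[OF T.abelian_group_axioms left(1) left(1)] _ t])
        (simp_all add: a left(2) M.smult_add_scalar p_left M.smult_closed)
    show "t \<odot>\<^sub>r\<^bsub>?T\<^esub> (c \<oplus>\<^bsub>C\<^esub> c') = t \<odot>\<^sub>r\<^bsub>?T\<^esub> c \<oplus>\<^bsub>?T\<^esub> t \<odot>\<^sub>r\<^bsub>?T\<^esub> c'"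
      if t: "t \<in> carrier ?T" and c: "c \<in> carrier C" "c' \<in> carrier C"
      by (rule eq[OF right(1) additive_map_plus[OF T.abelian_group_axioms right(1) right(1)] _ t])
        (simp_all add: c right(2) N.rsmult_add_scalar p_right N.rsmult_closed)
    show "(a \<otimes>\<^bsub>A\<^esub> a') \<odot>\<^bsub>?T\<^esub> t = a \<odot>\<^bsub>?T\<^esub> (a' \<odot>\<^bsub>?T\<^esub> t)"
      if a: "a \<in> carrier A" "a' \<in> carrier A" and t: "t \<in> carrier ?T"
      by (rule eq[OF left(1) additive_map_compose[OF left(1) left(1)] _ t])
        (simp_all add: a left(2) M.smult_assoc M.smult_closed M.A.m_closed)
    show "t \<odot>\<^sub>r\<^bsub>?T\<^esub> (c \<otimes>\<^bsub>C\<^esub> c') = (t \<odot>\<^sub>r\<^bsub>?T\<^esub> c) \<odot>\<^sub>r\<^bsub>?T\<^esub> c'"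
      if t: "t \<in> carrier ?T" and c: "c \<in> carrier C" "c' \<in> carrier C"
      by (rule eq[OF right(1) additive_map_compose[OF right(1) right(1)] _ t])
        (simp_all add: c right(2) N.rsmult_assoc N.rsmult_closed N.B.m_closed)
    show "(a \<odot>\<^bsub>?T\<^esub> t) \<odot>\<^sub>r\<^bsub>?T\<^esub> c = a \<odot>\<^bsub>?T\<^esub> (t \<odot>\<^sub>r\<^bsub>?T\<^esub> c)"
      if a: "a \<in> carrier A" and t: "t \<in> carrier ?T" and c: "c \<in> carrier C"
      by (rule eq[OF additive_map_compose[OF left(1) right(1)] additive_map_compose[OF right(1) left(1)] _ t])
        (simp_all add: a c left(2) right(2) N.rsmult_closed M.smult_closed)
  qed
  moreover have "bilinear A B C M N ?T ?p"
    using p by (simp add: bilinear_def left(2) right(2))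
  ultimately show ?thesis
    using T by (simp add: bitensor_def)
qed

lemma bimod_transport:
  assumes M: "bimod A B M" and e: "inj_on e (carrier M)"
  shows "bimod A B (transport_bimodule e M)"
    and "e \<in> additive_maps M (transport_bimodule e M)"
    and "inv_into (carrier M) e \<in> additive_maps (transport_bimodule e M) M"
    and "\<And>a m. m \<in> carrier M \<Longrightarrow> a \<odot>\<^bsub>transport_bimodule e M\<^esub> e m = e (a \<odot>\<^bsub>M\<^esub> m)"
    and "\<And>b m. m \<in> carrier M \<Longrightarrow> e m \<odot>\<^sub>r\<^bsub>transport_bimodule e M\<^esub> b = e (m \<odot>\<^sub>r\<^bsub>M\<^esub> b)"
proof -
  interpret M: bimod A B M by (rule M)
  let ?N = "transport_bimodule e M"
  note [simp] = inv_into_f_f[OF e]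
  have carr: "carrier ?N = e ` carrier M"
    by (simp add: transport_bimodule_def Let_def)
  have zero: "\<zero>\<^bsub>?N\<^esub> = e \<zero>\<^bsub>M\<^esub>"
    by (simp add: transport_bimodule_def Let_def)
  have add: "e m \<oplus>\<^bsub>?N\<^esub> e m' = e (m \<oplus>\<^bsub>M\<^esub> m')" if "m \<in> carrier M" "m' \<in> carrier M" for m m'
    using that by (simp add: transport_bimodule_def Let_def)
  show smult: "a \<odot>\<^bsub>?N\<^esub> e m = e (a \<odot>\<^bsub>M\<^esub> m)" if "m \<in> carrier M" for a m
    using that by (simp add: transport_bimodule_def Let_def)
  show rsmult: "e m \<odot>\<^sub>r\<^bsub>?N\<^esub> b = e (m \<odot>\<^sub>r\<^bsub>M\<^esub> b)" if "m \<in> carrier M" for b m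
    using that by (simp add: transport_bimodule_def Let_def)
  show "e \<in> additive_maps M ?N" "inv_into (carrier M) e \<in> additive_maps ?N M"
    by (rule additive_mapI; auto simp: carr add)+
  note simps = carr zero add smult rsmult M.smult_closed M.rsmult_closed
  interpret N: abelian_group ?N
  proof (rule abelian_groupI)
    show "\<exists>y\<in>carrier ?N. y \<oplus>\<^bsub>?N\<^esub> x = \<zero>\<^bsub>?N\<^esub>" if "x \<in> carrier ?N" for x
    proof -
      obtain m where "x = e m" "m \<in> carrier M"
        using \<open>x \<in> carrier ?N\<close> by (auto simp: carr)
      then show ?thesis
        by (intro bexI[of _ "e (\<ominus>\<^bsub>M\<^esub> m)"]) (simp_all add: simps M.M.l_neg)
    qed
  qed (auto simp: simps M.M.a_ac)
  show "bimod A B ?N"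
    by unfold_locales (auto simp: simps M.smult_add M.smult_add_scalar M.smult_assoc
        M.rsmult_add M.rsmult_add_scalar M.rsmult_assoc M.smult_rsmult)
qed

lemma bitensor_transport:
  assumes T: "bitensor A B C M N T p" and MN: "bimod A B M" "bimod B C N"
    and e: "inj_on e (carrier T)"
  shows "bitensor A B C M N (transport_bimodule e T) (\<lambda>m n. e (p m n))"
proof -
  let ?T = "transport_bimodule e T"
  note t = bimod_transport[OF bitensor_bimod[OF T] e]
  note p = bitensor_bilinear[OF T] and tp = bitensor_tensor_product[OF T]
  note pc = bilinear_closed[OF p]
  have bil: "bilinear A B C M N ?T (\<lambda>m n. e (p m n))"
    unfolding bilinear_def
    using balanced_compose[OF bilinear_balanced[OF p] t(2)]
    by (simp add: t(4,5) pc bilinear_smult[OF p] bilinear_rsmult[OF p])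
  have carr: "carrier ?T = e ` carrier T"
    by (simp add: transport_bimodule_def Let_def)
  have "spans M N ?T (\<lambda>m n. e (p m n))"
    unfolding spans_def
  proof (intro allI impI ballI)
    fix P x
    assume P: "\<forall>m\<in>carrier M. \<forall>n\<in>carrier N. P (e (p m n))"
      "\<forall>x\<in>carrier ?T. \<forall>y\<in>carrier ?T. P x \<longrightarrow> P y \<longrightarrow> P (x \<oplus>\<^bsub>?T\<^esub> y)" and "x \<in> carrier ?T"
    then obtain y where "x = e y" "y \<in> carrier T"
      by (auto simp: carr)
    moreover have "P (e y)" if "y \<in> carrier T" for y
      using that
      by (rule spans_induct[OF tensor_product_spans[OF tp], where P = "\<lambda>y. P (e y)"])
        (use P in \<open>auto simp: additive_map_add[OF t(2)] carr\<close>)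
    ultimately show "P x" by simp
  qed
  moreover obtain d where d: "d \<in> additive_maps T (tensor_bimodule B M N)"
    "\<And>m n. \<lbrakk>m \<in> carrier M; n \<in> carrier N\<rbrakk> \<Longrightarrow> d (p m n) = tensor_class B M N m n"
    using tp unfolding tensor_product_def by blast
  moreover have "(\<lambda>x. d (inv_into (carrier T) e x)) \<in> additive_maps ?T (tensor_bimodule B M N)"
    by (rule additive_map_compose[OF t(3) d(1)])
  ultimately have "tensor_product B M N ?T (\<lambda>m n. e (p m n))"
    unfolding tensor_product_def
    using bimod_abelian_group[OF t(1)] bilinear_balanced[OF bil]
    by (intro conjI bexI[of _ "\<lambda>x. d (inv_into (carrier T) e x)"])
      (simp_all add: inv_into_f_f[OF e] pc)
  then show ?thesis
    by (simp add: bitensor_def t(1) bil)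
qed


section \<open>Firm modules\<close>

lemma regular_bimodule_simps [simp]:
  "carrier (regular_bimodule A) = carrier A" "ring.add (regular_bimodule A) = ring.add A"
  "ring.zero (regular_bimodule A) = ring.zero A" "smult (regular_bimodule A) = monoid.mult A"
  "rsmult (regular_bimodule A) = monoid.mult A"
  by (simp_all add: regular_bimodule_def)

lemma bimod_regular:
  assumes "nonunital_ring A"
  shows "bimod A A (regular_bimodule A)"
proof -
  interpret A: nonunital_ring A by fact
  interpret R: abelian_group "regular_bimodule A"
    by (rule abelian_group_cong[OF A.abelian_group_axioms]) simp_all
  show ?thesis
    by unfold_locales (simp_all add: A.m_closed A.m_assoc A.l_distr A.r_distr)
qed

text \<open>
  The inverse of the canonical map is the comparison map demanded by \<open>tensor_product\<close>. Conversely
  the canonical map and a comparison map are mutually inverse, since both composites fix a spanning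
  set.
\<close>

lemma tensor_product_iff_iso:
  assumes MN: "right_module B M" "left_module B N"
    and G: "abelian_group G" and f: "balanced B M N G f"
  shows "the_hom (tensor_group B M N) (add_monoid G)
      (\<lambda>h. \<forall>m \<in> carrier M. \<forall>n \<in> carrier N. h (tensor_class B M N m n) = f m n)
      \<in> iso (tensor_group B M N) (add_monoid G)
    \<longleftrightarrow> tensor_product B M N G f" (is "?h \<in> iso ?TG _ \<longleftrightarrow> _")
proof -
  let ?T = "tensor_bimodule B M N" and ?p = "tensor_class B M N"
  note T = tensor_product_tensor_bimodule[OF MN]
  interpret T: abelian_group ?T using tensor_product_abelian_group[OF T] .
  define h where "h = ?h"
  note h = tensor_product_the_hom[OF MN T G f, folded the_hom_tensor_group, folded h_def]
  have iso_eq: "iso ?TG (add_monoid G) = iso (add_monoid ?T) (add_monoid G)"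
    by (simp add: iso_def hom_def tensor_bimodule_def)
  show ?thesis
    unfolding h_def[symmetric] iso_eq
  proof
    assume iso: "h \<in> iso (add_monoid ?T) (add_monoid G)"
    then have bij: "bij_betw h (carrier ?T) (carrier G)"
      by (simp add: iso_def)
    define d where "d = inv_into (carrier ?T) h"
    have "d \<in> additive_maps G ?T"
      using group.iso_set_sym[OF T.a_group iso] by (simp add: d_def iso_def)
    moreover have d_f: "d (f m n) = ?p m n" if "m \<in> carrier M" "n \<in> carrier N" for m n
      using that h(3)[OF that] bij tensor_product_closed[OF T that]
      by (simp add: d_def bij_betw_def inv_into_f_eq)
    moreover have "spans M N G f"
      unfolding spans_def
    proof (intro allI impI ballI)
      fix P x
      assume P: "\<forall>m\<in>carrier M. \<forall>n\<in>carrier N. P (f m n)"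
        "\<forall>x\<in>carrier G. \<forall>y\<in>carrier G. P x \<longrightarrow> P y \<longrightarrow> P (x \<oplus>\<^bsub>G\<^esub> y)" and "x \<in> carrier G"
      then obtain t where "x = h t" "t \<in> carrier ?T"
        using bij by (metis bij_betw_imp_surj_on imageE)
      moreover have "P (h t)" if "t \<in> carrier ?T" for t
        using that
        by (rule spans_induct[OF tensor_product_spans[OF T], where P = "\<lambda>t. P (h t)"])
          (use P in \<open>auto simp: additive_map_add[OF h(1)] additive_map_closed[OF h(1)] h(3)\<close>)
      ultimately show "P x" by simp
    qed
    ultimately show "tensor_product B M N G f"
      unfolding tensor_product_def using G f by blast
  next
    assume G': "tensor_product B M N G f"
    then obtain d where d: "d \<in> additive_maps G ?T"
      "\<And>m n. \<lbrakk>m \<in> carrier M; n \<in> carrier N\<rbrakk> \<Longrightarrow> d (f m n) = ?p m n"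
      unfolding tensor_product_def by blast
    have "d (h t) = t" if "t \<in> carrier ?T" for t
      using tensor_product_hom_eq[OF T additive_map_compose[OF h(1) d(1)], of "\<lambda>x. x" t] that
      by (simp add: h(3) d(2) hom_def)
    moreover have "h (d x) = x" if "x \<in> carrier G" for x
      using tensor_product_hom_eq[OF G' additive_map_compose[OF d(1) h(1)], of "\<lambda>x. x" x] that
      by (simp add: h(3) d(2) hom_def)
    ultimately have "bij_betw h (carrier ?T) (carrier G)"
      by (intro bij_betwI[where g = d])
        (auto intro: additive_map_closed[OF h(1)] additive_map_closed[OF d(1)])
    then show "h \<in> iso (add_monoid ?T) (add_monoid G)"
      by (simp add: iso_def h(1))
  qed
qed

lemma left_action_balanced:
  assumes "left_module A M"
  shows "balanced A (regular_bimodule A) M M (\<lambda>a m. a \<odot>\<^bsub>M\<^esub> m)"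
proof -
  interpret left_module A M by fact
  show ?thesis
    by (simp add: balanced_def smult_closed smult_add smult_add_scalar smult_assoc)
qed

lemma right_action_balanced:
  assumes "right_module B M"
  shows "balanced B M (regular_bimodule B) M (\<lambda>m b. m \<odot>\<^sub>r\<^bsub>M\<^esub> b)"
proof -
  interpret right_module B M by fact
  show ?thesis
    by (simp add: balanced_def rsmult_closed rsmult_add rsmult_add_scalar rsmult_assoc)
qed

text \<open>
  This removes the coset construction from the notion of firmness: homomorphisms out of a firm
  module can be defined by prescribing them, in a balanced way, on products \<open>a m\<close>.
\<close>

lemma firm_left_iff:
  assumes "left_module A M"
  shows "firm_left A M \<longleftrightarrow> tensor_product A (regular_bimodule A) M M (\<lambda>a m. a \<odot>\<^bsub>M\<^esub> m)"
proof -
  interpret left_module A M by fact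
  have "right_module A (regular_bimodule A)"
    using bimod_right[OF bimod_regular[OF A.nonunital_ring_axioms]] .
  from tensor_product_iff_iso[OF this assms M.abelian_group_axioms left_action_balanced[OF assms]]
  show ?thesis by (simp add: firm_left_def)
qed

lemma firm_right_iff:
  assumes "right_module B M"
  shows "firm_right B M \<longleftrightarrow> tensor_product B M (regular_bimodule B) M (\<lambda>m b. m \<odot>\<^sub>r\<^bsub>M\<^esub> b)"
proof -
  interpret right_module B M by fact
  have "left_module B (regular_bimodule B)"
    using bimod_left[OF bimod_regular[OF B.nonunital_ring_axioms]] .
  from tensor_product_iff_iso[OF assms this M.abelian_group_axioms right_action_balanced[OF assms]]
  show ?thesis by (simp add: firm_right_def)
qed

text \<open>
  The inverse of \<open>A \<otimes>\<^sub>A (M \<otimes>\<^sub>B N) \<rightarrow> M \<otimes>\<^sub>B N\<close> sends \<open>a m \<otimes> n\<close> to \<open>a \<otimes> (m \<otimes> n)\<close>; for fixed \<open>n\<close>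
  this is well defined in \<open>a m\<close> because \<open>M\<close> is firm.
\<close>

lemma firm_left_bitensor:
  assumes T: "bitensor A B C M N T p" and M: "bimod A B M" and N: "bimod B C N"
    and firm: "firm_left A M"
  shows "firm_left A T"
proof -
  interpret M: bimod A B M by (rule M)
  interpret N: bimod B C N by (rule N)
  interpret T: bimod A C T by (rule bitensor_bimod[OF T])
  let ?R = "regular_bimodule A"
  have R: "right_module A ?R"
    using bimod_right[OF bimod_regular[OF M.A.nonunital_ring_axioms]] .
  let ?G = "tensor_bimodule A ?R T" and ?q = "tensor_class A ?R T"
  note G = tensor_product_tensor_bimodule[OF R T.left_module_axioms]
  interpret G: abelian_group ?G by (rule tensor_product_abelian_group[OF G])
  note q = tensor_product_balanced[OF G]
  note p = bitensor_bilinear[OF T] and tp = bitensor_tensor_product[OF T]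
  note pb = bilinear_balanced[OF p]
  have firm': "tensor_product A ?R M M (\<lambda>a m. a \<odot>\<^bsub>M\<^esub> m)"
    using firm firm_left_iff[OF M.left_module_axioms] by simp
  have eq: "h x = k x" if "h \<in> additive_maps M ?G" "k \<in> additive_maps M ?G"
    "\<And>a m. \<lbrakk>a \<in> carrier A; m \<in> carrier M\<rbrakk> \<Longrightarrow> h (a \<odot>\<^bsub>M\<^esub> m) = k (a \<odot>\<^bsub>M\<^esub> m)" "x \<in> carrier M" for h k x
    using tensor_product_hom_eq[OF firm' that(1,2) _ that(4)] that(3) by simp
  have "\<exists>h \<in> additive_maps M ?G. \<forall>a \<in> carrier A. \<forall>m \<in> carrier M. h (a \<odot>\<^bsub>M\<^esub> m) = ?q a (p m n)"
    if n: "n \<in> carrier N" for n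
  proof -
    have "balanced A ?R M ?G (\<lambda>a m. ?q a (p m n))"
      using n balanced_middle[OF q]
      by (intro balancedI)
        (simp_all add: balanced_closed[OF q] balanced_closed[OF pb] balanced_add_left[OF q, simplified]
          balanced_add_right[OF q, simplified] balanced_add_left[OF pb] bilinear_smult[OF p])
    from tensor_product_universal[OF R M.left_module_axioms firm' G.abelian_group_axioms this]
    show ?thesis by auto
  qed
  then obtain h where h: "\<And>n. n \<in> carrier N \<Longrightarrow> h n \<in> additive_maps M ?G"
    and h_smult: "\<And>n a m. \<lbrakk>n \<in> carrier N; a \<in> carrier A; m \<in> carrier M\<rbrakk>
      \<Longrightarrow> h n (a \<odot>\<^bsub>M\<^esub> m) = ?q a (p m n)"
    by metis
  have "balanced B M N ?G (\<lambda>m n. h n m)"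
  proof (rule balancedI)
    fix m m' n n' b
    show "h n m \<in> carrier ?G" if "m \<in> carrier M" "n \<in> carrier N"
      using that additive_map_closed[OF h] by blast
    show "h n (m \<oplus>\<^bsub>M\<^esub> m') = h n m \<oplus>\<^bsub>?G\<^esub> h n m'"
      if "m \<in> carrier M" "m' \<in> carrier M" "n \<in> carrier N"
      using that additive_map_add[OF h] by blast
    show "h (n \<oplus>\<^bsub>N\<^esub> n') m = h n m \<oplus>\<^bsub>?G\<^esub> h n' m"
      if m: "m \<in> carrier M" and n: "n \<in> carrier N" "n' \<in> carrier N"
      by (rule eq[OF h additive_map_plus[OF G.abelian_group_axioms h h] _ m])
        (use n balanced_add_right[OF q] in \<open>simp_all add: h_smult balanced_add_right[OF pb] balanced_closed[OF pb]\<close>)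
    show "h n (m \<odot>\<^sub>r\<^bsub>M\<^esub> b) = h (b \<odot>\<^bsub>N\<^esub> n) m"
      if m: "m \<in> carrier M" and b: "b \<in> carrier B" and n: "n \<in> carrier N"
      by (rule eq[OF additive_map_compose[OF rsmult_additive[OF M.right_module_axioms b] h] h _ m])
        (use b n in \<open>simp_all add: h_smult N.smult_closed M.smult_rsmult M.rsmult_closed balanced_middle[OF pb]\<close>)
  qed
  from tensor_product_universal[OF M.right_module_axioms N.left_module_axioms tp G.abelian_group_axioms this]
  obtain d where d: "d \<in> additive_maps T ?G"
    and d_p: "\<And>m n. \<lbrakk>m \<in> carrier M; n \<in> carrier N\<rbrakk> \<Longrightarrow> d (p m n) = h n m"
    by auto
  have "d (a \<odot>\<^bsub>T\<^esub> t) = ?q a t" if a: "a \<in> carrier A" and t: "t \<in> carrier T" for a t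
  proof (rule tensor_product_hom_eq[OF tp additive_map_compose[OF smult_additive[OF T.left_module_axioms a] d] _ _ t])
    show "?q a \<in> additive_maps T ?G"
      using balanced_additive_right[OF q] a by simp
    show "d (a \<odot>\<^bsub>T\<^esub> p m n) = ?q a (p m n)" if "m \<in> carrier M" "n \<in> carrier N" for m n
      using that a d_p[of "a \<odot>\<^bsub>M\<^esub> m" n] by (simp add: bilinear_smult[OF p] M.smult_closed h_smult)
  qed
  moreover have "spans ?R T T (\<lambda>a t. a \<odot>\<^bsub>T\<^esub> t)"
    unfolding spans_def
  proof (intro allI impI ballI)
    fix P t
    assume P: "\<forall>a\<in>carrier ?R. \<forall>t\<in>carrier T. P (a \<odot>\<^bsub>T\<^esub> t)"
      "\<forall>x\<in>carrier T. \<forall>y\<in>carrier T. P x \<longrightarrow> P y \<longrightarrow> P (x \<oplus>\<^bsub>T\<^esub> y)" and t: "t \<in> carrier T"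
    have pure: "P (p m n)" if m: "m \<in> carrier M" and n: "n \<in> carrier N" for m n
      using m
    proof (rule spans_induct[OF tensor_product_spans[OF firm'], where P = "\<lambda>m. P (p m n)"])
      show "P (p (a \<odot>\<^bsub>M\<^esub> m) n)" if "a \<in> carrier ?R" "m \<in> carrier M" for a m
        using that n P(1) by (simp add: bilinear_smult[OF p] bilinear_closed[OF p])
      show "P (p (m \<oplus>\<^bsub>M\<^esub> m') n)"
        if "m \<in> carrier M" "m' \<in> carrier M" "P (p m n)" "P (p m' n)" for m m'
        using that n P(2) by (simp add: balanced_add_left[OF pb] bilinear_closed[OF p])
    qed
    show "P t"
      using t by (rule spans_induct[OF tensor_product_spans[OF tp]]) (use pure P(2) in auto)
  qed
  ultimately have "tensor_product A ?R T T (\<lambda>a t. a \<odot>\<^bsub>T\<^esub> t)"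
    unfolding tensor_product_def
    using d left_action_balanced[OF T.left_module_axioms] T.M.abelian_group_axioms by (simp, blast)
  then show ?thesis
    using firm_left_iff[OF T.left_module_axioms] by simp
qed


section \<open>Opposite rings and bimodules\<close>

definition op_ring :: "'a ring \<Rightarrow> 'a ring" where
  "op_ring A = A\<lparr>monoid.mult := \<lambda>x y. y \<otimes>\<^bsub>A\<^esub> x\<rparr>"

definition op_bimodule :: "('a, 'b, 'm) bimodule \<Rightarrow> ('b, 'a, 'm) bimodule" where
  "op_bimodule M = \<lparr>carrier = carrier M, monoid.mult = monoid.mult M, monoid.one = monoid.one M,
     ring.zero = ring.zero M, ring.add = ring.add M,
     smult = (\<lambda>b m. m \<odot>\<^sub>r\<^bsub>M\<^esub> b), rsmult = (\<lambda>m a. a \<odot>\<^bsub>M\<^esub> m)\<rparr>"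

lemma op_ring_simps [simp]:
  "carrier (op_ring A) = carrier A" "ring.add (op_ring A) = ring.add A"
  "ring.zero (op_ring A) = ring.zero A" "x \<otimes>\<^bsub>op_ring A\<^esub> y = y \<otimes>\<^bsub>A\<^esub> x"
  "op_ring (op_ring A) = A"
  by (simp_all add: op_ring_def)

lemma op_bimodule_simps [simp]:
  "carrier (op_bimodule M) = carrier M" "ring.add (op_bimodule M) = ring.add M"
  "ring.zero (op_bimodule M) = ring.zero M" "b \<odot>\<^bsub>op_bimodule M\<^esub> m = m \<odot>\<^sub>r\<^bsub>M\<^esub> b"
  "m \<odot>\<^sub>r\<^bsub>op_bimodule M\<^esub> a = a \<odot>\<^bsub>M\<^esub> m" "op_bimodule (op_bimodule M) = M"
  by (simp_all add: op_bimodule_def)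

lemma op_regular_bimodule: "op_bimodule (regular_bimodule A) = regular_bimodule (op_ring A)"
  by (simp add: op_bimodule_def regular_bimodule_def op_ring_def)

lemma nonunital_ring_op: "nonunital_ring (op_ring A)" if "nonunital_ring A"
proof -
  interpret A: nonunital_ring A by fact
  interpret O: abelian_group "op_ring A"
    by (rule abelian_group_cong[OF A.abelian_group_axioms]) simp_all
  show ?thesis
    by unfold_locales (simp_all add: A.m_closed A.m_assoc A.l_distr A.r_distr)
qed

lemma abelian_group_op: "abelian_group M \<Longrightarrow> abelian_group (op_bimodule M)"
  by (erule abelian_group_cong) simp_all

lemma left_module_op: "left_module (op_ring B) (op_bimodule M)" if "right_module B M"
proof -
  interpret right_module B M by fact
  interpret O: nonunital_ring "op_ring B" by (rule nonunital_ring_op[OF B.nonunital_ring_axioms])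
  interpret N: abelian_group "op_bimodule M" by (rule abelian_group_op[OF M.abelian_group_axioms])
  show ?thesis
    by unfold_locales (simp_all add: rsmult_closed rsmult_add rsmult_add_scalar rsmult_assoc)
qed

lemma right_module_op: "right_module (op_ring A) (op_bimodule M)" if "left_module A M"
proof -
  interpret left_module A M by fact
  interpret O: nonunital_ring "op_ring A" by (rule nonunital_ring_op[OF A.nonunital_ring_axioms])
  interpret N: abelian_group "op_bimodule M" by (rule abelian_group_op[OF M.abelian_group_axioms])
  show ?thesis
    by unfold_locales (simp_all add: smult_closed smult_add smult_add_scalar smult_assoc)
qed

lemma bimod_op: "bimod (op_ring B) (op_ring A) (op_bimodule M)" if "bimod A B M"
proof -
  interpret bimod A B M by fact
  interpret L: left_module "op_ring B" "op_bimodule M" by (rule left_module_op[OF right_module_axioms])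
  interpret R: right_module "op_ring A" "op_bimodule M" by (rule right_module_op[OF left_module_axioms])
  show ?thesis
    by unfold_locales (simp add: smult_rsmult)
qed

lemma bimodule_hom_op:
  "bimodule_hom (op_ring B) (op_ring A) (op_bimodule M) (op_bimodule N) = bimodule_hom A B M N"
proof -
  have "additive_maps (op_bimodule M) (op_bimodule N) = additive_maps M N"
    by (rule additive_maps_cong) simp_all
  then show ?thesis
    by (auto simp: bimodule_hom_def)
qed

lemma balanced_op:
  "balanced B M N G f \<Longrightarrow> balanced (op_ring B) (op_bimodule N) (op_bimodule M) G (\<lambda>n m. f m n)"
  by (simp add: balanced_def)

lemma balanced_cong:
  "\<lbrakk>balanced B M N G f; carrier H = carrier G; ring.add H = ring.add G\<rbrakk> \<Longrightarrow> balanced B M N H f"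
  by (simp add: balanced_def)

lemma bilinear_op:
  assumes "bilinear A B C M N G f"
  shows "bilinear (op_ring C) (op_ring B) (op_ring A) (op_bimodule N) (op_bimodule M) (op_bimodule G)
    (\<lambda>n m. f m n)"
  using assms balanced_cong[OF balanced_op[of B M N G f], of "op_bimodule G"] by (simp add: bilinear_def)

text \<open>
  Being balanced over \<open>B\<close> and over its opposite are the same condition with the factors exchanged.
  Hence a statement about left firmness can be applied to opposites to give the one about right
  firmness.
\<close>

lemma tensor_product_op:
  assumes MN: "right_module B M" "left_module B N" and T: "tensor_product B M N T p"
    and eq: "carrier T' = carrier T" "ring.add T' = ring.add T" "ring.zero T' = ring.zero T"
  shows "tensor_product (op_ring B) (op_bimodule N) (op_bimodule M) T' (\<lambda>n m. p m n)"
proof (rule tensor_product_cong[OF _ eq])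
  let ?G = "tensor_bimodule (op_ring B) (op_bimodule N) (op_bimodule M)"
    and ?q = "tensor_class (op_ring B) (op_bimodule N) (op_bimodule M)"
  note G = tensor_product_tensor_bimodule[OF right_module_op[OF MN(2)] left_module_op[OF MN(1)]]
  have "balanced B M N ?G (\<lambda>m n. ?q n m)"
    using balanced_op[OF tensor_product_balanced[OF G]] by simp
  from tensor_product_universal[OF MN T tensor_product_abelian_group[OF G] this]
  have "\<exists>d \<in> additive_maps T ?G. \<forall>m \<in> carrier M. \<forall>n \<in> carrier N. d (p m n) = ?q n m"
    by blast
  moreover have "spans (op_bimodule N) (op_bimodule M) T (\<lambda>n m. p m n)"
    unfolding spans_def
    by (intro allI impI ballI, erule spans_induct[OF tensor_product_spans[OF T]]) simp_all
  ultimately show "tensor_product (op_ring B) (op_bimodule N) (op_bimodule M) T (\<lambda>n m. p m n)"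
    using T balanced_op[OF tensor_product_balanced[OF T]] unfolding tensor_product_def by auto
qed

lemma bitensor_op:
  assumes "bimod A B M" "bimod B C N" "bitensor A B C M N T p"
  shows "bitensor (op_ring C) (op_ring B) (op_ring A) (op_bimodule N) (op_bimodule M) (op_bimodule T)
    (\<lambda>n m. p m n)"
  using assms tensor_product_op[of B M N T p "op_bimodule T"]
  by (simp add: bitensor_def bimod_op bilinear_op bimod_left bimod_right)

lemma firm_right_op: "firm_right (op_ring A) (op_bimodule M)" if "left_module A M" "firm_left A M"
proof -
  interpret left_module A M by fact
  have R: "right_module A (regular_bimodule A)"
    using bimod_right[OF bimod_regular[OF A.nonunital_ring_axioms]] .
  have "tensor_product (op_ring A) (op_bimodule M) (op_bimodule (regular_bimodule A)) (op_bimodule M)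
    (\<lambda>m a. a \<odot>\<^bsub>M\<^esub> m)"
    using that by (intro tensor_product_op[OF R that(1)]) (simp_all add: firm_left_iff)
  then show ?thesis
    by (simp add: firm_right_iff right_module_op that(1) op_regular_bimodule)
qed

lemma firm_left_op: "firm_left (op_ring B) (op_bimodule M)" if "right_module B M" "firm_right B M"
proof -
  interpret right_module B M by fact
  have R: "left_module B (regular_bimodule B)"
    using bimod_left[OF bimod_regular[OF B.nonunital_ring_axioms]] .
  have "tensor_product (op_ring B) (op_bimodule (regular_bimodule B)) (op_bimodule M) (op_bimodule M)
    (\<lambda>b m. m \<odot>\<^sub>r\<^bsub>M\<^esub> b)"
    using that by (intro tensor_product_op[OF that(1) R]) (simp_all add: firm_right_iff)
  then show ?thesis
    by (simp add: firm_left_iff left_module_op that(1) op_regular_bimodule)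
qed

lemma firm_right_bitensor:
  assumes T: "bitensor A B C M N T p" and M: "bimod A B M" and N: "bimod B C N"
    and firm: "firm_right C N"
  shows "firm_right C T"
proof -
  have "firm_left (op_ring C) (op_bimodule T)"
    using firm_left_bitensor[OF bitensor_op[OF M N T] bimod_op[OF N] bimod_op[OF M]]
      firm_left_op[OF bimod_right[OF N] firm] by simp
  from firm_right_op[OF left_module_op[OF bimod_right[OF bitensor_bimod[OF T]]] this]
  show ?thesis by simp
qed

lemma firm_bimodule_op:
  assumes "firm_bimodule A B M"
  shows "firm_bimodule (op_ring B) (op_ring A) (op_bimodule M)"
  using assms bimod_left[of A B M] bimod_right[of A B M]
  by (simp add: firm_bimodule_def bimod_op firm_left_op firm_right_op)

lemma firm_ring_op: "firm_ring A \<Longrightarrow> firm_ring (op_ring A)"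
  using firm_left_op[of A "regular_bimodule A"] firm_right_op[of A "regular_bimodule A"]
    bimod_left[OF bimod_regular, of A] bimod_right[OF bimod_regular, of A]
  by (simp add: firm_ring_def nonunital_ring_op op_regular_bimodule)


section \<open>Smallness\<close>

lemma lepoll_iff_ordLeq: "X \<lesssim> Y \<longleftrightarrow> |X| \<le>o |Y|"
  by (simp add: lepoll_def card_of_ordLeq)

lemma infinite_times_lepoll:
  assumes "infinite X" "Y \<lesssim> X"
  shows "X \<times> Y \<lesssim> X"
  using card_of_Times_infinite[OF assms(1), of Y] assms(2)
  by (cases "Y = {}") (auto simp: lepoll_iff_ordLeq ordIso_iff_ordLeq)

lemma times_lesspoll_infinite:
  assumes U: "infinite U" and X: "X \<prec> U" and Y: "Y \<prec> U"
  shows "X \<times> Y \<prec> U"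
proof (cases "finite (X \<times> Y)")
  case True
  then show ?thesis using U by (rule finite_lesspoll_infinite[rotated])
next
  case False
  consider "X \<lesssim> Y" | "Y \<lesssim> X"
    using ordLeq_total[OF card_of_Well_order card_of_Well_order] by (auto simp: lepoll_iff_ordLeq)
  then show ?thesis
  proof cases
    case 1
    then have "infinite Y"
      using False card_of_ordLeq_finite[of X Y] by (auto simp: lepoll_iff_ordLeq)
    then have "Y \<times> X \<lesssim> Y"
      using 1 by (rule infinite_times_lepoll)
    then have "X \<times> Y \<lesssim> Y"
      using times_commute_eqpoll lepoll_trans1 by blast
    then show ?thesis using Y by (rule lesspoll_trans1)
  next
    case 2
    then have "infinite X"
      using False card_of_ordLeq_finite[of Y X] by (auto simp: lepoll_iff_ordLeq)
    then have "X \<times> Y \<lesssim> X"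
      using 2 by (rule infinite_times_lepoll)
    then show ?thesis using X by (rule lesspoll_trans1)
  qed
qed

lemma small_image: "X \<prec> (UNIV :: 'u set) \<Longrightarrow> small (e ` X :: 'u set)"
  unfolding small_def using image_lepoll lesspoll_trans1 by blast

text \<open>
  The free abelian group on a finite nonempty set is infinite, so finiteness needs an argument of
  its own: the order of \<open>M\<close> annihilates every pure tensor, so each element is a combination of the
  finitely many pure tensors with coefficients below that order.
\<close>

lemma finite_tensor_bimodule:
  assumes MN: "right_module B M" "left_module B N"
    and fin: "finite (carrier M)" "finite (carrier N)"
  shows "finite (carrier (tensor_bimodule B M N))"
proof -
  interpret M: right_module B M by fact
  interpret N: left_module B N by fact
  let ?T = "tensor_bimodule B M N" and ?p = "tensor_class B M N"
  let ?X = "carrier M \<times> carrier N" and ?k = "card (carrier M)"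
  note T = tensor_product_tensor_bimodule[OF MN]
  interpret T: abelian_group ?T by (rule tensor_product_abelian_group[OF T])
  note p = tensor_product_balanced[OF T]
  define comb where "comb c = (\<Oplus>\<^bsub>?T\<^esub>z\<in>?X. [(c z :: nat)] \<cdot>\<^bsub>?T\<^esub> case_prod ?p z)" for c
  have p_closed: "case_prod ?p z \<in> carrier ?T" if "z \<in> ?X" for z
    using that by (auto simp: balanced_closed[OF p])
  have torsion: "[?k] \<cdot>\<^bsub>?T\<^esub> case_prod ?p z = \<zero>\<^bsub>?T\<^esub>" if z: "z \<in> ?X" for z
  proof -
    obtain m n where mn: "z = (m, n)" "m \<in> carrier M" "n \<in> carrier N"
      using z by auto
    interpret h: group_hom "add_monoid M" "add_monoid ?T" "\<lambda>m. ?p m n"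
      using balanced_additive_left[OF p mn(3)] M.M.a_group T.a_group
      by (simp add: group_hom_def group_hom_axioms_def)
    have "[?k] \<cdot>\<^bsub>?T\<^esub> ?p m n = ?p ([?k] \<cdot>\<^bsub>M\<^esub> m) n"
      using h.hom_nat_pow[of m ?k] mn by (simp add: add_pow_def)
    also have "[?k] \<cdot>\<^bsub>M\<^esub> m = \<zero>\<^bsub>M\<^esub>"
      using group.pow_order_eq_1[OF M.M.a_group, of m] mn by (simp add: order_def add_pow_def)
    also have "?p \<zero>\<^bsub>M\<^esub> n = \<zero>\<^bsub>?T\<^esub>"
      using h.hom_one by simp
    finally show ?thesis by (simp add: mn)
  qed
  have reduce: "[(c mod ?k)] \<cdot>\<^bsub>?T\<^esub> case_prod ?p z = [c] \<cdot>\<^bsub>?T\<^esub> case_prod ?p z"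
    if z: "z \<in> ?X" for z and c :: nat
  proof -
    have "[(?k * q + r)] \<cdot>\<^bsub>?T\<^esub> case_prod ?p z = [r] \<cdot>\<^bsub>?T\<^esub> case_prod ?p z" for q r :: nat
      using p_closed[OF z] torsion[OF z] by (simp flip: T.add.nat_pow_mult T.add.nat_pow_pow)
    from this[of "c div ?k" "c mod ?k"] show ?thesis by simp
  qed
  have "\<exists>c. t = comb c" if "t \<in> carrier ?T" for t
    using that
  proof (rule spans_induct[OF tensor_product_spans[OF T]])
    fix m n assume mn: "m \<in> carrier M" "n \<in> carrier N"
    have "comb (\<lambda>z. if z = (m, n) then 1 else 0)
      = (\<Oplus>\<^bsub>?T\<^esub>z\<in>?X. if z = (m, n) then case_prod ?p z else \<zero>\<^bsub>?T\<^esub>)"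
      unfolding comb_def by (rule T.add.finprod_cong') (use p_closed in auto)
    also have "\<dots> = ?p m n"
      using T.add.finprod_singleton[of "(m, n)" ?X "case_prod ?p"] mn fin p_closed
      by (simp add: eq_commute[of _ "(m, n)"] Pi_iff)
    finally show "\<exists>c. ?p m n = comb c" by metis
  next
    fix x y assume "\<exists>c. x = comb c" "\<exists>c. y = comb c"
    then obtain c c' where c: "x = comb c" "y = comb c'" by blast
    have "comb (\<lambda>z. c z + c' z)
      = (\<Oplus>\<^bsub>?T\<^esub>z\<in>?X. [(c z)] \<cdot>\<^bsub>?T\<^esub> case_prod ?p z \<oplus>\<^bsub>?T\<^esub> [(c' z)] \<cdot>\<^bsub>?T\<^esub> case_prod ?p z)"
      unfolding comb_def by (rule T.add.finprod_cong') (use p_closed in \<open>auto simp: T.add.nat_pow_mult\<close>)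
    also have "\<dots> = comb c \<oplus>\<^bsub>?T\<^esub> comb c'"
      unfolding comb_def by (rule T.finsum_addf) (use p_closed in auto)
    finally have "comb (\<lambda>z. c z + c' z) = comb c \<oplus>\<^bsub>?T\<^esub> comb c'" .
    then show "\<exists>c. x \<oplus>\<^bsub>?T\<^esub> y = comb c"
      using c by metis
  qed
  moreover have "comb c = comb (restrict (\<lambda>z. c z mod ?k) ?X)" for c
    unfolding comb_def by (rule T.add.finprod_cong') (use p_closed reduce in auto)
  moreover have "restrict (\<lambda>z. c z mod ?k) ?X \<in> ?X \<rightarrow>\<^sub>E {..<?k}" for c
  proof -
    have "0 < ?k"
      using fin M.M.zero_closed by (metis card_gt_0_iff empty_iff)
    then show ?thesis by simp
  qed
  ultimately have "carrier ?T \<subseteq> comb ` (?X \<rightarrow>\<^sub>E {..<?k})"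
    by (metis (no_types, lifting) image_eqI subsetI)
  then show ?thesis
    by (rule finite_subset) (intro finite_imageI finite_PiE finite_cartesian_product fin, simp)
qed

lemma tensor_bimodule_lesspoll:
  fixes M :: "('a, 'b, 'u) bimodule" and N :: "('b, 'c, 'u) bimodule"
  assumes U: "infinite (UNIV :: 'u set)"
    and MN: "right_module B M" "left_module B N"
    and small: "small (carrier M)" "small (carrier N)"
  shows "carrier (tensor_bimodule B M N) \<prec> (UNIV :: 'u set)"
    (is "carrier ?T \<prec> _")
proof (cases "finite (carrier M \<times> carrier N)")
  case True
  interpret M: right_module B M by fact
  interpret N: left_module B N by fact
  have "finite (carrier M)" "finite (carrier N)"
    using True M.M.zero_closed N.M.zero_closed
    by (metis empty_iff finite_cartesian_productD1 finite_cartesian_productD2)+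
  then show ?thesis
    using finite_tensor_bimodule[OF MN] finite_lesspoll_infinite[OF U] by blast
next
  case False
  have "carrier ?T \<lesssim> carrier (free_Abelian_group (carrier M \<times> carrier N))"
    unfolding carrier_tensor_bimodule[OF MN] by (rule image_lepoll)
  also have "\<dots> \<approx> carrier M \<times> carrier N"
    using False by (rule eqpoll_free_Abelian_group_infinite)
  also have "\<dots> \<prec> (UNIV :: 'u set)"
    using small times_lesspoll_infinite[OF U] by (simp add: small_def)
  finally show ?thesis .
qed

lemma lesspoll_Pow:
  assumes U: "universe TYPE('u)" and X: "X \<prec> (UNIV :: 'u set)"
  shows "Pow X \<prec> (UNIV :: 'u set)"
proof -
  obtain g :: "_ \<Rightarrow> 'u" where g: "inj_on g X"
    using lesspoll_imp_lepoll[OF X] by (auto simp: lepoll_def)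
  have "Pow X \<lesssim> Pow (g ` X)"
    unfolding lepoll_def
    by (intro exI[of _ "(`) g"] conjI inj_on_image_Pow g) auto
  also have "Pow (g ` X) \<prec> (UNIV :: 'u set)"
    using U small_image[OF X] by (simp add: universe_def)
  finally show ?thesis .
qed

lemma funcset_lesspoll:
  assumes U: "universe TYPE('u)" and XY: "small (X :: 'u set)" "small (Y :: 'u set)"
  shows "(X \<rightarrow>\<^sub>E Y) \<prec> (UNIV :: 'u set)"
proof -
  have "(X \<rightarrow>\<^sub>E Y) \<lesssim> Pow (X \<times> Y)"
    unfolding lepoll_def
  proof (intro exI conjI)
    show "inj_on (\<lambda>f. (\<lambda>x. (x, f x)) ` X) (X \<rightarrow>\<^sub>E Y)"
      by (rule inj_onI, rule PiE_ext) (auto simp: set_eq_iff image_iff)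
  qed auto
  also have "\<dots> \<prec> (UNIV :: 'u set)"
    using U XY by (intro lesspoll_Pow times_lesspoll_infinite) (auto simp: universe_def small_def)
  finally show ?thesis .
qed

lemma tensor_bitensor:
  fixes M N :: "('u, 'u, 'u) bimodule"
  assumes U: "universe TYPE('u)" and MN: "bimod A B M" "bimod B C N"
    and small: "small (carrier M)" "small (carrier N)"
  shows "bitensor A B C M N (tensor B M N) (pure_tensor B M N)"
    and "small (carrier (tensor B M N))"
proof -
  have less: "carrier (tensor_bimodule B M N) \<prec> (UNIV :: 'u set)"
    using U MN small
    by (intro tensor_bimodule_lesspoll) (auto simp: universe_def bimod_left bimod_right)
  obtain e :: "_ \<Rightarrow> 'u" where "inj_on e (carrier (tensor_bimodule B M N))"
    using lesspoll_imp_lepoll[OF less] by (auto simp: lepoll_def)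
  then have inj: "inj_on (tensor_embedding B M N) (carrier (tensor_bimodule B M N))"
    unfolding tensor_embedding_def
    by (rule someI[where P = "\<lambda>e. inj_on e (carrier (tensor_bimodule B M N))"])
  show "bitensor A B C M N (tensor B M N) (pure_tensor B M N)"
    using bitensor_transport[OF bitensor_tensor_bimodule[OF MN] MN inj]
    unfolding tensor_def pure_tensor_def .
  show "small (carrier (tensor B M N))"
    using small_image[OF less] by (simp add: tensor_def transport_bimodule_def Let_def)
qed


section \<open>Associativity\<close>

lemma triple_tensor_hom_eq:
  assumes S: "tensor_product C N P S q" and T: "tensor_product B M S T r"
    and hk: "h \<in> additive_maps T G" "k \<in> additive_maps T G"
    and eq: "\<And>m n p. \<lbrakk>m \<in> carrier M; n \<in> carrier N; p \<in> carrier P\<rbrakk>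
      \<Longrightarrow> h (r m (q n p)) = k (r m (q n p))"
    and t: "t \<in> carrier T"
  shows "h t = k t"
proof (rule tensor_product_hom_eq[OF T hk _ t])
  fix m s assume m: "m \<in> carrier M" and s: "s \<in> carrier S"
  have r: "r m \<in> additive_maps S T"
    by (rule balanced_additive_right[OF tensor_product_balanced[OF T] m])
  show "h (r m s) = k (r m s)"
    by (rule tensor_product_hom_eq[OF S additive_map_compose[OF r hk(1)]
          additive_map_compose[OF r hk(2)] _ s]) (rule eq[OF m])
qed

text \<open>
  For fixed \<open>m\<close> the assignment \<open>n \<otimes> p \<mapsto> (m \<otimes> n) \<otimes> p\<close> is a map on \<open>N \<otimes> P\<close> by the universal property;
  that it is bilinear in \<open>m\<close> and the element of \<open>N \<otimes> P\<close> is checked on pure tensors.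
\<close>

lemma triple_tensor_hom_exists:
  assumes M: "bimod A B M" and N: "bimod B C N" and P: "bimod C D P"
    and S: "bitensor B C D N P S q" and T: "bitensor A B D M S T r"
    and U: "bitensor A B C M N U u" and V: "bitensor A C D U P V v"
  shows "\<exists>h \<in> bimodule_hom A D T V. \<forall>m \<in> carrier M. \<forall>n \<in> carrier N. \<forall>p \<in> carrier P.
    h (r m (q n p)) = v (u m n) p"
proof -
  interpret M: bimod A B M by (rule M)
  interpret N: bimod B C N by (rule N)
  interpret P: bimod C D P by (rule P)
  interpret S: bimod B D S by (rule bitensor_bimod[OF S])
  interpret T: bimod A D T by (rule bitensor_bimod[OF T])
  interpret U: bimod A C U by (rule bitensor_bimod[OF U])
  interpret V: bimod A D V by (rule bitensor_bimod[OF V])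
  note q = bitensor_bilinear[OF S] and r = bitensor_bilinear[OF T]
    and u = bitensor_bilinear[OF U] and v = bitensor_bilinear[OF V]
  note qb = bilinear_balanced[OF q] and rb = bilinear_balanced[OF r]
    and ub = bilinear_balanced[OF u] and vb = bilinear_balanced[OF v]
  note closed = bilinear_closed[OF q] bilinear_closed[OF r] bilinear_closed[OF u] bilinear_closed[OF v]
    M.smult_closed M.rsmult_closed N.smult_closed N.rsmult_closed P.smult_closed P.rsmult_closed
  note Sp = bitensor_tensor_product[OF S] and Tp = bitensor_tensor_product[OF T]
  have "\<exists>h \<in> additive_maps S V. \<forall>n \<in> carrier N. \<forall>p \<in> carrier P. h (q n p) = v (u m n) p"
    if m: "m \<in> carrier M" for m
  proof -
    have "balanced C N P V (\<lambda>n p. v (u m n) p)"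
      using m by (intro balancedI)
        (simp_all add: closed balanced_add_right[OF ub] balanced_add_left[OF vb]
          balanced_add_right[OF vb] bilinear_rsmult[OF u] balanced_middle[OF vb])
    from tensor_product_universal[OF N.right_module_axioms P.left_module_axioms Sp
        V.M.abelian_group_axioms this]
    show ?thesis by auto
  qed
  then obtain h where h: "\<And>m. m \<in> carrier M \<Longrightarrow> h m \<in> additive_maps S V"
    and h_q: "\<And>m n p. \<lbrakk>m \<in> carrier M; n \<in> carrier N; p \<in> carrier P\<rbrakk> \<Longrightarrow> h m (q n p) = v (u m n) p"
    by metis
  note eqS = tensor_product_hom_eq[OF Sp]
  have "balanced B M S V h"
  proof (rule balancedI)
    fix m m' s s' b
    show "h m s \<in> carrier V" if "m \<in> carrier M" "s \<in> carrier S"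
      using that additive_map_closed[OF h] by blast
    show "h m (s \<oplus>\<^bsub>S\<^esub> s') = h m s \<oplus>\<^bsub>V\<^esub> h m s'"
      if "m \<in> carrier M" "s \<in> carrier S" "s' \<in> carrier S"
      using that additive_map_add[OF h] by blast
    show "h (m \<oplus>\<^bsub>M\<^esub> m') s = h m s \<oplus>\<^bsub>V\<^esub> h m' s"
      if m: "m \<in> carrier M" "m' \<in> carrier M" and s: "s \<in> carrier S"
      by (rule eqS[OF h additive_map_plus[OF V.M.abelian_group_axioms h h] _ s])
        (use m in \<open>simp_all add: h_q closed balanced_add_left[OF ub] balanced_add_left[OF vb]\<close>)
    show "h (m \<odot>\<^sub>r\<^bsub>M\<^esub> b) s = h m (b \<odot>\<^bsub>S\<^esub> s)"
      if m: "m \<in> carrier M" and b: "b \<in> carrier B" and s: "s \<in> carrier S"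
    proof (rule eqS[OF h additive_map_compose[OF smult_additive[OF S.left_module_axioms b] h] _ s])
      fix n p assume np: "n \<in> carrier N" "p \<in> carrier P"
      then have "h m (b \<odot>\<^bsub>S\<^esub> q n p) = h m (q (b \<odot>\<^bsub>N\<^esub> n) p)"
        using b by (simp add: bilinear_smult[OF q])
      then show "h (m \<odot>\<^sub>r\<^bsub>M\<^esub> b) (q n p) = h m (b \<odot>\<^bsub>S\<^esub> q n p)"
        using m b np by (simp add: h_q closed balanced_middle[OF ub])
    qed (use m b in \<open>simp_all add: closed\<close>)
  qed
  moreover have "h (a \<odot>\<^bsub>M\<^esub> m) s = a \<odot>\<^bsub>V\<^esub> h m s"
    if a: "a \<in> carrier A" and m: "m \<in> carrier M" and s: "s \<in> carrier S" for a m s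
    by (rule eqS[OF h additive_map_compose[OF h smult_additive[OF V.left_module_axioms a]] _ s])
      (use a m in \<open>simp_all add: h_q closed bilinear_smult[OF u] bilinear_smult[OF v]\<close>)
  moreover have "h m (s \<odot>\<^sub>r\<^bsub>S\<^esub> d) = h m s \<odot>\<^sub>r\<^bsub>V\<^esub> d"
    if m: "m \<in> carrier M" and s: "s \<in> carrier S" and d: "d \<in> carrier D" for d m s
  proof (rule eqS[OF additive_map_compose[OF rsmult_additive[OF S.right_module_axioms d] h]
        additive_map_compose[OF h rsmult_additive[OF V.right_module_axioms d]] _ s])
    fix n p assume np: "n \<in> carrier N" "p \<in> carrier P"
    then have "h m (q n p \<odot>\<^sub>r\<^bsub>S\<^esub> d) = h m (q n (p \<odot>\<^sub>r\<^bsub>P\<^esub> d))"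
      using d by (simp add: bilinear_rsmult[OF q])
    then show "h m (q n p \<odot>\<^sub>r\<^bsub>S\<^esub> d) = h m (q n p) \<odot>\<^sub>r\<^bsub>V\<^esub> d"
      using m d np by (simp add: h_q closed bilinear_rsmult[OF v])
  qed (use m in simp_all)
  ultimately have "bilinear A B D M S V h"
    by (simp add: bilinear_def)
  from bitensor_the_hom[OF T M S.bimod_axioms V.bimod_axioms this]
  show ?thesis
    by (intro bexI) (auto simp: h_q closed)
qed


section \<open>The bimodule of right linear maps\<close>

text \<open>
  \<open>Hom\<^sub>B(F, Y)\<close> with the left action of \<open>C\<close> on values and the right action of \<open>A\<close> by precomposition
  with its left action on \<open>F\<close>. Maps are extensional, so that equal maps are equal elements.
\<close>

definition right_hom_bimodule ::
  "'b ring \<Rightarrow> ('a, 'b, 'm) bimodule \<Rightarrow> ('c, 'b, 'n) bimodule \<Rightarrow> ('c, 'a, 'm \<Rightarrow> 'n) bimodule" where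
  "right_hom_bimodule B F Y =
    \<lparr>carrier = {h \<in> additive_maps F Y \<inter> extensional (carrier F).
        \<forall>f \<in> carrier F. \<forall>b \<in> carrier B. h (f \<odot>\<^sub>r\<^bsub>F\<^esub> b) = h f \<odot>\<^sub>r\<^bsub>Y\<^esub> b},
     monoid.mult = undefined, monoid.one = undefined,
     ring.zero = (\<lambda>f\<in>carrier F. \<zero>\<^bsub>Y\<^esub>), ring.add = (\<lambda>h k. \<lambda>f\<in>carrier F. h f \<oplus>\<^bsub>Y\<^esub> k f),
     smult = (\<lambda>c h. \<lambda>f\<in>carrier F. c \<odot>\<^bsub>Y\<^esub> h f), rsmult = (\<lambda>h a. \<lambda>f\<in>carrier F. h (a \<odot>\<^bsub>F\<^esub> f))\<rparr>"

lemma carrier_right_hom_bimodule: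
  "h \<in> carrier (right_hom_bimodule B F Y) \<longleftrightarrow>
    h \<in> extensional (carrier F) \<and> (\<forall>f \<in> carrier F. h f \<in> carrier Y) \<and>
    (\<forall>f \<in> carrier F. \<forall>f' \<in> carrier F. h (f \<oplus>\<^bsub>F\<^esub> f') = h f \<oplus>\<^bsub>Y\<^esub> h f') \<and>
    (\<forall>f \<in> carrier F. \<forall>b \<in> carrier B. h (f \<odot>\<^sub>r\<^bsub>F\<^esub> b) = h f \<odot>\<^sub>r\<^bsub>Y\<^esub> b)"
  by (auto simp: right_hom_bimodule_def hom_def)

lemma right_hom_bimodule_simps:
  "\<zero>\<^bsub>right_hom_bimodule B F Y\<^esub> = (\<lambda>f\<in>carrier F. \<zero>\<^bsub>Y\<^esub>)"
  "h \<oplus>\<^bsub>right_hom_bimodule B F Y\<^esub> k = (\<lambda>f\<in>carrier F. h f \<oplus>\<^bsub>Y\<^esub> k f)"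
  "c \<odot>\<^bsub>right_hom_bimodule B F Y\<^esub> h = (\<lambda>f\<in>carrier F. c \<odot>\<^bsub>Y\<^esub> h f)"
  "h \<odot>\<^sub>r\<^bsub>right_hom_bimodule B F Y\<^esub> a = (\<lambda>f\<in>carrier F. h (a \<odot>\<^bsub>F\<^esub> f))"
  by (simp_all add: right_hom_bimodule_def)

lemma bimod_right_hom_bimodule:
  assumes F: "bimod A B F" and Y: "bimod C B Y"
  shows "bimod C A (right_hom_bimodule B F Y)" (is "bimod C A ?H")
proof -
  interpret F: bimod A B F by (rule F)
  interpret Y: bimod C B Y by (rule Y)
  note simps = carrier_right_hom_bimodule right_hom_bimodule_simps
    F.smult_closed F.rsmult_closed Y.smult_closed Y.rsmult_closed
  have ext: "h = (\<lambda>f\<in>carrier F. g f)"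
    if "h \<in> carrier ?H" "\<And>f. f \<in> carrier F \<Longrightarrow> h f = g f" for h g
    using that by (intro extensionalityI[of _ "carrier F"]) (auto simp: simps)
  interpret H: abelian_group ?H
  proof (rule abelian_groupI)
    fix h k l assume h: "h \<in> carrier ?H" and k: "k \<in> carrier ?H" and l: "l \<in> carrier ?H"
    show "h \<oplus>\<^bsub>?H\<^esub> k \<in> carrier ?H"
      using h k by (auto simp: simps Y.M.a_ac Y.rsmult_add)
    show "h \<oplus>\<^bsub>?H\<^esub> k \<oplus>\<^bsub>?H\<^esub> l = h \<oplus>\<^bsub>?H\<^esub> (k \<oplus>\<^bsub>?H\<^esub> l)"
      using h k l by (auto simp: simps Y.M.a_ac intro!: restrict_ext)
    show "h \<oplus>\<^bsub>?H\<^esub> k = k \<oplus>\<^bsub>?H\<^esub> h"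
      using h k by (auto simp: simps Y.M.a_ac intro!: restrict_ext)
  next
    have "\<zero>\<^bsub>Y\<^esub> \<odot>\<^sub>r\<^bsub>Y\<^esub> b = \<zero>\<^bsub>Y\<^esub>" if "b \<in> carrier B" for b
      using additive_map_zero[OF Y.M.abelian_group_axioms Y.M.abelian_group_axioms
          rsmult_additive[OF Y.right_module_axioms that]] .
    then show "\<zero>\<^bsub>?H\<^esub> \<in> carrier ?H"
      by (auto simp: simps)
  next
    fix h assume h: "h \<in> carrier ?H"
    show "\<zero>\<^bsub>?H\<^esub> \<oplus>\<^bsub>?H\<^esub> h = h"
      by (subst right_hom_bimodule_simps, rule sym, rule ext[OF h]) (use h in \<open>simp add: simps\<close>)
    have neg: "(\<ominus>\<^bsub>Y\<^esub> y) \<odot>\<^sub>r\<^bsub>Y\<^esub> b = \<ominus>\<^bsub>Y\<^esub> (y \<odot>\<^sub>r\<^bsub>Y\<^esub> b)" if "y \<in> carrier Y" "b \<in> carrier B" for y b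
    proof -
      interpret r: group_hom "add_monoid Y" "add_monoid Y" "\<lambda>y. y \<odot>\<^sub>r\<^bsub>Y\<^esub> b"
        using rsmult_additive[OF Y.right_module_axioms that(2)] Y.M.a_group
        by (simp add: group_hom_def group_hom_axioms_def)
      show ?thesis using r.hom_inv[of y] that by (simp add: a_inv_def)
    qed
    show "\<exists>k\<in>carrier ?H. k \<oplus>\<^bsub>?H\<^esub> h = \<zero>\<^bsub>?H\<^esub>"
      using h by (intro bexI[of _ "\<lambda>f\<in>carrier F. \<ominus>\<^bsub>Y\<^esub> h f"])
        (auto simp: simps neg Y.M.l_neg Y.M.minus_add intro!: restrict_ext)
  qed
  show ?thesis
  proof unfold_locales
    fix c c' a a' h k
    show "c \<odot>\<^bsub>?H\<^esub> h \<in> carrier ?H" if "c \<in> carrier C" "h \<in> carrier ?H"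
      using that by (auto simp: simps Y.smult_add Y.smult_rsmult)
    show "h \<odot>\<^sub>r\<^bsub>?H\<^esub> a \<in> carrier ?H" if "h \<in> carrier ?H" "a \<in> carrier A"
      using that by (auto simp: simps F.smult_add F.smult_rsmult[symmetric])
    show "(c \<oplus>\<^bsub>C\<^esub> c') \<odot>\<^bsub>?H\<^esub> h = c \<odot>\<^bsub>?H\<^esub> h \<oplus>\<^bsub>?H\<^esub> c' \<odot>\<^bsub>?H\<^esub> h"
      if "c \<in> carrier C" "c' \<in> carrier C" "h \<in> carrier ?H"
      using that by (auto simp: simps Y.smult_add_scalar intro!: restrict_ext)
    show "c \<odot>\<^bsub>?H\<^esub> (h \<oplus>\<^bsub>?H\<^esub> k) = c \<odot>\<^bsub>?H\<^esub> h \<oplus>\<^bsub>?H\<^esub> c \<odot>\<^bsub>?H\<^esub> k"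
      if "c \<in> carrier C" "h \<in> carrier ?H" "k \<in> carrier ?H"
      using that by (auto simp: simps Y.smult_add intro!: restrict_ext)
    show "(c \<otimes>\<^bsub>C\<^esub> c') \<odot>\<^bsub>?H\<^esub> h = c \<odot>\<^bsub>?H\<^esub> (c' \<odot>\<^bsub>?H\<^esub> h)"
      if "c \<in> carrier C" "c' \<in> carrier C" "h \<in> carrier ?H"
      using that by (auto simp: simps Y.smult_assoc intro!: restrict_ext)
    show "h \<odot>\<^sub>r\<^bsub>?H\<^esub> (a \<oplus>\<^bsub>A\<^esub> a') = h \<odot>\<^sub>r\<^bsub>?H\<^esub> a \<oplus>\<^bsub>?H\<^esub> h \<odot>\<^sub>r\<^bsub>?H\<^esub> a'"
      if "h \<in> carrier ?H" "a \<in> carrier A" "a' \<in> carrier A"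
      using that by (auto simp: simps F.smult_add_scalar intro!: restrict_ext)
    show "(h \<oplus>\<^bsub>?H\<^esub> k) \<odot>\<^sub>r\<^bsub>?H\<^esub> a = h \<odot>\<^sub>r\<^bsub>?H\<^esub> a \<oplus>\<^bsub>?H\<^esub> k \<odot>\<^sub>r\<^bsub>?H\<^esub> a"
      if "h \<in> carrier ?H" "k \<in> carrier ?H" "a \<in> carrier A"
      using that by (auto simp: simps intro!: restrict_ext)
    show "h \<odot>\<^sub>r\<^bsub>?H\<^esub> (a \<otimes>\<^bsub>A\<^esub> a') = h \<odot>\<^sub>r\<^bsub>?H\<^esub> a \<odot>\<^sub>r\<^bsub>?H\<^esub> a'"
      if "h \<in> carrier ?H" "a \<in> carrier A" "a' \<in> carrier A"
      using that by (auto simp: simps F.smult_assoc intro!: restrict_ext)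
    show "(c \<odot>\<^bsub>?H\<^esub> h) \<odot>\<^sub>r\<^bsub>?H\<^esub> a = c \<odot>\<^bsub>?H\<^esub> (h \<odot>\<^sub>r\<^bsub>?H\<^esub> a)"
      if "c \<in> carrier C" "h \<in> carrier ?H" "a \<in> carrier A"
      using that by (auto simp: simps intro!: restrict_ext)
  qed
qed

lemma bilinear_eval:
  assumes F: "bimod A B F" and Y: "bimod C B Y"
  shows "bilinear C A B (right_hom_bimodule B F Y) F Y (\<lambda>h f. h f)"
proof -
  interpret F: bimod A B F by (rule F)
  interpret Y: bimod C B Y by (rule Y)
  show ?thesis
    by (simp add: bilinear_def balanced_def carrier_right_hom_bimodule right_hom_bimodule_simps)
qed

text \<open>
  Currying: linearity over \<open>B\<close> puts each \<open>k x\<close> into \<open>Hom\<^sub>B(F, Y)\<close>, and balancedness over \<open>A\<close>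
  becomes right linearity of \<open>x \<mapsto> k x\<close>.
\<close>

lemma right_hom_bimodule_curry:
  assumes F: "bimod A B F" and Y: "bimod C B Y" and X: "bimod C A X"
    and k: "bilinear C A B X F Y k"
  shows "\<exists>u \<in> bimodule_hom C A X (right_hom_bimodule B F Y).
    \<forall>x \<in> carrier X. \<forall>f \<in> carrier F. u x f = k x f"
proof -
  interpret F: bimod A B F by (rule F)
  interpret Y: bimod C B Y by (rule Y)
  interpret X: bimod C A X by (rule X)
  let ?H = "right_hom_bimodule B F Y"
  note simps = carrier_right_hom_bimodule right_hom_bimodule_simps F.smult_closed F.rsmult_closed
    X.smult_closed X.rsmult_closed
  note kb = bilinear_balanced[OF k]
  let ?u = "\<lambda>x\<in>carrier X. \<lambda>f\<in>carrier F. k x f"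
  have "?u \<in> bimodule_hom C A X ?H"
  proof (rule bimodule_homI)
    show "?u \<in> additive_maps X ?H"
      by (rule additive_mapI)
        (auto simp: simps balanced_closed[OF kb] balanced_add_left[OF kb] balanced_add_right[OF kb]
          bilinear_rsmult[OF k] intro!: restrict_ext)
  qed (auto simp: simps bilinear_smult[OF k] balanced_middle[OF kb] intro!: restrict_ext)
  then show ?thesis
    by (intro bexI[of _ ?u]) auto
qed

lemma small_right_hom_bimodule:
  fixes F :: "('a, 'b, 'u) bimodule" and Y :: "('c, 'b, 'u) bimodule"
  assumes U: "universe TYPE('u)" and "small (carrier F)" "small (carrier Y)"
  shows "carrier (right_hom_bimodule B F Y) \<prec> (UNIV :: 'u set)"
proof (rule lesspoll_trans1[OF subset_imp_lepoll funcset_lesspoll[OF assms]])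
  show "carrier (right_hom_bimodule B F Y) \<subseteq> carrier F \<rightarrow>\<^sub>E carrier Y"
    by (simp add: PiE_def Pi_def carrier_right_hom_bimodule subset_iff)
qed


section \<open>Firm coreflections\<close>

text \<open>
  The coreflection of a module \<open>H\<close> into firm modules is \<open>A \<otimes>\<^sub>A H \<rightarrow> H\<close>. A map \<open>u : X \<rightarrow> H\<close> from a
  firm \<open>X\<close> lifts to \<open>a x \<mapsto> a \<otimes> u x\<close>; the lift is unique because \<open>a t = a \<otimes> \<pi> t\<close> for all
  \<open>t \<in> A \<otimes>\<^sub>A H\<close>.
\<close>

lemma firm_left_coreflection:
  fixes H :: "('u, 'u, 'u) bimodule"
  assumes U: "universe TYPE('u)" and A: "firm_ring A" "small (carrier A)"
    and H: "bimod A B H" "small (carrier H)"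
  obtains E :: "('u, 'u, 'u) bimodule" and \<pi> where "bimod A B E" "small (carrier E)" "firm_left A E"
    "firm_right B H \<Longrightarrow> firm_right B E" "\<pi> \<in> bimodule_hom A B E H"
    "\<And>(X :: ('u, 'u, 'u) bimodule) u. \<lbrakk>bimod A B X; firm_left A X; u \<in> bimodule_hom A B X H\<rbrakk> \<Longrightarrow>
      \<exists>!v. v \<in> bimodule_hom A B X E \<and> (\<forall>x \<in> carrier X. \<pi> (v x) = u x)"
proof -
  let ?R = "regular_bimodule A"
  let ?E = "tensor A ?R H" and ?q = "pure_tensor A ?R H"
  have R: "bimod A A ?R" "small (carrier ?R)" "firm_left A ?R"
    using A by (simp_all add: firm_ring_def bimod_regular)
  note E = tensor_bitensor[OF U R(1) H(1) R(2) H(2)]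
  note q = bitensor_bilinear[OF E(1)] and tp = bitensor_tensor_product[OF E(1)]
  note qb = bilinear_balanced[OF q]
  interpret H: bimod A B H by (rule H)
  interpret E: bimod A B ?E by (rule bitensor_bimod[OF E(1)])
  have "bilinear A A B ?R H H (\<lambda>a h. a \<odot>\<^bsub>H\<^esub> h)"
    using left_action_balanced[OF H.left_module_axioms]
    by (simp add: bilinear_def H.smult_assoc H.smult_rsmult)
  from bitensor_the_hom[OF E(1) R(1) H(1) H(1) this]
  obtain \<pi> where \<pi>: "\<pi> \<in> bimodule_hom A B ?E H"
    and \<pi>_q: "\<And>a h. \<lbrakk>a \<in> carrier A; h \<in> carrier H\<rbrakk> \<Longrightarrow> \<pi> (?q a h) = a \<odot>\<^bsub>H\<^esub> h"
    by auto
  have smult_eq: "a \<odot>\<^bsub>?E\<^esub> t = ?q a (\<pi> t)" if a: "a \<in> carrier A" and t: "t \<in> carrier ?E" for a t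
  proof (rule tensor_product_hom_eq[OF tp smult_additive[OF E.left_module_axioms a]
        additive_map_compose[OF bimodule_hom_additive[OF \<pi>] balanced_additive_right[OF qb]] _ t])
    fix s h assume "s \<in> carrier ?R" "h \<in> carrier H"
    then show "a \<odot>\<^bsub>?E\<^esub> ?q s h = ?q a (\<pi> (?q s h))"
      using a bilinear_smult[OF q, of a s h] balanced_middle[OF qb, of a s h] by (simp add: \<pi>_q)
  qed (use a in simp)
  have univ: "\<exists>!v. v \<in> bimodule_hom A B X ?E \<and> (\<forall>x \<in> carrier X. \<pi> (v x) = u x)"
    if X: "bimod A B X" "firm_left A X" and u: "u \<in> bimodule_hom A B X H"
    for X :: "('u, 'u, 'u) bimodule" and u
  proof -
    interpret X: bimod A B X by (rule X)
    have Xt: "tensor_product A ?R X X (\<lambda>a x. a \<odot>\<^bsub>X\<^esub> x)"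
      using X firm_left_iff[OF X.left_module_axioms] by simp
    then have XT: "bitensor A A B ?R X X (\<lambda>a x. a \<odot>\<^bsub>X\<^esub> x)"
      using tensor_product_balanced[OF Xt]
      by (simp add: bitensor_def X.bimod_axioms bilinear_def X.smult_assoc X.smult_rsmult)
    have u_closed: "u x \<in> carrier H" if "x \<in> carrier X" for x
      using bimodule_hom_closed[OF u that] .
    have "bilinear A A B ?R X ?E (\<lambda>a x. ?q a (u x))"
      unfolding bilinear_def balanced_def
      using bilinear_smult[OF q] bilinear_rsmult[OF q] balanced_middle[OF qb]
        balanced_add_left[OF qb] balanced_add_right[OF qb] balanced_closed[OF qb]
      by (simp add: u_closed additive_map_add[OF bimodule_hom_additive[OF u]]
          bimodule_hom_smult[OF u] bimodule_hom_rsmult[OF u])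
    from bitensor_the_hom[OF XT R(1) X(1) E.bimod_axioms this]
    obtain v where v: "v \<in> bimodule_hom A B X ?E"
      and v_smult: "\<And>a x. \<lbrakk>a \<in> carrier A; x \<in> carrier X\<rbrakk> \<Longrightarrow> v (a \<odot>\<^bsub>X\<^esub> x) = ?q a (u x)"
      by auto
    show ?thesis
    proof (rule ex1I[of _ v], intro conjI ballI)
      show "\<pi> (v x) = u x" if "x \<in> carrier X" for x
        by (rule tensor_product_hom_eq[OF Xt additive_map_compose[OF bimodule_hom_additive[OF v]
                bimodule_hom_additive[OF \<pi>]] bimodule_hom_additive[OF u] _ that])
          (simp add: v_smult \<pi>_q u_closed bimodule_hom_smult[OF u])
    next
      fix w assume w: "w \<in> bimodule_hom A B X ?E \<and> (\<forall>x \<in> carrier X. \<pi> (w x) = u x)"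
      then have w_hom: "w \<in> bimodule_hom A B X ?E" by simp
      show "w = v"
      proof (rule bimodule_hom_eqI[OF w_hom v])
        fix x assume x: "x \<in> carrier X"
        show "w x = v x"
        proof (rule tensor_product_hom_eq[OF Xt bimodule_hom_additive[OF w_hom]
              bimodule_hom_additive[OF v] _ x])
          fix a y assume "a \<in> carrier ?R" "y \<in> carrier X"
          then show "w (a \<odot>\<^bsub>X\<^esub> y) = v (a \<odot>\<^bsub>X\<^esub> y)"
            using w by (simp add: v_smult bimodule_hom_smult[OF w_hom] smult_eq
                bimodule_hom_closed[OF w_hom])
        qed
      qed
    qed (rule v)
  qed
  show thesis
    by (rule that[OF E.bimod_axioms E(2) firm_left_bitensor[OF E(1) R(1) H(1) R(3)]
          firm_right_bitensor[OF E(1) R(1) H(1)] \<pi> univ])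
qed

lemma firm_right_coreflection:
  fixes H :: "('u, 'u, 'u) bimodule"
  assumes U: "universe TYPE('u)" and B: "firm_ring B" "small (carrier B)"
    and H: "bimod A B H" "small (carrier H)"
  obtains E :: "('u, 'u, 'u) bimodule" and \<pi> where "bimod A B E" "small (carrier E)" "firm_right B E"
    "firm_left A H \<Longrightarrow> firm_left A E" "\<pi> \<in> bimodule_hom A B E H"
    "\<And>(X :: ('u, 'u, 'u) bimodule) u. \<lbrakk>bimod A B X; firm_right B X; u \<in> bimodule_hom A B X H\<rbrakk> \<Longrightarrow>
      \<exists>!v. v \<in> bimodule_hom A B X E \<and> (\<forall>x \<in> carrier X. \<pi> (v x) = u x)"
proof -
  have small: "small (carrier (op_ring B))" "small (carrier (op_bimodule H))"
    using B H by simp_all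
  show ?thesis
  proof (rule firm_left_coreflection[OF U firm_ring_op[OF B(1)] small(1) bimod_op[OF H(1)] small(2)])
    fix E :: "('u, 'u, 'u) bimodule" and \<pi>
    assume E: "bimod (op_ring B) (op_ring A) E" "small (carrier E)" "firm_left (op_ring B) E"
        "firm_right (op_ring A) (op_bimodule H) \<Longrightarrow> firm_right (op_ring A) E"
      and \<pi>: "\<pi> \<in> bimodule_hom (op_ring B) (op_ring A) E (op_bimodule H)"
      and univ: "\<And>(X :: ('u, 'u, 'u) bimodule) u. \<lbrakk>bimod (op_ring B) (op_ring A) X;
          firm_left (op_ring B) X; u \<in> bimodule_hom (op_ring B) (op_ring A) X (op_bimodule H)\<rbrakk> \<Longrightarrow>
        \<exists>!v. v \<in> bimodule_hom (op_ring B) (op_ring A) X E \<and> (\<forall>x \<in> carrier X. \<pi> (v x) = u x)"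
    let ?E = "op_bimodule E"
    show thesis
    proof (rule that[of ?E \<pi>])
      show "bimod A B ?E"
        using bimod_op[OF E(1)] by simp
      show "small (carrier ?E)"
        using E(2) by simp
      show "firm_right B ?E"
        using firm_right_op[OF bimod_left[OF E(1)] E(3)] by simp
      show "firm_left A ?E" if "firm_left A H"
        using firm_left_op[OF bimod_right[OF E(1)] E(4)[OF firm_right_op[OF bimod_left[OF H(1)] that]]]
        by simp
      show "\<pi> \<in> bimodule_hom A B ?E H"
        using \<pi> bimodule_hom_op[of B A ?E H] by simp
      show "\<exists>!v. v \<in> bimodule_hom A B X ?E \<and> (\<forall>x \<in> carrier X. \<pi> (v x) = u x)"
        if X: "bimod A B X" "firm_right B X" "u \<in> bimodule_hom A B X H"
        for X :: "('u, 'u, 'u) bimodule" and u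
        using univ[OF bimod_op[OF X(1)] firm_left_op[OF bimod_right[OF X(1)] X(2)], of u] X(3)
          bimodule_hom_op[of B A X H] bimodule_hom_op[of B A X ?E] by simp
    qed
  qed
qed


section \<open>Residuals\<close>

lemma bimodule_hom_compose:
  assumes M: "bimod A B M" and h: "h \<in> bimodule_hom A B M N" and k: "k \<in> bimodule_hom A B N P"
  shows "compose (carrier M) k h \<in> bimodule_hom A B M P"
proof -
  interpret M: bimod A B M by (rule M)
  show ?thesis
  proof (rule bimodule_homI)
    show "compose (carrier M) k h \<in> additive_maps M P"
      unfolding compose_def
      by (rule additive_map_restrict[OF M.M.abelian_group_axioms
            additive_map_compose[OF bimodule_hom_additive[OF h] bimodule_hom_additive[OF k]]])
  qed (simp_all add: compose_def M.smult_closed M.rsmult_closed bimodule_hom_closed[OF h]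
      bimodule_hom_smult[OF h] bimodule_hom_smult[OF k] bimodule_hom_rsmult[OF h]
      bimodule_hom_rsmult[OF k])
qed

lemma bilinear_bimodule_hom:
  assumes f: "bilinear A B C M N G f" and u: "u \<in> bimodule_hom A B M' M"
  shows "bilinear A B C M' N G (\<lambda>m n. f (u m) n)"
  using bilinear_balanced[OF f] bilinear_smult[OF f] bilinear_rsmult[OF f]
  by (simp add: bilinear_def balanced_def bimodule_hom_closed[OF u] bimodule_hom_smult[OF u]
      bimodule_hom_rsmult[OF u] additive_map_add[OF bimodule_hom_additive[OF u]])

text \<open>
  The representing object is \<open>(C \<otimes>\<^sub>C H) \<otimes>\<^sub>A A\<close>, where \<open>H\<close> is a copy of \<open>Hom\<^sub>B(F, Y)\<close> inside the
  universe: a bilinear map is curried and then lifted along the two coreflections.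
\<close>

lemma right_residual:
  fixes F Y :: "('u, 'u, 'u) bimodule"
  assumes U: "universe TYPE('u)"
    and A: "firm_ring A" "small (carrier A)" and C: "firm_ring C" "small (carrier C)"
    and F: "bimod A B F" "small (carrier F)" and Y: "bimod C B Y" "small (carrier Y)"
  obtains G :: "('u, 'u, 'u) bimodule" and e where "firm_bimodule C A G" "small (carrier G)"
    "bilinear C A B G F Y e"
    "\<And>(X :: ('u, 'u, 'u) bimodule) k. \<lbrakk>firm_bimodule C A X; bilinear C A B X F Y k\<rbrakk> \<Longrightarrow>
      \<exists>!u. u \<in> bimodule_hom C A X G \<and> (\<forall>x \<in> carrier X. \<forall>f \<in> carrier F. k x f = e (u x) f)"
proof -
  let ?H\<^sub>0 = "right_hom_bimodule B F Y"
  have H\<^sub>0: "bimod C A ?H\<^sub>0"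
    by (rule bimod_right_hom_bimodule[OF F(1) Y(1)])
  have less: "carrier ?H\<^sub>0 \<prec> (UNIV :: 'u set)"
    by (rule small_right_hom_bimodule[OF U F(2) Y(2)])
  obtain i :: "_ \<Rightarrow> 'u" where i: "inj_on i (carrier ?H\<^sub>0)"
    using lesspoll_imp_lepoll[OF less] by (auto simp: lepoll_def)
  let ?H = "transport_bimodule i ?H\<^sub>0"
  note tr = bimod_transport[OF H\<^sub>0 i]
  have carr: "carrier ?H = i ` carrier ?H\<^sub>0"
    by (simp add: transport_bimodule_def Let_def)
  then have H: "bimod C A ?H" "small (carrier ?H)"
    using tr(1) small_image[OF less] by simp_all
  interpret H\<^sub>0: bimod C A ?H\<^sub>0 by (rule H\<^sub>0)
  interpret H: bimod C A ?H by (rule H(1))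
  define j where "j = restrict (inv_into (carrier ?H\<^sub>0) i) (carrier ?H)"
  have j_i: "j (i h) = h" if "h \<in> carrier ?H\<^sub>0" for h
    using that i by (simp add: j_def carr)
  have j: "j \<in> bimodule_hom C A ?H ?H\<^sub>0"
  proof (rule bimodule_homI)
    show "j \<in> additive_maps ?H ?H\<^sub>0"
      unfolding j_def by (rule additive_map_restrict[OF H.M.abelian_group_axioms tr(3)])
  qed (auto simp: carr tr(4,5) j_i H\<^sub>0.smult_closed H\<^sub>0.rsmult_closed, simp add: j_def carr)
  have i_hom: "restrict i (carrier ?H\<^sub>0) \<in> bimodule_hom C A ?H\<^sub>0 ?H"
    by (rule bimodule_homI[OF additive_map_restrict[OF H\<^sub>0.M.abelian_group_axioms tr(2)]])
      (simp_all add: tr(4,5) H\<^sub>0.smult_closed H\<^sub>0.rsmult_closed)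
  show thesis
  proof (rule firm_left_coreflection[OF U C H])
    fix E\<^sub>1 :: "('u, 'u, 'u) bimodule" and \<pi>\<^sub>1
    assume E\<^sub>1: "bimod C A E\<^sub>1" "small (carrier E\<^sub>1)" "firm_left C E\<^sub>1"
      and \<pi>\<^sub>1: "\<pi>\<^sub>1 \<in> bimodule_hom C A E\<^sub>1 ?H"
      and univ\<^sub>1: "\<And>(X :: ('u, 'u, 'u) bimodule) u. \<lbrakk>bimod C A X; firm_left C X;
          u \<in> bimodule_hom C A X ?H\<rbrakk> \<Longrightarrow>
        \<exists>!v. v \<in> bimodule_hom C A X E\<^sub>1 \<and> (\<forall>x \<in> carrier X. \<pi>\<^sub>1 (v x) = u x)"
    show thesis
    proof (rule firm_right_coreflection[OF U A E\<^sub>1(1,2)])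
      fix E :: "('u, 'u, 'u) bimodule" and \<pi>
      assume E: "bimod C A E" "small (carrier E)" "firm_right A E"
          "firm_left C E\<^sub>1 \<Longrightarrow> firm_left C E"
        and \<pi>: "\<pi> \<in> bimodule_hom C A E E\<^sub>1"
        and univ: "\<And>(X :: ('u, 'u, 'u) bimodule) u. \<lbrakk>bimod C A X; firm_right A X;
            u \<in> bimodule_hom C A X E\<^sub>1\<rbrakk> \<Longrightarrow>
          \<exists>!v. v \<in> bimodule_hom C A X E \<and> (\<forall>x \<in> carrier X. \<pi> (v x) = u x)"
      let ?e = "\<lambda>g f. j (\<pi>\<^sub>1 (\<pi> g)) f"
      show thesis
      proof (rule that[of E ?e])
        show "firm_bimodule C A E" "small (carrier E)"
          using E E\<^sub>1(3) by (simp_all add: firm_bimodule_def)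
        show "bilinear C A B E F Y ?e"
          by (intro bilinear_bimodule_hom[OF _ \<pi>] bilinear_bimodule_hom[OF _ \<pi>\<^sub>1]
              bilinear_bimodule_hom[OF _ j] bilinear_eval[OF F(1) Y(1)])
        fix X :: "('u, 'u, 'u) bimodule" and k
        assume X: "firm_bimodule C A X" and k: "bilinear C A B X F Y k"
        then have X': "bimod C A X" "firm_left C X" "firm_right A X"
          by (simp_all add: firm_bimodule_def)
        obtain u\<^sub>0 where u\<^sub>0: "u\<^sub>0 \<in> bimodule_hom C A X ?H\<^sub>0"
          "\<And>x f. \<lbrakk>x \<in> carrier X; f \<in> carrier F\<rbrakk> \<Longrightarrow> u\<^sub>0 x f = k x f"
          using right_hom_bimodule_curry[OF F(1) Y(1) X'(1) k] by auto
        define u where "u = compose (carrier X) (restrict i (carrier ?H\<^sub>0)) u\<^sub>0"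
        have u: "u \<in> bimodule_hom C A X ?H"
          unfolding u_def by (rule bimodule_hom_compose[OF X'(1) u\<^sub>0(1) i_hom])
        have u_eq: "u x = i (u\<^sub>0 x)" if "x \<in> carrier X" for x
          using that bimodule_hom_closed[OF u\<^sub>0(1)] by (simp add: u_def compose_eq)
        \<comment> \<open>Representing \<open>k\<close> through \<open>e\<close> is the same as lifting \<open>u\<close> along both coreflections.\<close>
        have key: "(\<forall>x \<in> carrier X. \<forall>f \<in> carrier F. k x f = ?e (w x) f) \<longleftrightarrow>
            (\<forall>x \<in> carrier X. \<pi>\<^sub>1 (\<pi> (w x)) = u x)"
          if w: "w \<in> bimodule_hom C A X E" for w
        proof (intro iffI ballI)
          fix x assume x: "x \<in> carrier X"
            and eq: "\<forall>x \<in> carrier X. \<forall>f \<in> carrier F. k x f = ?e (w x) f"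
          have mem: "\<pi>\<^sub>1 (\<pi> (w x)) \<in> carrier ?H"
            using x bimodule_hom_closed[OF \<pi>\<^sub>1] bimodule_hom_closed[OF \<pi>] bimodule_hom_closed[OF w]
            by blast
          then obtain h where h: "\<pi>\<^sub>1 (\<pi> (w x)) = i h" "h \<in> carrier ?H\<^sub>0"
            unfolding carr by blast
          have "h = u\<^sub>0 x"
            using h eq x u\<^sub>0(2) bimodule_hom_closed[OF u\<^sub>0(1) x]
            by (intro extensionalityI[of _ "carrier F"]) (auto simp: carrier_right_hom_bimodule j_i)
          then show "\<pi>\<^sub>1 (\<pi> (w x)) = u x"
            using h x by (simp add: u_eq)
        next
          fix x f assume x: "x \<in> carrier X" and f: "f \<in> carrier F"
            and eq: "\<forall>x \<in> carrier X. \<pi>\<^sub>1 (\<pi> (w x)) = u x"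
          then show "k x f = ?e (w x) f"
            using bimodule_hom_closed[OF u\<^sub>0(1) x] by (simp add: u_eq j_i u\<^sub>0(2))
        qed
        obtain v\<^sub>1 where v\<^sub>1: "v\<^sub>1 \<in> bimodule_hom C A X E\<^sub>1" "\<forall>x \<in> carrier X. \<pi>\<^sub>1 (v\<^sub>1 x) = u x"
          and v\<^sub>1_unique: "\<And>w. \<lbrakk>w \<in> bimodule_hom C A X E\<^sub>1; \<forall>x \<in> carrier X. \<pi>\<^sub>1 (w x) = u x\<rbrakk> \<Longrightarrow> w = v\<^sub>1"
          using univ\<^sub>1[OF X'(1,2) u] by (elim ex1E) blast
        obtain v where v: "v \<in> bimodule_hom C A X E" "\<forall>x \<in> carrier X. \<pi> (v x) = v\<^sub>1 x"
          and v_unique: "\<And>w. \<lbrakk>w \<in> bimodule_hom C A X E; \<forall>x \<in> carrier X. \<pi> (w x) = v\<^sub>1 x\<rbrakk> \<Longrightarrow> w = v"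
          using univ[OF X'(1,3) v\<^sub>1(1)] by (elim ex1E) blast
        show "\<exists>!u. u \<in> bimodule_hom C A X E \<and> (\<forall>x \<in> carrier X. \<forall>f \<in> carrier F. k x f = ?e (u x) f)"
        proof (rule ex1I[of _ v])
          show "v \<in> bimodule_hom C A X E \<and> (\<forall>x \<in> carrier X. \<forall>f \<in> carrier F. k x f = ?e (v x) f)"
            using v v\<^sub>1(2) key[OF v(1)] by simp
          fix w assume "w \<in> bimodule_hom C A X E \<and> (\<forall>x \<in> carrier X. \<forall>f \<in> carrier F. k x f = ?e (w x) f)"
          then have w: "w \<in> bimodule_hom C A X E" "\<forall>x \<in> carrier X. \<pi>\<^sub>1 (\<pi> (w x)) = u x"
            using key by blast+
          have "compose (carrier X) \<pi> w = v\<^sub>1"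
            by (rule v\<^sub>1_unique[OF bimodule_hom_compose[OF X'(1) w(1) \<pi>]]) (use w in \<open>simp add: compose_eq\<close>)
          then show "w = v"
            by (intro v_unique w(1)) (auto simp: compose_eq)
        qed
      qed
    qed
  qed
qed

lemma left_residual:
  fixes F Z :: "('u, 'u, 'u) bimodule"
  assumes U: "universe TYPE('u)"
    and B: "firm_ring B" "small (carrier B)" and C: "firm_ring C" "small (carrier C)"
    and F: "bimod A B F" "small (carrier F)" and Z: "bimod A C Z" "small (carrier Z)"
  obtains G :: "('u, 'u, 'u) bimodule" and e where "firm_bimodule B C G" "small (carrier G)"
    "bilinear A B C F G Z e"
    "\<And>(X :: ('u, 'u, 'u) bimodule) k. \<lbrakk>firm_bimodule B C X; bilinear A B C F X Z k\<rbrakk> \<Longrightarrow>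
      \<exists>!u. u \<in> bimodule_hom B C X G \<and> (\<forall>x \<in> carrier X. \<forall>f \<in> carrier F. k f x = e f (u x))"
proof -
  have small: "small (carrier (op_ring B))" "small (carrier (op_ring C))"
    "small (carrier (op_bimodule F))" "small (carrier (op_bimodule Z))"
    using B C F Z by simp_all
  show thesis
  proof (rule right_residual[OF U firm_ring_op[OF B(1)] small(1) firm_ring_op[OF C(1)] small(2)
        bimod_op[OF F(1)] small(3) bimod_op[OF Z(1)] small(4)])
    fix G :: "('u, 'u, 'u) bimodule" and e
    assume G: "firm_bimodule (op_ring C) (op_ring B) G" "small (carrier G)"
      and e: "bilinear (op_ring C) (op_ring B) (op_ring A) G (op_bimodule F) (op_bimodule Z) e"
      and univ: "\<And>(X :: ('u, 'u, 'u) bimodule) k. \<lbrakk>firm_bimodule (op_ring C) (op_ring B) X;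
          bilinear (op_ring C) (op_ring B) (op_ring A) X (op_bimodule F) (op_bimodule Z) k\<rbrakk> \<Longrightarrow>
        \<exists>!u. u \<in> bimodule_hom (op_ring C) (op_ring B) X G \<and>
          (\<forall>x \<in> carrier X. \<forall>f \<in> carrier (op_bimodule F). k x f = e (u x) f)"
    show thesis
    proof (rule that[of "op_bimodule G" "\<lambda>f g. e g f"])
      show "firm_bimodule B C (op_bimodule G)"
        using firm_bimodule_op[OF G(1)] by simp
      show "small (carrier (op_bimodule G))"
        using G(2) by simp
      show "bilinear A B C F (op_bimodule G) Z (\<lambda>f g. e g f)"
        using bilinear_op[OF e] by simp
      show "\<exists>!u. u \<in> bimodule_hom B C X (op_bimodule G) \<and>
          (\<forall>x \<in> carrier X. \<forall>f \<in> carrier F. k f x = e (u x) f)"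
        if X: "firm_bimodule B C X" "bilinear A B C F X Z k" for X :: "('u, 'u, 'u) bimodule" and k
        using univ[OF firm_bimodule_op[OF X(1)] bilinear_op[OF X(2)]]
          bimodule_hom_op[of C B X "op_bimodule G"] by simp
    qed
  qed
qed


section \<open>Adjoints from universal arrows\<close>

lemma has_right_adjointI:
  assumes F: "functor_between C D F"
    and universal: "\<And>Y. Y \<in> Obj D \<Longrightarrow> \<exists>G \<in> Obj C. \<exists>e \<in> Hom D (fobj F G) Y.
      \<forall>X \<in> Obj C. \<forall>h \<in> Hom D (fobj F X) Y.
        \<exists>!u. u \<in> Hom C X G \<and> Comp D (fobj F X) (fobj F G) Y e (farr F X G u) = h"
  shows "has_right_adjoint C D F"
proof -
  interpret F: functor_between C D F by (rule F)
  obtain G e where G: "\<And>Y. Y \<in> Obj D \<Longrightarrow> G Y \<in> Obj C"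
    and e: "\<And>Y. Y \<in> Obj D \<Longrightarrow> e Y \<in> Hom D (fobj F (G Y)) Y"
    and ex1: "\<And>X Y h. \<lbrakk>X \<in> Obj C; Y \<in> Obj D; h \<in> Hom D (fobj F X) Y\<rbrakk> \<Longrightarrow>
      \<exists>!u. u \<in> Hom C X (G Y) \<and> Comp D (fobj F X) (fobj F (G Y)) Y (e Y) (farr F X (G Y) u) = h"
    using universal by metis
  \<comment> \<open>\<open>E\<close> composes with the universal arrow; the adjunction bijection \<open>\<phi>\<close> is its inverse.\<close>
  define E where "E X Y u = Comp D (fobj F X) (fobj F (G Y)) Y (e Y) (farr F X (G Y) u)" for X Y u
  define \<phi> where "\<phi> X Y h = (THE u. u \<in> Hom C X (G Y) \<and> E X Y u = h)" for X Y h
  have \<phi>: "\<phi> X Y h \<in> Hom C X (G Y)" "E X Y (\<phi> X Y h) = h"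
    if "X \<in> Obj C" "Y \<in> Obj D" "h \<in> Hom D (fobj F X) Y" for X Y h
    using theI'[OF ex1[OF that]] unfolding \<phi>_def E_def by blast+
  have \<phi>_eq: "\<phi> X Y h = u" if "X \<in> Obj C" "Y \<in> Obj D" "u \<in> Hom C X (G Y)" "E X Y u = h"
    "h \<in> Hom D (fobj F X) Y" for X Y h u
    using ex1[OF that(1,2,5)] \<phi>[OF that(1,2,5)] that(3,4) unfolding E_def by blast
  have E_in: "E X Y u \<in> Hom D (fobj F X) Y" if "X \<in> Obj C" "Y \<in> Obj D" "u \<in> Hom C X (G Y)" for X Y u
    unfolding E_def
    by (rule F.D.Comp_in_Hom[OF F.fobj_in_Obj F.fobj_in_Obj _ F.farr_in_Hom e]) (use that G in auto)
  have E_comp: "E X' Y (Comp C X' X (G Y) u w) = Comp D (fobj F X') (fobj F X) Y (E X Y u) (farr F X' X w)"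
    if "X \<in> Obj C" "X' \<in> Obj C" "Y \<in> Obj D" "u \<in> Hom C X (G Y)" "w \<in> Hom C X' X" for X X' Y u w
  proof -
    have "farr F X' (G Y) (Comp C X' X (G Y) u w)
      = Comp D (fobj F X') (fobj F X) (fobj F (G Y)) (farr F X (G Y) u) (farr F X' X w)"
      using that G by (simp add: F.farr_Comp)
    then show ?thesis
      unfolding E_def
      by (simp only:, intro F.D.Comp_assoc) (use that G e in \<open>auto intro: F.fobj_in_Obj F.farr_in_Hom\<close>)
  qed
  define R where "R = \<lparr>fobj = G, farr = (\<lambda>Y Y' v. \<phi> (G Y) Y' (Comp D (fobj F (G Y)) Y Y' v (e Y)))\<rparr>"
  have R: "fobj R = G" "\<And>Y Y' v. farr R Y Y' v = \<phi> (G Y) Y' (Comp D (fobj F (G Y)) Y Y' v (e Y))"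
    by (simp_all add: R_def)
  have ve: "Comp D (fobj F (G Y)) Y Y' v (e Y) \<in> Hom D (fobj F (G Y)) Y'"
    if "Y \<in> Obj D" "Y' \<in> Obj D" "v \<in> Hom D Y Y'" for Y Y' v
    by (rule F.D.Comp_in_Hom[OF F.fobj_in_Obj _ _ e]) (use that G in auto)
  have R_arr: "farr R Y Y' v \<in> Hom C (G Y) (G Y')"
    "E (G Y) Y' (farr R Y Y' v) = Comp D (fobj F (G Y)) Y Y' v (e Y)"
    if "Y \<in> Obj D" "Y' \<in> Obj D" "v \<in> Hom D Y Y'" for Y Y' v
    using \<phi>[OF G[OF that(1)] that(2) ve[OF that]] by (simp_all add: R)
  have E_post: "E X Y' (Comp C X (G Y) (G Y') (farr R Y Y' v) u) = Comp D (fobj F X) Y Y' v (E X Y u)"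
    if "X \<in> Obj C" "Y \<in> Obj D" "Y' \<in> Obj D" "u \<in> Hom C X (G Y)" "v \<in> Hom D Y Y'" for X Y Y' u v
  proof -
    have "E X Y' (Comp C X (G Y) (G Y') (farr R Y Y' v) u)
      = Comp D (fobj F X) (fobj F (G Y)) Y' (Comp D (fobj F (G Y)) Y Y' v (e Y)) (farr F X (G Y) u)"
      using that by (simp add: E_comp G R_arr)
    also have "\<dots> = Comp D (fobj F X) Y Y' v (E X Y u)"
      unfolding E_def
      by (rule F.D.Comp_assoc[symmetric]) (use that G e in \<open>auto intro: F.fobj_in_Obj F.farr_in_Hom\<close>)
    finally show ?thesis .
  qed
  have "functor_between D C R"
  proof unfold_locales
    show "farr R Y Y (Id D Y) = Id C (fobj R Y)" if Y: "Y \<in> Obj D" for Y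
    proof -
      have "E (G Y) Y (Id C (G Y)) = e Y"
        unfolding E_def using Y G e F.fobj_in_Obj by (simp add: F.farr_Id F.D.Comp_Id_right)
      moreover have "Comp D (fobj F (G Y)) Y Y (Id D Y) (e Y) = e Y"
        using Y G e F.fobj_in_Obj by (simp add: F.D.Comp_Id_left)
      ultimately show ?thesis
        using Y G e by (simp add: R \<phi>_eq F.C.Id_in_Hom)
    qed
    show "farr R X Z (Comp D X Y Z g f)
        = Comp C (fobj R X) (fobj R Y) (fobj R Z) (farr R Y Z g) (farr R X Y f)"
      if X: "X \<in> Obj D" "Y \<in> Obj D" "Z \<in> Obj D" and f: "f \<in> Hom D X Y" and g: "g \<in> Hom D Y Z" for X Y Z f g
    proof -
      have "E (G X) Z (Comp C (G X) (G Y) (G Z) (farr R Y Z g) (farr R X Y f))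
        = Comp D (fobj F (G X)) Y Z g (Comp D (fobj F (G X)) X Y f (e X))"
        using X f g by (simp add: E_post G R_arr)
      also have "\<dots> = Comp D (fobj F (G X)) X Z (Comp D X Y Z g f) (e X)"
        by (rule F.D.Comp_assoc) (use X f g G e in \<open>auto intro: F.fobj_in_Obj\<close>)
      finally have eq: "E (G X) Z (Comp C (G X) (G Y) (G Z) (farr R Y Z g) (farr R X Y f))
        = Comp D (fobj F (G X)) X Z (Comp D X Y Z g f) (e X)" .
      have "Comp C (G X) (G Y) (G Z) (farr R Y Z g) (farr R X Y f) \<in> Hom C (G X) (G Z)"
        by (rule F.C.Comp_in_Hom) (use X f g G R_arr in auto)
      from \<phi>_eq[OF G[OF X(1)] X(3) this eq ve[OF X(1,3) F.D.Comp_in_Hom[OF X f g]]]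
      show ?thesis unfolding R .
    qed
  qed (use G R_arr in \<open>simp_all add: R(1)\<close>)
  then interpret R: functor_between D C R .
  have "adjunction C D F R \<phi>"
  proof unfold_locales
    show "bij_betw (\<phi> X Y) (Hom D (fobj F X) Y) (Hom C X (fobj R Y))"
      if "X \<in> Obj C" "Y \<in> Obj D" for X Y
      by (rule bij_betwI[where g = "E X Y"]) (use that \<phi> \<phi>_eq E_in in \<open>auto simp: R(1)\<close>)
    show "\<phi> X' Y (Comp D (fobj F X') (fobj F X) Y h (farr F X' X u)) = Comp C X' X (fobj R Y) (\<phi> X Y h) u"
      if "X \<in> Obj C" "X' \<in> Obj C" "Y \<in> Obj D" "u \<in> Hom C X' X" "h \<in> Hom D (fobj F X) Y" for X X' Y u h
      unfolding R(1)
      by (rule \<phi>_eq)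
        (use that \<phi> G in \<open>auto simp: E_comp intro: F.C.Comp_in_Hom F.D.Comp_in_Hom F.fobj_in_Obj F.farr_in_Hom\<close>)
    show "\<phi> X Y' (Comp D (fobj F X) Y Y' v h) = Comp C X (fobj R Y) (fobj R Y') (farr R Y Y' v) (\<phi> X Y h)"
      if "X \<in> Obj C" "Y \<in> Obj D" "Y' \<in> Obj D" "h \<in> Hom D (fobj F X) Y" "v \<in> Hom D Y Y'" for X Y Y' h v
      unfolding R(1)
      by (rule \<phi>_eq)
        (use that \<phi> G R_arr in \<open>auto simp: E_post intro: F.C.Comp_in_Hom F.D.Comp_in_Hom F.fobj_in_Obj\<close>)
  qed
  then show ?thesis
    unfolding has_right_adjoint_def by blast
qed

lemma product_category:
  assumes "category C" "category D"
  shows "category (product_category C D)"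
proof -
  interpret C: category C by fact
  interpret D: category D by fact
  show ?thesis
    by (rule category.intro)
      (auto simp: product_category_def C.Id_in_Hom D.Id_in_Hom C.Comp_in_Hom D.Comp_in_Hom
        C.Comp_Id_right D.Comp_Id_right C.Comp_Id_left D.Comp_Id_left C.Comp_assoc D.Comp_assoc)
qed

lemma (in bicategory) postcomp_functor_between:
  assumes abc: "a \<in> Cell0 \<B>" "b \<in> Cell0 \<B>" "c \<in> Cell0 \<B>" and f: "f \<in> Cell1 \<B> a b"
  shows "functor_between (HomCat \<B> c a) (HomCat \<B> c b) (postcomp_functor \<B> c a b f)"
proof -
  interpret H: functor_between "product_category (HomCat \<B> a b) (HomCat \<B> c a)" "HomCat \<B> c b"
    "hcomp \<B> c a b"
    using hcomp_functor abc by blast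
  interpret A: category "HomCat \<B> c a" using HomCat_category abc by blast
  interpret B: category "HomCat \<B> a b" using HomCat_category abc by blast
  note P = product_category_def[of "HomCat \<B> a b" "HomCat \<B> c a"]
  show ?thesis
  proof unfold_locales
    show "fobj (postcomp_functor \<B> c a b f) x \<in> Cell1 \<B> c b" if "x \<in> Cell1 \<B> c a" for x
      using H.fobj_in_Obj[of "(f, x)"] that f by (simp add: P postcomp_functor_def)
    show "farr (postcomp_functor \<B> c a b f) x y u
        \<in> Cell2 \<B> c b (fobj (postcomp_functor \<B> c a b f) x) (fobj (postcomp_functor \<B> c a b f) y)"
      if "x \<in> Cell1 \<B> c a" "y \<in> Cell1 \<B> c a" "u \<in> Cell2 \<B> c a x y" for x y u
      using H.farr_in_Hom[of "(f, x)" "(f, y)" "(id2 \<B> a b f, u)"] that f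
      by (simp add: P postcomp_functor_def B.Id_in_Hom)
    show "farr (postcomp_functor \<B> c a b f) x x (id2 \<B> c a x) = id2 \<B> c b (fobj (postcomp_functor \<B> c a b f) x)"
      if "x \<in> Cell1 \<B> c a" for x
      using H.farr_Id[of "(f, x)"] that f by (simp add: P postcomp_functor_def)
    show "farr (postcomp_functor \<B> c a b f) x z (vcomp \<B> c a x y z v u)
        = vcomp \<B> c b (fobj (postcomp_functor \<B> c a b f) x) (fobj (postcomp_functor \<B> c a b f) y)
           (fobj (postcomp_functor \<B> c a b f) z) (farr (postcomp_functor \<B> c a b f) y z v)
           (farr (postcomp_functor \<B> c a b f) x y u)"
      if "x \<in> Cell1 \<B> c a" "y \<in> Cell1 \<B> c a" "z \<in> Cell1 \<B> c a" "u \<in> Cell2 \<B> c a x y"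
        "v \<in> Cell2 \<B> c a y z" for x y z u v
      using H.farr_Comp[of "(f, x)" "(f, y)" "(f, z)" "(id2 \<B> a b f, u)" "(id2 \<B> a b f, v)"] that f
      by (simp add: P postcomp_functor_def B.Id_in_Hom B.Comp_Id_left)
  qed
qed

lemma (in bicategory) precomp_functor_between:
  assumes abc: "a \<in> Cell0 \<B>" "b \<in> Cell0 \<B>" "c \<in> Cell0 \<B>" and f: "f \<in> Cell1 \<B> a b"
  shows "functor_between (HomCat \<B> b c) (HomCat \<B> a c) (precomp_functor \<B> a b c f)"
proof -
  interpret H: functor_between "product_category (HomCat \<B> b c) (HomCat \<B> a b)" "HomCat \<B> a c"
    "hcomp \<B> a b c"
    using hcomp_functor abc by blast
  interpret A: category "HomCat \<B> b c" using HomCat_category abc by blast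
  interpret B: category "HomCat \<B> a b" using HomCat_category abc by blast
  note P = product_category_def[of "HomCat \<B> b c" "HomCat \<B> a b"]
  show ?thesis
  proof unfold_locales
    show "fobj (precomp_functor \<B> a b c f) x \<in> Cell1 \<B> a c" if "x \<in> Cell1 \<B> b c" for x
      using H.fobj_in_Obj[of "(x, f)"] that f by (simp add: P precomp_functor_def)
    show "farr (precomp_functor \<B> a b c f) x y u
        \<in> Cell2 \<B> a c (fobj (precomp_functor \<B> a b c f) x) (fobj (precomp_functor \<B> a b c f) y)"
      if "x \<in> Cell1 \<B> b c" "y \<in> Cell1 \<B> b c" "u \<in> Cell2 \<B> b c x y" for x y u
      using H.farr_in_Hom[of "(x, f)" "(y, f)" "(u, id2 \<B> a b f)"] that f
      by (simp add: P precomp_functor_def B.Id_in_Hom)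
    show "farr (precomp_functor \<B> a b c f) x x (id2 \<B> b c x) = id2 \<B> a c (fobj (precomp_functor \<B> a b c f) x)"
      if "x \<in> Cell1 \<B> b c" for x
      using H.farr_Id[of "(x, f)"] that f by (simp add: P precomp_functor_def)
    show "farr (precomp_functor \<B> a b c f) x z (vcomp \<B> b c x y z v u)
        = vcomp \<B> a c (fobj (precomp_functor \<B> a b c f) x) (fobj (precomp_functor \<B> a b c f) y)
           (fobj (precomp_functor \<B> a b c f) z) (farr (precomp_functor \<B> a b c f) y z v)
           (farr (precomp_functor \<B> a b c f) x y u)"
      if "x \<in> Cell1 \<B> b c" "y \<in> Cell1 \<B> b c" "z \<in> Cell1 \<B> b c" "u \<in> Cell2 \<B> b c x y"
        "v \<in> Cell2 \<B> b c y z" for x y z u v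
      using H.farr_Comp[of "(x, f)" "(y, f)" "(z, f)" "(u, id2 \<B> a b f)" "(v, id2 \<B> a b f)"] that f
      by (simp add: P precomp_functor_def B.Id_in_Hom B.Comp_Id_left)
  qed
qed


section \<open>The bicategory of firm bimodules\<close>

lemma Firm_simps:
  "A \<in> Cell0 Firm \<longleftrightarrow> firm_ring A \<and> small (carrier A)"
  "HomCat Firm = firm_category" "unit1 Firm = regular_bimodule" "hcomp Firm A B C = firm_hcomp B"
  "associator Firm A B C D = firm_associator B C"
  "lunitor Firm A B M = the_hom (add_monoid (tensor B M (regular_bimodule B))) (add_monoid M)
     (\<lambda>h. \<forall>m \<in> carrier M. \<forall>b \<in> carrier (regular_bimodule B).
       h (pure_tensor B M (regular_bimodule B) m b) = m \<odot>\<^sub>r\<^bsub>M\<^esub> b)"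
  "runitor Firm A B M = the_hom (add_monoid (tensor A (regular_bimodule A) M)) (add_monoid M)
     (\<lambda>h. \<forall>a \<in> carrier (regular_bimodule A). \<forall>m \<in> carrier M.
       h (pure_tensor A (regular_bimodule A) M a m) = a \<odot>\<^bsub>M\<^esub> m)"
  by (simp_all add: Firm_def)

lemma firm_category_simps:
  "M \<in> Obj (firm_category A B) \<longleftrightarrow> firm_bimodule A B M \<and> small (carrier M)"
  "Hom (firm_category A B) M N = bimodule_hom A B M N"
  "Id (firm_category A B) M = restrict id (carrier M)"
  "Comp (firm_category A B) M N P g f = compose (carrier M) g f"
  by (simp_all add: firm_category_def)

lemma Obj_firm_categoryD:
  assumes "M \<in> Obj (firm_category A B)"
  shows "bimod A B M" "firm_left A M" "firm_right B M" "small (carrier M)"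
  using assms by (simp_all add: firm_category_simps firm_bimodule_def)

lemma id_bimodule_hom:
  assumes "bimod A B M"
  shows "restrict id (carrier M) \<in> bimodule_hom A B M M"
proof -
  interpret bimod A B M by fact
  show ?thesis
    by (rule bimodule_homI) (auto simp: hom_def smult_closed rsmult_closed)
qed

lemma category_firm_category: "category (firm_category A B)"
proof
  fix M N P Q f g h
  assume M: "M \<in> Obj (firm_category A B)"
  note MA = Obj_firm_categoryD(1)[OF M]
  show "Id (firm_category A B) M \<in> Hom (firm_category A B) M M"
    using id_bimodule_hom[OF MA] by (simp add: firm_category_simps)
  assume N: "N \<in> Obj (firm_category A B)" and f: "f \<in> Hom (firm_category A B) M N"
  then have f': "f \<in> bimodule_hom A B M N"
    by (simp add: firm_category_simps)
  note ext = bimodule_hom_extensional[OF f'] and closed = bimodule_hom_closed[OF f']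
  show "Comp (firm_category A B) M M N f (Id (firm_category A B) M) = f"
    "Comp (firm_category A B) M N N (Id (firm_category A B) N) f = f"
    by (rule extensionalityI[OF _ ext]; simp add: firm_category_simps compose_eq closed)+
  assume g: "g \<in> Hom (firm_category A B) N P"
  then show "Comp (firm_category A B) M N P g f \<in> Hom (firm_category A B) M P"
    using bimodule_hom_compose[OF MA f'] by (simp add: firm_category_simps)
  show "Comp (firm_category A B) M P Q h (Comp (firm_category A B) M N P g f)
      = Comp (firm_category A B) M N Q (Comp (firm_category A B) N P Q h g) f"
    by (rule extensionalityI[of _ "carrier M"]) (simp_all add: firm_category_simps compose_eq closed)
qed

lemma iso_arrow_firm_categoryI:
  assumes "f \<in> bimodule_hom A B M N" "g \<in> bimodule_hom A B N M"
    and "\<And>x. x \<in> carrier M \<Longrightarrow> g (f x) = x" "\<And>y. y \<in> carrier N \<Longrightarrow> f (g y) = y"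
  shows "iso_arrow (firm_category A B) M N f"
  unfolding iso_arrow_def firm_category_simps
  using assms by (intro conjI bexI[of _ g]) (auto simp: compose_def restrict_def fun_eq_iff)

lemma additive_maps_id: "(\<lambda>x. x) \<in> additive_maps T T"
  by (simp add: hom_def)

text \<open>
  The two universal properties give homomorphisms in both directions, and both composites fix the
  pure tensors.
\<close>

lemma bitensor_iso_arrow:
  assumes MN: "bimod A B M" "bimod B C N"
    and T: "bitensor A B C M N T p" and T': "bitensor A B C M N T' p'"
    and h: "h \<in> bimodule_hom A C T T'"
    and h_p: "\<And>m n. \<lbrakk>m \<in> carrier M; n \<in> carrier N\<rbrakk> \<Longrightarrow> h (p m n) = p' m n"
  shows "iso_arrow (firm_category A C) T T' h"
proof -
  obtain k where k: "k \<in> bimodule_hom A C T' T"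
    and k_p: "\<And>m n. \<lbrakk>m \<in> carrier M; n \<in> carrier N\<rbrakk> \<Longrightarrow> k (p' m n) = p m n"
    using bitensor_the_hom[OF T' MN bitensor_bimod[OF T] bitensor_bilinear[OF T]] by auto
  show ?thesis
  proof (rule iso_arrow_firm_categoryI[OF h k])
    show "k (h x) = x" if "x \<in> carrier T" for x
      using tensor_product_hom_eq[OF bitensor_tensor_product[OF T] additive_map_compose[OF
            bimodule_hom_additive[OF h] bimodule_hom_additive[OF k]] additive_maps_id _ that]
      by (simp add: h_p k_p)
    show "h (k x) = x" if "x \<in> carrier T'" for x
      using tensor_product_hom_eq[OF bitensor_tensor_product[OF T'] additive_map_compose[OF
            bimodule_hom_additive[OF k] bimodule_hom_additive[OF h]] additive_maps_id _ that]
      by (simp add: h_p k_p)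
  qed
qed

text \<open>
  The horizontal composite of the 2-cells \<open>\<alpha>\<close> and \<open>\<beta>\<close>, with arguments in the order of the tensor
  product \<open>M \<otimes>\<^sub>B N\<close> rather than of the composition \<open>N \<otimes> M\<close>.
\<close>

definition tensor_map :: "'u ring \<Rightarrow> ('u, 'u, 'u) bimodule \<Rightarrow> ('u, 'u, 'u) bimodule
    \<Rightarrow> ('u, 'u, 'u) bimodule \<Rightarrow> ('u, 'u, 'u) bimodule \<Rightarrow> ('u \<Rightarrow> 'u) \<Rightarrow> ('u \<Rightarrow> 'u) \<Rightarrow> 'u \<Rightarrow> 'u" where
  "tensor_map B M M' N N' \<alpha> \<beta> = the_hom (add_monoid (tensor B M N)) (add_monoid (tensor B M' N'))
     (\<lambda>h. \<forall>m \<in> carrier M. \<forall>n \<in> carrier N.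
       h (pure_tensor B M N m n) = pure_tensor B M' N' (\<alpha> m) (\<beta> n))"

lemma firm_hcomp_simps:
  "fobj (firm_hcomp B) (N, M) = tensor B M N"
  "farr (firm_hcomp B) (N, M) (N', M') (\<beta>, \<alpha>) = tensor_map B M M' N N' \<alpha> \<beta>"
  by (simp_all add: firm_hcomp_def tensor_map_def)

context
  assumes U: "universe TYPE('u)"
begin

abbreviation (input) Cells :: "'u ring \<Rightarrow> 'u ring \<Rightarrow> ('u, 'u, 'u) bimodule set" where
  "Cells A B \<equiv> Obj (firm_category A B)"

lemma tensor_cell:
  assumes M: "M \<in> Cells A B" and N: "N \<in> Cells B C"
  shows "bitensor A B C M N (tensor B M N) (pure_tensor B M N)"
    and "tensor B M N \<in> Cells A C"
proof -
  note M' = Obj_firm_categoryD[OF M] and N' = Obj_firm_categoryD[OF N]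
  note T = tensor_bitensor[OF U M'(1) N'(1) M'(4) N'(4)]
  show "bitensor A B C M N (tensor B M N) (pure_tensor B M N)"
    by (rule T(1))
  show "tensor B M N \<in> Cells A C"
    using T(2) bitensor_bimod[OF T(1)] firm_left_bitensor[OF T(1) M'(1) N'(1) M'(2)]
      firm_right_bitensor[OF T(1) M'(1) N'(1) N'(3)]
    by (simp add: firm_category_simps firm_bimodule_def)
qed

lemma regular_cell:
  assumes "firm_ring A" "small (carrier A)"
  shows "regular_bimodule A \<in> Cells A A"
  using assms by (simp add: firm_category_simps firm_bimodule_def firm_ring_def bimod_regular)

lemma tensor_cell_spans:
  assumes M: "M \<in> Cells A B" and N: "N \<in> Cells B C"
  shows "tensor_product B M N (tensor B M N) (pure_tensor B M N)"
  by (rule bitensor_tensor_product[OF tensor_cell(1)[OF M N]])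

lemma pure_tensor_bilinear:
  assumes M: "M \<in> Cells A B" and N: "N \<in> Cells B C"
  shows "bilinear A B C M N (tensor B M N) (pure_tensor B M N)"
  by (rule bitensor_bilinear[OF tensor_cell(1)[OF M N]])

lemma pure_tensor_closed:
  assumes M: "M \<in> Cells A B" and N: "N \<in> Cells B C" and "m \<in> carrier M" "n \<in> carrier N"
  shows "pure_tensor B M N m n \<in> carrier (tensor B M N)"
  by (rule bilinear_closed[OF pure_tensor_bilinear[OF M N] assms(3,4)])

lemma tensor_hom_eqI:
  assumes M: "M \<in> Cells A B" and N: "N \<in> Cells B C"
    and h: "h \<in> bimodule_hom A C (tensor B M N) G" and k: "k \<in> bimodule_hom A C (tensor B M N) G"
    and "\<And>m n. \<lbrakk>m \<in> carrier M; n \<in> carrier N\<rbrakk>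
      \<Longrightarrow> h (pure_tensor B M N m n) = k (pure_tensor B M N m n)"
  shows "h = k"
  by (rule bimodule_hom_eqI[OF h k], rule tensor_product_hom_eq[OF tensor_cell_spans[OF M N]
        bimodule_hom_additive[OF h] bimodule_hom_additive[OF k]]) (use assms(5) in auto)

lemma triple_tensor_hom_eqI:
  assumes M: "M \<in> Cells A B" and N: "N \<in> Cells B C" and P: "P \<in> Cells C D"
    and h: "h \<in> bimodule_hom A D (tensor B M (tensor C N P)) G"
    and k: "k \<in> bimodule_hom A D (tensor B M (tensor C N P)) G"
    and "\<And>m n p. \<lbrakk>m \<in> carrier M; n \<in> carrier N; p \<in> carrier P\<rbrakk>
      \<Longrightarrow> h (pure_tensor B M (tensor C N P) m (pure_tensor C N P n p))
        = k (pure_tensor B M (tensor C N P) m (pure_tensor C N P n p))"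
  shows "h = k"
  by (rule bimodule_hom_eqI[OF h k], rule triple_tensor_hom_eq[OF tensor_cell_spans[OF N P]
        tensor_cell_spans[OF M tensor_cell(2)[OF N P]]
        bimodule_hom_additive[OF h] bimodule_hom_additive[OF k]]) (use assms(6) in auto)

lemma quadruple_tensor_hom_eqI:
  assumes M: "M \<in> Cells A B" and N: "N \<in> Cells B C" and P: "P \<in> Cells C D" and Q: "Q \<in> Cells D E"
  defines "S \<equiv> tensor D P Q" and "T \<equiv> tensor C N (tensor D P Q)"
  assumes h: "h \<in> bimodule_hom A E (tensor B M T) G"
    and k: "k \<in> bimodule_hom A E (tensor B M T) G"
    and eq: "\<And>m n p q. \<lbrakk>m \<in> carrier M; n \<in> carrier N; p \<in> carrier P; q \<in> carrier Q\<rbrakk>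
      \<Longrightarrow> h (pure_tensor B M T m (pure_tensor C N S n (pure_tensor D P Q p q)))
        = k (pure_tensor B M T m (pure_tensor C N S n (pure_tensor D P Q p q)))"
  shows "h = k"
proof -
  note S = tensor_cell(2)[OF P Q, folded S_def]
  note T = tensor_cell(2)[OF N S, unfolded S_def, folded T_def]
  show ?thesis
  proof (rule tensor_hom_eqI[OF M T h k])
    fix m t assume m: "m \<in> carrier M" and t: "t \<in> carrier T"
    note r = balanced_additive_right[OF bilinear_balanced[OF pure_tensor_bilinear[OF M T]] m]
    show "h (pure_tensor B M T m t) = k (pure_tensor B M T m t)"
      by (rule triple_tensor_hom_eq[OF tensor_cell_spans[OF P Q]
            tensor_cell_spans[OF N S, unfolded S_def, folded T_def]
            additive_map_compose[OF r bimodule_hom_additive[OF h]]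
            additive_map_compose[OF r bimodule_hom_additive[OF k]] _ t])
        (rule eq[OF m, unfolded S_def])
  qed
qed

lemma tensor_map:
  assumes M: "M \<in> Cells A B" and M': "M' \<in> Cells A B" and N: "N \<in> Cells B C" and N': "N' \<in> Cells B C"
    and \<alpha>: "\<alpha> \<in> bimodule_hom A B M M'" and \<beta>: "\<beta> \<in> bimodule_hom B C N N'"
  shows "tensor_map B M M' N N' \<alpha> \<beta> \<in> bimodule_hom A C (tensor B M N) (tensor B M' N')"
    and "\<And>m n. \<lbrakk>m \<in> carrier M; n \<in> carrier N\<rbrakk> \<Longrightarrow>
      tensor_map B M M' N N' \<alpha> \<beta> (pure_tensor B M N m n) = pure_tensor B M' N' (\<alpha> m) (\<beta> n)"
proof -
  note p = pure_tensor_bilinear[OF M' N'] and pb = bilinear_balanced[OF pure_tensor_bilinear[OF M' N']]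
  have "bilinear A B C M N (tensor B M' N') (\<lambda>m n. pure_tensor B M' N' (\<alpha> m) (\<beta> n))"
    unfolding bilinear_def balanced_def
    by (simp add: balanced_closed[OF pb] balanced_add_left[OF pb] balanced_add_right[OF pb]
        balanced_middle[OF pb] bilinear_smult[OF p] bilinear_rsmult[OF p]
        bimodule_hom_closed[OF \<alpha>] bimodule_hom_smult[OF \<alpha>] bimodule_hom_rsmult[OF \<alpha>]
        bimodule_hom_closed[OF \<beta>] bimodule_hom_smult[OF \<beta>] bimodule_hom_rsmult[OF \<beta>]
        additive_map_add[OF bimodule_hom_additive[OF \<alpha>]]
        additive_map_add[OF bimodule_hom_additive[OF \<beta>]])
  note h = bitensor_the_hom[OF tensor_cell(1)[OF M N] Obj_firm_categoryD(1)[OF M]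
      Obj_firm_categoryD(1)[OF N] bitensor_bimod[OF tensor_cell(1)[OF M' N']] this,
      folded tensor_map_def]
  show "tensor_map B M M' N N' \<alpha> \<beta> \<in> bimodule_hom A C (tensor B M N) (tensor B M' N')"
    by (rule h(1))
  show "tensor_map B M M' N N' \<alpha> \<beta> (pure_tensor B M N m n) = pure_tensor B M' N' (\<alpha> m) (\<beta> n)"
    if "m \<in> carrier M" "n \<in> carrier N" for m n
    by (rule h(2)[OF that])
qed

lemma compose_hom:
  assumes "M \<in> Cells A B" "f \<in> bimodule_hom A B M N" "g \<in> bimodule_hom A B N P"
  shows "compose (carrier M) g f \<in> bimodule_hom A B M P"
  by (rule bimodule_hom_compose[OF Obj_firm_categoryD(1)[OF assms(1)] assms(2,3)])

lemma id_hom: "M \<in> Cells A B \<Longrightarrow> restrict id (carrier M) \<in> bimodule_hom A B M M"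
  by (rule id_bimodule_hom[OF Obj_firm_categoryD(1)])

lemma tensor_map_id:
  assumes M: "M \<in> Cells A B" and N: "N \<in> Cells B C"
  shows "tensor_map B M M N N (restrict id (carrier M)) (restrict id (carrier N))
    = restrict id (carrier (tensor B M N))"
  using tensor_map[OF M M N N id_hom[OF M] id_hom[OF N]] id_hom[OF tensor_cell(2)[OF M N]]
  by (intro tensor_hom_eqI[OF M N]) (simp_all add: pure_tensor_closed[OF M N])

lemma tensor_map_compose:
  assumes M: "M \<in> Cells A B" "M' \<in> Cells A B" "M'' \<in> Cells A B"
    and N: "N \<in> Cells B C" "N' \<in> Cells B C" "N'' \<in> Cells B C"
    and \<alpha>: "\<alpha> \<in> bimodule_hom A B M M'" "\<alpha>' \<in> bimodule_hom A B M' M''"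
    and \<beta>: "\<beta> \<in> bimodule_hom B C N N'" "\<beta>' \<in> bimodule_hom B C N' N''"
  shows "tensor_map B M M'' N N'' (compose (carrier M) \<alpha>' \<alpha>) (compose (carrier N) \<beta>' \<beta>)
    = compose (carrier (tensor B M N)) (tensor_map B M' M'' N' N'' \<alpha>' \<beta>') (tensor_map B M M' N N' \<alpha> \<beta>)"
proof -
  note t1 = tensor_map[OF M(1,2) N(1,2) \<alpha>(1) \<beta>(1)]
    and t2 = tensor_map[OF M(2,3) N(2,3) \<alpha>(2) \<beta>(2)]
    and t3 = tensor_map[OF M(1,3) N(1,3) compose_hom[OF M(1) \<alpha>] compose_hom[OF N(1) \<beta>]]
  show ?thesis
    by (rule tensor_hom_eqI[OF M(1) N(1) t3(1) compose_hom[OF tensor_cell(2)[OF M(1) N(1)] t1(1) t2(1)]])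
      (simp add: t1(2) t2(2) t3(2) compose_eq pure_tensor_closed[OF M(1) N(1)]
        bimodule_hom_closed[OF \<alpha>(1)] bimodule_hom_closed[OF \<beta>(1)])
qed

lemma firm_hcomp_functor:
  fixes A B C :: "'u ring"
  shows "functor_between (product_category (firm_category B C) (firm_category A B)) (firm_category A C)
    (firm_hcomp B)"
proof -
  interpret P: category "product_category (firm_category B C) (firm_category A B)"
    by (intro product_category category_firm_category)
  interpret C: category "firm_category A C"
    by (rule category_firm_category)
  show ?thesis
    by unfold_locales
      (auto simp: product_category_def firm_hcomp_simps firm_category_simps(2-4) tensor_cell(2)
        tensor_map_id tensor_map(1) tensor_map_compose)
qed

lemma firm_associator:
  assumes M: "M \<in> Cells A B" and N: "N \<in> Cells B C" and P: "P \<in> Cells C D"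
  shows "firm_associator B C P N M
      \<in> bimodule_hom A D (tensor B M (tensor C N P)) (tensor C (tensor B M N) P)" (is ?hom)
    and "\<And>m n p. \<lbrakk>m \<in> carrier M; n \<in> carrier N; p \<in> carrier P\<rbrakk> \<Longrightarrow>
      firm_associator B C P N M (pure_tensor B M (tensor C N P) m (pure_tensor C N P n p))
        = pure_tensor C (tensor B M N) P (pure_tensor B M N m n) p"
    and "iso_arrow (firm_category A D) (tensor B M (tensor C N P)) (tensor C (tensor B M N) P)
      (firm_associator B C P N M)" (is ?iso)
proof -
  note NP = tensor_cell[OF N P] and MN = tensor_cell[OF M N]
  note S = tensor_cell[OF M NP(2)] and T = tensor_cell[OF MN(2) P]
  note M' = Obj_firm_categoryD(1)[OF M] and N' = Obj_firm_categoryD(1)[OF N]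
    and P' = Obj_firm_categoryD(1)[OF P]
    and MN' = Obj_firm_categoryD(1)[OF MN(2)] and NP' = Obj_firm_categoryD(1)[OF NP(2)]
  let ?r = "\<lambda>m n p. pure_tensor B M (tensor C N P) m (pure_tensor C N P n p)"
    and ?l = "\<lambda>m n p. pure_tensor C (tensor B M N) P (pure_tensor B M N m n) p"
  obtain h where h: "h \<in> bimodule_hom A D (tensor B M (tensor C N P)) (tensor C (tensor B M N) P)"
    and h_pure: "\<And>m n p. \<lbrakk>m \<in> carrier M; n \<in> carrier N; p \<in> carrier P\<rbrakk> \<Longrightarrow> h (?r m n p) = ?l m n p"
    using triple_tensor_hom_exists[OF M' N' P' NP(1) S(1) MN(1) T(1)] by blast
  have "firm_associator B C P N M = h"
    unfolding firm_associator_def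
  proof (rule the_hom_equality)
    fix k x
    assume k: "k \<in> additive_maps (tensor B M (tensor C N P)) (tensor C (tensor B M N) P)"
      and k_pure: "\<forall>m\<in>carrier M. \<forall>n\<in>carrier N. \<forall>p\<in>carrier P. k (?r m n p) = ?l m n p"
      and x: "x \<in> carrier (add_monoid (tensor B M (tensor C N P)))"
    show "k x = h x"
      by (rule triple_tensor_hom_eq[OF tensor_cell_spans[OF N P] tensor_cell_spans[OF M NP(2)]
            k bimodule_hom_additive[OF h]]) (use k_pure h_pure x in simp_all)
  qed (use h h_pure in \<open>simp_all add: bimodule_hom_def\<close>)
  then show hom: ?hom
    and pure: "\<And>m n p. \<lbrakk>m \<in> carrier M; n \<in> carrier N; p \<in> carrier P\<rbrakk> \<Longrightarrow>
      firm_associator B C P N M (?r m n p) = ?l m n p"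
    using h h_pure by simp_all
  \<comment> \<open>The inverse comes from the same construction applied to the opposite bimodules.\<close>
  have "\<exists>k \<in> bimodule_hom (op_ring D) (op_ring A) (op_bimodule (tensor C (tensor B M N) P))
      (op_bimodule (tensor B M (tensor C N P))).
    \<forall>p \<in> carrier (op_bimodule P). \<forall>n \<in> carrier (op_bimodule N). \<forall>m \<in> carrier (op_bimodule M).
      k (?l m n p) = ?r m n p"
    by (rule triple_tensor_hom_exists[OF bimod_op[OF P'] bimod_op[OF N'] bimod_op[OF M']
          bitensor_op[OF M' N' MN(1)] bitensor_op[OF MN' P' T(1)] bitensor_op[OF N' P' NP(1)]
          bitensor_op[OF M' NP' S(1)]])
  then obtain k where k: "k \<in> bimodule_hom A D (tensor C (tensor B M N) P) (tensor B M (tensor C N P))"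
    and k_pure: "\<And>m n p. \<lbrakk>m \<in> carrier M; n \<in> carrier N; p \<in> carrier P\<rbrakk> \<Longrightarrow> k (?l m n p) = ?r m n p"
    by (auto simp: bimodule_hom_op)
  let ?a = "firm_associator B C P N M"
  show ?iso
  proof (rule iso_arrow_firm_categoryI[OF hom k])
    show "k (?a x) = x" if "x \<in> carrier (tensor B M (tensor C N P))" for x
      using triple_tensor_hom_eq[OF tensor_cell_spans[OF N P] tensor_cell_spans[OF M NP(2)]
          additive_map_compose[OF bimodule_hom_additive[OF hom] bimodule_hom_additive[OF k]]
          additive_maps_id _ that]
      by (simp add: pure k_pure)
    show "?a (k x) = x" if x: "x \<in> carrier (tensor C (tensor B M N) P)" for x
    proof (rule tensor_product_hom_eq[OF tensor_cell_spans[OF MN(2) P]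
          additive_map_compose[OF bimodule_hom_additive[OF k] bimodule_hom_additive[OF hom]]
          additive_maps_id _ x])
      fix y p assume y: "y \<in> carrier (tensor B M N)" and p: "p \<in> carrier P"
      note v = balanced_additive_left[OF bilinear_balanced[OF pure_tensor_bilinear[OF MN(2) P]] p]
      show "?a (k (pure_tensor C (tensor B M N) P y p)) = pure_tensor C (tensor B M N) P y p"
        by (rule tensor_product_hom_eq[OF tensor_cell_spans[OF M N]
              additive_map_compose[OF additive_map_compose[OF v bimodule_hom_additive[OF k]]
                bimodule_hom_additive[OF hom]] v _ y])
          (simp add: p pure k_pure)
    qed
  qed
qed

lemma firm_associator_natural:
  assumes M: "M \<in> Cells A B" "M' \<in> Cells A B" and N: "N \<in> Cells B C" "N' \<in> Cells B C"
    and P: "P \<in> Cells C D" "P' \<in> Cells C D"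
    and \<alpha>: "\<alpha> \<in> bimodule_hom A B M M'" and \<beta>: "\<beta> \<in> bimodule_hom B C N N'"
    and \<gamma>: "\<gamma> \<in> bimodule_hom C D P P'"
  shows "compose (carrier (tensor B M (tensor C N P))) (firm_associator B C P' N' M')
      (tensor_map B M M' (tensor C N P) (tensor C N' P') \<alpha> (tensor_map C N N' P P' \<beta> \<gamma>))
    = compose (carrier (tensor B M (tensor C N P)))
      (tensor_map C (tensor B M N) (tensor B M' N') P P' (tensor_map B M M' N N' \<alpha> \<beta>) \<gamma>)
      (firm_associator B C P N M)"
proof -
  note NP = tensor_cell(2)[OF N(1) P(1)] and NP' = tensor_cell(2)[OF N(2) P(2)]
    and MN = tensor_cell(2)[OF M(1) N(1)] and MN' = tensor_cell(2)[OF M(2) N(2)]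
  note \<beta>\<gamma> = tensor_map[OF N P \<beta> \<gamma>] and \<alpha>\<beta> = tensor_map[OF M N \<alpha> \<beta>]
  note r = tensor_map[OF M NP NP' \<alpha> \<beta>\<gamma>(1)] and l = tensor_map[OF MN MN' P \<alpha>\<beta>(1) \<gamma>]
  note a = firm_associator(1,2)[OF M(1) N(1) P(1)] and a' = firm_associator(1,2)[OF M(2) N(2) P(2)]
  note S = tensor_cell(2)[OF M(1) NP]
  show ?thesis
    by (rule triple_tensor_hom_eqI[OF M(1) N(1) P(1) compose_hom[OF S r(1) a'(1)]
          compose_hom[OF S a(1) l(1)]])
      (simp add: compose_eq pure_tensor_closed[OF M(1) NP] pure_tensor_closed[OF N(1) P(1)]
        pure_tensor_closed[OF M(1) N(1)] r(2) \<beta>\<gamma>(2) l(2) \<alpha>\<beta>(2) a(2) a'(2)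
        bimodule_hom_closed[OF \<alpha>] bimodule_hom_closed[OF \<beta>] bimodule_hom_closed[OF \<gamma>])
qed

text \<open>
  Both sides send \<open>m \<otimes> (n \<otimes> (p \<otimes> q))\<close> to \<open>((m \<otimes> n) \<otimes> p) \<otimes> q\<close>.
\<close>

lemma firm_pentagon:
  assumes M: "M \<in> Cells A B" and N: "N \<in> Cells B C" and P: "P \<in> Cells C D" and Q: "Q \<in> Cells D E"
  shows "compose (carrier (tensor B M (tensor C N (tensor D P Q))))
      (firm_associator C D Q P (tensor B M N)) (firm_associator B C (tensor D P Q) N M)
    = compose (carrier (tensor B M (tensor C N (tensor D P Q))))
      (tensor_map D (tensor B M (tensor C N P)) (tensor C (tensor B M N) P) Q Q
        (firm_associator B C P N M) (restrict id (carrier Q)))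
      (compose (carrier (tensor B M (tensor C N (tensor D P Q))))
        (firm_associator B D Q (tensor C N P) M)
        (tensor_map B M M (tensor C N (tensor D P Q)) (tensor D (tensor C N P) Q)
          (restrict id (carrier M)) (firm_associator C D Q P N)))"
proof -
  note PQ = tensor_cell(2)[OF P Q] and NP = tensor_cell(2)[OF N P] and MN = tensor_cell(2)[OF M N]
  note N_PQ = tensor_cell(2)[OF N PQ] and NP_Q = tensor_cell(2)[OF NP Q]
    and M_NP = tensor_cell(2)[OF M NP] and MN_P = tensor_cell(2)[OF MN P]
  note S = tensor_cell(2)[OF M N_PQ]
  note a1 = firm_associator(1,2)[OF MN P Q] and a2 = firm_associator(1,2)[OF M N PQ]
    and a3 = firm_associator(1,2)[OF M N P] and a4 = firm_associator(1,2)[OF M NP Q]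
    and a5 = firm_associator(1,2)[OF N P Q]
  note t1 = tensor_map[OF M_NP MN_P Q Q a3(1) id_hom[OF Q]]
    and t2 = tensor_map[OF M M N_PQ NP_Q id_hom[OF M] a5(1)]
  show ?thesis
    by (rule quadruple_tensor_hom_eqI[OF M N P Q compose_hom[OF S a2(1) a1(1)]
          compose_hom[OF S compose_hom[OF S t2(1) a4(1)] t1(1)]])
      (simp add: compose_eq pure_tensor_closed[OF M N_PQ] pure_tensor_closed[OF N PQ]
        pure_tensor_closed[OF P Q] pure_tensor_closed[OF M N] pure_tensor_closed[OF N P]
        pure_tensor_closed[OF M NP] a1(2) a2(2) a3(2) a4(2) a5(2) t1(2) t2(2))
qed

lemma firm_left_action_bitensor:
  assumes A: "firm_ring A" and M: "M \<in> Cells A B"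
  shows "bitensor A A B (regular_bimodule A) M M (\<lambda>a m. a \<odot>\<^bsub>M\<^esub> m)"
proof -
  interpret M: bimod A B M by (rule Obj_firm_categoryD(1)[OF M])
  show ?thesis
    using Obj_firm_categoryD(2)[OF M] left_action_balanced[OF M.left_module_axioms] M.bimod_axioms
    by (simp add: bitensor_def bilinear_def M.smult_assoc M.smult_rsmult
        firm_left_iff[OF M.left_module_axioms])
qed

lemma firm_right_action_bitensor:
  assumes B: "firm_ring B" and M: "M \<in> Cells A B"
  shows "bitensor A B B M (regular_bimodule B) M (\<lambda>m b. m \<odot>\<^sub>r\<^bsub>M\<^esub> b)"
proof -
  interpret M: bimod A B M by (rule Obj_firm_categoryD(1)[OF M])
  show ?thesis
    using Obj_firm_categoryD(3)[OF M] right_action_balanced[OF M.right_module_axioms] M.bimod_axioms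
    by (simp add: bitensor_def bilinear_def M.rsmult_assoc M.smult_rsmult
        firm_right_iff[OF M.right_module_axioms])
qed

lemma firm_lunitor:
  assumes B: "firm_ring B" "small (carrier B)" and M: "M \<in> Cells A B"
  shows "lunitor Firm A B M \<in> bimodule_hom A B (tensor B M (regular_bimodule B)) M"
    and "\<And>m b. \<lbrakk>m \<in> carrier M; b \<in> carrier B\<rbrakk> \<Longrightarrow>
      lunitor Firm A B M (pure_tensor B M (regular_bimodule B) m b) = m \<odot>\<^sub>r\<^bsub>M\<^esub> b"
    and "iso_arrow (firm_category A B) (tensor B M (regular_bimodule B)) M (lunitor Firm A B M)"
proof -
  note R = regular_cell[OF B]
  note M' = Obj_firm_categoryD(1)[OF M] and R' = Obj_firm_categoryD(1)[OF R]
  note act = firm_right_action_bitensor[OF B(1) M]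
  note h = bitensor_the_hom[OF tensor_cell(1)[OF M R] M' R' M' bitensor_bilinear[OF act],
      folded Firm_simps(6)[of A B M]]
  show "lunitor Firm A B M \<in> bimodule_hom A B (tensor B M (regular_bimodule B)) M"
    by (rule h(1))
  show "lunitor Firm A B M (pure_tensor B M (regular_bimodule B) m b) = m \<odot>\<^sub>r\<^bsub>M\<^esub> b"
    if "m \<in> carrier M" "b \<in> carrier B" for m b
    using h(2) that by simp
  show "iso_arrow (firm_category A B) (tensor B M (regular_bimodule B)) M (lunitor Firm A B M)"
    by (rule bitensor_iso_arrow[OF M' R' tensor_cell(1)[OF M R] act h(1)]) (rule h(2))
qed

lemma firm_runitor:
  assumes A: "firm_ring A" "small (carrier A)" and M: "M \<in> Cells A B"
  shows "runitor Firm A B M \<in> bimodule_hom A B (tensor A (regular_bimodule A) M) M"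
    and "\<And>a m. \<lbrakk>a \<in> carrier A; m \<in> carrier M\<rbrakk> \<Longrightarrow>
      runitor Firm A B M (pure_tensor A (regular_bimodule A) M a m) = a \<odot>\<^bsub>M\<^esub> m"
    and "iso_arrow (firm_category A B) (tensor A (regular_bimodule A) M) M (runitor Firm A B M)"
proof -
  note R = regular_cell[OF A]
  note M' = Obj_firm_categoryD(1)[OF M] and R' = Obj_firm_categoryD(1)[OF R]
  note act = firm_left_action_bitensor[OF A(1) M]
  note h = bitensor_the_hom[OF tensor_cell(1)[OF R M] R' M' M' bitensor_bilinear[OF act],
      folded Firm_simps(7)[of A B M]]
  show "runitor Firm A B M \<in> bimodule_hom A B (tensor A (regular_bimodule A) M) M"
    by (rule h(1))
  show "runitor Firm A B M (pure_tensor A (regular_bimodule A) M a m) = a \<odot>\<^bsub>M\<^esub> m"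
    if "a \<in> carrier A" "m \<in> carrier M" for a m
    using h(2) that by simp
  show "iso_arrow (firm_category A B) (tensor A (regular_bimodule A) M) M (runitor Firm A B M)"
    by (rule bitensor_iso_arrow[OF R' M' tensor_cell(1)[OF R M] act h(1)]) (rule h(2))
qed

lemma firm_lunitor_natural:
  assumes B: "firm_ring B" "small (carrier B)" and M: "M \<in> Cells A B" "M' \<in> Cells A B"
    and \<alpha>: "\<alpha> \<in> bimodule_hom A B M M'"
  shows "compose (carrier (tensor B M (regular_bimodule B))) (lunitor Firm A B M')
      (tensor_map B M M' (regular_bimodule B) (regular_bimodule B) \<alpha>
        (restrict id (carrier (regular_bimodule B))))
    = compose (carrier (tensor B M (regular_bimodule B))) \<alpha> (lunitor Firm A B M)"
proof -
  note R = regular_cell[OF B]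
  note S = tensor_cell(2)[OF M(1) R]
  note l = firm_lunitor[OF B M(1)] and l' = firm_lunitor[OF B M(2)]
    and t = tensor_map[OF M R R \<alpha> id_hom[OF R]]
  show ?thesis
    by (rule tensor_hom_eqI[OF M(1) R compose_hom[OF S t(1) l'(1)] compose_hom[OF S l(1) \<alpha>]])
      (use t(2) in \<open>simp add: compose_eq pure_tensor_closed[OF M(1) R] l(2) l'(2) bimodule_hom_closed[OF \<alpha>]
        bimodule_hom_rsmult[OF \<alpha>]\<close>)
qed

lemma firm_runitor_natural:
  assumes A: "firm_ring A" "small (carrier A)" and M: "M \<in> Cells A B" "M' \<in> Cells A B"
    and \<alpha>: "\<alpha> \<in> bimodule_hom A B M M'"
  shows "compose (carrier (tensor A (regular_bimodule A) M)) (runitor Firm A B M')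
      (tensor_map A (regular_bimodule A) (regular_bimodule A) M M'
        (restrict id (carrier (regular_bimodule A))) \<alpha>)
    = compose (carrier (tensor A (regular_bimodule A) M)) \<alpha> (runitor Firm A B M)"
proof -
  note R = regular_cell[OF A]
  note S = tensor_cell(2)[OF R M(1)]
  note l = firm_runitor[OF A M(1)] and l' = firm_runitor[OF A M(2)]
    and t = tensor_map[OF R R M id_hom[OF R] \<alpha>]
  show ?thesis
    by (rule tensor_hom_eqI[OF R M(1) compose_hom[OF S t(1) l'(1)] compose_hom[OF S l(1) \<alpha>]])
      (use t(2) in \<open>simp add: compose_eq pure_tensor_closed[OF R M(1)] l(2) l'(2) bimodule_hom_closed[OF \<alpha>]
        bimodule_hom_smult[OF \<alpha>]\<close>)
qed

text \<open>
  The two sides send \<open>m \<otimes> (b \<otimes> n)\<close> to \<open>m b \<otimes> n\<close> and \<open>m \<otimes> b n\<close>.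
\<close>

lemma firm_triangle:
  assumes B: "firm_ring B" "small (carrier B)" and M: "M \<in> Cells A B" and N: "N \<in> Cells B C"
  shows "compose (carrier (tensor B M (tensor B (regular_bimodule B) N)))
      (tensor_map B (tensor B M (regular_bimodule B)) M N N (lunitor Firm A B M) (restrict id (carrier N)))
      (firm_associator B B N (regular_bimodule B) M)
    = tensor_map B M M (tensor B (regular_bimodule B) N) N (restrict id (carrier M)) (runitor Firm B C N)"
proof -
  note R = regular_cell[OF B]
  note RN = tensor_cell(2)[OF R N] and MR = tensor_cell(2)[OF M R]
  note S = tensor_cell(2)[OF M RN]
  note l = firm_lunitor[OF B M] and r = firm_runitor[OF B N] and a = firm_associator(1,2)[OF M R N]
  note t1 = tensor_map[OF MR M N N l(1) id_hom[OF N]] and t2 = tensor_map[OF M M RN N id_hom[OF M] r(1)]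
  note mid = balanced_middle[OF bilinear_balanced[OF pure_tensor_bilinear[OF M N]]]
  show ?thesis
    by (rule triple_tensor_hom_eqI[OF M R N compose_hom[OF S a(1) t1(1)] t2(1)])
      (use a(2) pure_tensor_closed[OF M R] pure_tensor_closed[OF R N] in
        \<open>simp add: compose_eq pure_tensor_closed[OF M RN] l(2) r(2) t1(2) t2(2) mid\<close>)
qed

lemma bicategory_Firm: "bicategory (Firm :: ('u ring, ('u, 'u, 'u) bimodule, 'u \<Rightarrow> 'u) bicategory_data)"
proof (rule bicategory.intro, unfold Firm_simps(1-5) firm_category_simps(2-4) firm_hcomp_simps, goal_cases)
  case 1
  show ?case by (rule category_firm_category)
next
  case (2 a)
  then show ?case using regular_cell by simp
next
  case 3
  show ?case by (rule firm_hcomp_functor)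
next
  case 4
  then show ?case by (intro firm_associator(3))
next
  case 5
  then show ?case by (intro firm_associator_natural)
next
  case 6
  then show ?case by (intro firm_lunitor(3)) auto
next
  case 7
  then show ?case by (intro firm_lunitor_natural) auto
next
  case 8
  then show ?case by (intro firm_runitor(3)) auto
next
  case 9
  then show ?case by (intro firm_runitor_natural) auto
next
  case 10
  then show ?case by (simp only:) (intro firm_pentagon)
next
  case 11
  then show ?case by (intro firm_triangle) auto
qed

section \<open>Right adjoints of horizontal composition\<close>

text \<open>
  Homomorphisms \<open>X \<otimes>\<^sub>A F \<rightarrow> Y\<close> correspond to bilinear maps on \<open>X \<times> F\<close>, which the residual represents;
  its universal bilinear map \<open>\<epsilon>\<close> becomes the universal arrow \<open>e : G \<otimes>\<^sub>A F \<rightarrow> Y\<close>.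
\<close>

lemma firm_postcomp_adjoint:
  fixes A B C :: "'u ring"
  assumes A: "A \<in> Cell0 Firm" and B: "B \<in> Cell0 Firm" and C: "C \<in> Cell0 Firm"
    and F: "F \<in> Cell1 Firm A B"
  shows "has_right_adjoint (HomCat Firm C A) (HomCat Firm C B) (postcomp_functor Firm C A B F)"
proof (rule has_right_adjointI)
  show "functor_between (HomCat Firm C A) (HomCat Firm C B) (postcomp_functor Firm C A B F)"
    by (rule bicategory.postcomp_functor_between[OF bicategory_Firm A B C F])
  fix Y :: "('u, 'u, 'u) bimodule"
  assume "Y \<in> Obj (HomCat Firm C B)"
  then have Y: "Y \<in> Cells C B" by (simp add: Firm_simps)
  have F': "F \<in> Cells A B" using F by (simp add: Firm_simps)
  note Fb = Obj_firm_categoryD[OF F'] and Yb = Obj_firm_categoryD[OF Y]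
  have rings: "firm_ring A" "small (carrier A)" "firm_ring C" "small (carrier C)"
    using A C by (simp_all add: Firm_simps)
  show "\<exists>G \<in> Obj (HomCat Firm C A).
    \<exists>e \<in> Hom (HomCat Firm C B) (fobj (postcomp_functor Firm C A B F) G) Y.
      \<forall>X \<in> Obj (HomCat Firm C A). \<forall>h \<in> Hom (HomCat Firm C B) (fobj (postcomp_functor Firm C A B F) X) Y.
        \<exists>!u. u \<in> Hom (HomCat Firm C A) X G \<and>
          Comp (HomCat Firm C B) (fobj (postcomp_functor Firm C A B F) X)
            (fobj (postcomp_functor Firm C A B F) G) Y e (farr (postcomp_functor Firm C A B F) X G u) = h"
    unfolding postcomp_functor_def functor_data.simps Firm_simps firm_category_simps(2-4) firm_hcomp_simps
  proof (rule right_residual[OF U rings Fb(1,4) Yb(1,4)])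
    fix G :: "('u, 'u, 'u) bimodule" and \<epsilon>
    assume G: "firm_bimodule C A G" "small (carrier G)" and \<epsilon>: "bilinear C A B G F Y \<epsilon>"
      and univ: "\<And>(X :: ('u, 'u, 'u) bimodule) k. \<lbrakk>firm_bimodule C A X; bilinear C A B X F Y k\<rbrakk> \<Longrightarrow>
        \<exists>!u. u \<in> bimodule_hom C A X G \<and> (\<forall>x \<in> carrier X. \<forall>f \<in> carrier F. k x f = \<epsilon> (u x) f)"
    have G': "G \<in> Cells C A" using G by (simp add: firm_category_simps)
    obtain e where e: "e \<in> bimodule_hom C B (tensor A G F) Y"
      and e_pure: "\<And>g f. \<lbrakk>g \<in> carrier G; f \<in> carrier F\<rbrakk> \<Longrightarrow> e (pure_tensor A G F g f) = \<epsilon> g f"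
      using bitensor_the_hom[OF tensor_cell(1)[OF G' F'] Obj_firm_categoryD(1)[OF G'] Fb(1) Yb(1) \<epsilon>]
      by blast
    have "\<exists>!u. u \<in> bimodule_hom C A X G \<and>
        compose (carrier (tensor A X F)) e (tensor_map A X G F F u (restrict id (carrier F))) = h"
      if X: "X \<in> Cells C A" and h: "h \<in> bimodule_hom C B (tensor A X F) Y" for X h
    proof -
      have "compose (carrier (tensor A X F)) e (tensor_map A X G F F u (restrict id (carrier F))) = h
        \<longleftrightarrow> (\<forall>x \<in> carrier X. \<forall>f \<in> carrier F. h (pure_tensor A X F x f) = \<epsilon> (u x) f)"
        if u: "u \<in> bimodule_hom C A X G" for u
      proof -
        note t = tensor_map[OF X G' F' F' u id_hom[OF F']]
        note et = compose_hom[OF tensor_cell(2)[OF X F'] t(1) e]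
        have et_pure: "compose (carrier (tensor A X F)) e (tensor_map A X G F F u (restrict id (carrier F)))
            (pure_tensor A X F x f) = \<epsilon> (u x) f" if "x \<in> carrier X" "f \<in> carrier F" for x f
          using that by (simp add: compose_eq pure_tensor_closed[OF X F'] t(2) e_pure
              bimodule_hom_closed[OF u])
        show ?thesis
          using et_pure tensor_hom_eqI[OF X F' et h] by metis
      qed
      moreover have "bilinear C A B X F Y (\<lambda>x f. h (pure_tensor A X F x f))"
        using pure_tensor_bilinear[OF X F'] balanced_compose[OF bilinear_balanced[OF
              pure_tensor_bilinear[OF X F']] bimodule_hom_additive[OF h]]
        by (simp add: bilinear_def bimodule_hom_smult[OF h] bimodule_hom_rsmult[OF h]
            pure_tensor_closed[OF X F'])
      ultimately show ?thesis
        using univ[of X "\<lambda>x f. h (pure_tensor A X F x f)"] X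
        by (simp add: firm_category_simps cong: conj_cong)
    qed
    then show "\<exists>G \<in> Cells C A. \<exists>e \<in> bimodule_hom C B (tensor A G F) Y.
      \<forall>X \<in> Cells C A. \<forall>h \<in> bimodule_hom C B (tensor A X F) Y.
        \<exists>!u. u \<in> bimodule_hom C A X G \<and>
          compose (carrier (tensor A X F)) e (tensor_map A X G F F u (restrict id (carrier F))) = h"
      using G' e by blast
  qed
qed

lemma firm_precomp_adjoint:
  fixes A B C :: "'u ring"
  assumes A: "A \<in> Cell0 Firm" and B: "B \<in> Cell0 Firm" and C: "C \<in> Cell0 Firm"
    and F: "F \<in> Cell1 Firm A B"
  shows "has_right_adjoint (HomCat Firm B C) (HomCat Firm A C) (precomp_functor Firm A B C F)"
proof (rule has_right_adjointI)
  show "functor_between (HomCat Firm B C) (HomCat Firm A C) (precomp_functor Firm A B C F)"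
    by (rule bicategory.precomp_functor_between[OF bicategory_Firm A B C F])
  fix Y :: "('u, 'u, 'u) bimodule"
  assume "Y \<in> Obj (HomCat Firm A C)"
  then have Y: "Y \<in> Cells A C" by (simp add: Firm_simps)
  have F': "F \<in> Cells A B" using F by (simp add: Firm_simps)
  note Fb = Obj_firm_categoryD[OF F'] and Yb = Obj_firm_categoryD[OF Y]
  have rings: "firm_ring B" "small (carrier B)" "firm_ring C" "small (carrier C)"
    using B C by (simp_all add: Firm_simps)
  show "\<exists>G \<in> Obj (HomCat Firm B C).
    \<exists>e \<in> Hom (HomCat Firm A C) (fobj (precomp_functor Firm A B C F) G) Y.
      \<forall>X \<in> Obj (HomCat Firm B C). \<forall>h \<in> Hom (HomCat Firm A C) (fobj (precomp_functor Firm A B C F) X) Y.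
        \<exists>!u. u \<in> Hom (HomCat Firm B C) X G \<and>
          Comp (HomCat Firm A C) (fobj (precomp_functor Firm A B C F) X)
            (fobj (precomp_functor Firm A B C F) G) Y e (farr (precomp_functor Firm A B C F) X G u) = h"
    unfolding precomp_functor_def functor_data.simps Firm_simps firm_category_simps(2-4) firm_hcomp_simps
  proof (rule left_residual[OF U rings Fb(1,4) Yb(1,4)])
    fix G :: "('u, 'u, 'u) bimodule" and \<epsilon>
    assume G: "firm_bimodule B C G" "small (carrier G)" and \<epsilon>: "bilinear A B C F G Y \<epsilon>"
      and univ: "\<And>(X :: ('u, 'u, 'u) bimodule) k. \<lbrakk>firm_bimodule B C X; bilinear A B C F X Y k\<rbrakk> \<Longrightarrow>
        \<exists>!u. u \<in> bimodule_hom B C X G \<and> (\<forall>x \<in> carrier X. \<forall>f \<in> carrier F. k f x = \<epsilon> f (u x))"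
    have G': "G \<in> Cells B C" using G by (simp add: firm_category_simps)
    obtain e where e: "e \<in> bimodule_hom A C (tensor B F G) Y"
      and e_pure: "\<And>f g. \<lbrakk>f \<in> carrier F; g \<in> carrier G\<rbrakk> \<Longrightarrow> e (pure_tensor B F G f g) = \<epsilon> f g"
      using bitensor_the_hom[OF tensor_cell(1)[OF F' G'] Fb(1) Obj_firm_categoryD(1)[OF G'] Yb(1) \<epsilon>]
      by blast
    have "\<exists>!u. u \<in> bimodule_hom B C X G \<and>
        compose (carrier (tensor B F X)) e (tensor_map B F F X G (restrict id (carrier F)) u) = h"
      if X: "X \<in> Cells B C" and h: "h \<in> bimodule_hom A C (tensor B F X) Y" for X h
    proof -
      have "compose (carrier (tensor B F X)) e (tensor_map B F F X G (restrict id (carrier F)) u) = h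
        \<longleftrightarrow> (\<forall>x \<in> carrier X. \<forall>f \<in> carrier F. h (pure_tensor B F X f x) = \<epsilon> f (u x))"
        if u: "u \<in> bimodule_hom B C X G" for u
      proof -
        note t = tensor_map[OF F' F' X G' id_hom[OF F'] u]
        note et = compose_hom[OF tensor_cell(2)[OF F' X] t(1) e]
        have et_pure: "compose (carrier (tensor B F X)) e (tensor_map B F F X G (restrict id (carrier F)) u)
            (pure_tensor B F X f x) = \<epsilon> f (u x)" if "f \<in> carrier F" "x \<in> carrier X" for x f
          using that by (simp add: compose_eq pure_tensor_closed[OF F' X] t(2) e_pure
              bimodule_hom_closed[OF u])
        show ?thesis
          using et_pure tensor_hom_eqI[OF F' X et h] by metis
      qed
      moreover have "bilinear A B C F X Y (\<lambda>f x. h (pure_tensor B F X f x))"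
        using pure_tensor_bilinear[OF F' X] balanced_compose[OF bilinear_balanced[OF
              pure_tensor_bilinear[OF F' X]] bimodule_hom_additive[OF h]]
        by (simp add: bilinear_def bimodule_hom_smult[OF h] bimodule_hom_rsmult[OF h]
            pure_tensor_closed[OF F' X])
      ultimately show ?thesis
        using univ[of X "\<lambda>f x. h (pure_tensor B F X f x)"] X
        by (simp add: firm_category_simps cong: conj_cong)
    qed
    then show "\<exists>G \<in> Cells B C. \<exists>e \<in> bimodule_hom A C (tensor B F G) Y.
      \<forall>X \<in> Cells B C. \<forall>h \<in> bimodule_hom A C (tensor B F X) Y.
        \<exists>!u. u \<in> bimodule_hom B C X G \<and>
          compose (carrier (tensor B F X)) e (tensor_map B F F X G (restrict id (carrier F)) u) = h"
      using G' e by blast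
  qed
qed

end

theorem proposition4p11:
  assumes "universe TYPE('u)"
  shows "biclosed_bicategory (Firm :: ('u ring, ('u, 'u, 'u) bimodule, 'u \<Rightarrow> 'u) bicategory_data)"
  by (intro biclosed_bicategory.intro biclosed_bicategory_axioms.intro bicategory_Firm[OF assms]
      firm_postcomp_adjoint[OF assms] firm_precomp_adjoint[OF assms])

end
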